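(* Let $0<\varepsilon<\infty$ and $\ell>0$, and let $(X,Y)$ be given by either of the following two driftless settings. (Gaussian random walk setting) $X_0=0$, $X_t=\sum_{i=1}^t V_i$, $Y_0=0$, $Y_t=X_t+\varepsilon\sum_{i=1}^tW_i$ for integers $t\ge1$, where $V_1,V_2,\ldots$ and $W_1,W_2,\ldots$ are two independent sequences of independent standard Gaussian random variables. (Wiener process setting) $X_0=0$, $X_t=B_t$, $Y_0=0$, $Y_t=X_t+\varepsilon N_t$ for real $t>0$, where $\{B_t\}_{t\ge0}$ and $\{N_t\}_{t\ge0}$ are two independent standard Wiener processes. For $h>0$ let $\tau_h=\inf\{t\ge0:X_t\ge h\}$. Let $f(x)$, $x\ge0$, be a nonnegative and nondecreasing function such that $$\mathbb{E} f(\tau_{h}/2)=\infty \qquad ( * )$$ for some constant $h>0$. Then: (i) $\mathbb{E} f(|\tau_\ell-\eta(Y_0^\infty)|)=\infty$ for any estimator $\eta(Y_0^\infty)$. (ii) If $f(x)=x^p$ with $p\ge1/2$, then $( * )$ holds for all $h>0$. Hence $\mathbb{E}|\tau_\ell-\eta|^p=\infty$ for any estimator $\eta=\eta(Y_0^\infty)$ of $\tau_\ell$ whenever $p\ge1/2$.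
   Context: Standard Gaussian means mean zero and unit variance. An estimator $\eta(Y_0^\infty)$ is any (measurable) function of the entire observation process $Y_0^\infty$ (that is, $\{Y_t\}_{t\ge0}$ with $t$ ranging over the nonnegative integers in the random walk setting and over $[0,\infty)$ in the Wiener setting), not necessarily a stopping time. If infinite values occur, $f(\infty)$ is understood as $\sup_{x\ge 0} f(x)$. *)

theory Defs
  imports "HOL-Probability.Probability"
begin

text \<open>Time is a set \<open>T\<close> of reals: \<open>\<nat>\<close> for the random walk and \<open>{0..}\<close> for the Wiener
  process. Only the values \<open>X t\<close>, \<open>Y t\<close> with \<open>t \<in> T\<close> matter.\<close>

definition gaussian_walk_setting ::
    "'a measure \<Rightarrow> real \<Rightarrow> (real \<Rightarrow> 'a \<Rightarrow> real) \<Rightarrow> (real \<Rightarrow> 'a \<Rightarrow> real) \<Rightarrow> bool" where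
  "gaussian_walk_setting M \<epsilon> X Y \<longleftrightarrow> prob_space M \<and>
    (\<exists>V W :: nat \<Rightarrow> 'a \<Rightarrow> real.
      (\<forall>i\<ge>1. distributed M lborel (V i) std_normal_density) \<and>
      (\<forall>i\<ge>1. distributed M lborel (W i) std_normal_density) \<and>
      prob_space.indep_vars M (\<lambda>_. borel) V {1..} \<and>
      prob_space.indep_vars M (\<lambda>_. borel) W {1..} \<and>
      prob_space.indep_var M
        (PiM {1..} (\<lambda>_. borel)) (\<lambda>\<omega>. \<lambda>i\<in>{1..}. V i \<omega>)
        (PiM {1..} (\<lambda>_. borel)) (\<lambda>\<omega>. \<lambda>i\<in>{1..}. W i \<omega>) \<and>
      (\<forall>\<omega>\<in>space M. \<forall>n::nat.
        X (real n) \<omega> = (\<Sum>i=1..n. V i \<omega>) \<and>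
        Y (real n) \<omega> = X (real n) \<omega> + \<epsilon> * (\<Sum>i=1..n. W i \<omega>)))"

text \<open>Path continuity is required almost surely, which covers the convention that all paths are
  continuous. The second parameter of \<^const>\<open>normal_density\<close> is the standard deviation.\<close>

definition standard_wiener :: "'a measure \<Rightarrow> (real \<Rightarrow> 'a \<Rightarrow> real) \<Rightarrow> bool" where
  "standard_wiener M B \<longleftrightarrow>
    (\<forall>t\<ge>0. B t \<in> borel_measurable M) \<and>
    (AE \<omega> in M. B 0 \<omega> = 0) \<and>
    (\<forall>s t. 0 \<le> s \<and> s < t \<longrightarrow>
      distributed M lborel (\<lambda>\<omega>. B t \<omega> - B s \<omega>) (normal_density 0 (sqrt (t - s)))) \<and>
    (\<forall>(n::nat) (t::nat \<Rightarrow> real). 0 \<le> t 0 \<and> (\<forall>i<n. t i < t (Suc i)) \<longrightarrow>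
      prob_space.indep_vars M (\<lambda>_. borel) (\<lambda>i \<omega>. B (t (Suc i)) \<omega> - B (t i) \<omega>) {..<n}) \<and>
    (AE \<omega> in M. continuous_on {0..} (\<lambda>t. B t \<omega>))"

definition wiener_setting ::
    "'a measure \<Rightarrow> real \<Rightarrow> (real \<Rightarrow> 'a \<Rightarrow> real) \<Rightarrow> (real \<Rightarrow> 'a \<Rightarrow> real) \<Rightarrow> bool" where
  "wiener_setting M \<epsilon> X Y \<longleftrightarrow> prob_space M \<and>
    (\<exists>B N :: real \<Rightarrow> 'a \<Rightarrow> real.
      standard_wiener M B \<and> standard_wiener M N \<and>
      prob_space.indep_var M
        (PiM {0..} (\<lambda>_. borel)) (\<lambda>\<omega>. \<lambda>t\<in>{0..}. B t \<omega>)
        (PiM {0..} (\<lambda>_. borel)) (\<lambda>\<omega>. \<lambda>t\<in>{0..}. N t \<omega>) \<and>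
      (\<forall>\<omega>\<in>space M. X 0 \<omega> = 0 \<and> Y 0 \<omega> = 0 \<and>
        (\<forall>t>0. X t \<omega> = B t \<omega> \<and> Y t \<omega> = X t \<omega> + \<epsilon> * N t \<omega>)))"

text \<open>The value is \<open>\<infinity>\<close> when the level is never reached.\<close>

definition hitting_time :: "real set \<Rightarrow> (real \<Rightarrow> 'a \<Rightarrow> real) \<Rightarrow> real \<Rightarrow> 'a \<Rightarrow> ereal" where
  "hitting_time T X h \<omega> = Inf {ereal t | t. t \<in> T \<and> X t \<omega> \<ge> h}"

text \<open>Extension of a nonnegative function on \<open>{0..}\<close> to infinite arguments by
  \<open>f(\<infinity>) = sup f\<close>. It is only applied to nonnegative arguments.\<close>

definition extend_sup :: "(real \<Rightarrow> real) \<Rightarrow> ereal \<Rightarrow> ennreal" where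
  "extend_sup f x =
    (if x = \<infinity> then (SUP y\<in>{0..}. ennreal (f y)) else ennreal (f (real_of_ereal x)))"

text \<open>An estimator is a functional of the path on \<open>T\<close>, measurable for the product sigma-algebra;
  infinite estimates are allowed.\<close>

definition estimators :: "real set \<Rightarrow> ((real \<Rightarrow> real) \<Rightarrow> ereal) set" where
  "estimators T = borel_measurable (PiM T (\<lambda>_. borel))"

definition observation :: "real set \<Rightarrow> (real \<Rightarrow> 'a \<Rightarrow> real) \<Rightarrow> 'a \<Rightarrow> (real \<Rightarrow> real)" where
  "observation T Y \<omega> = (\<lambda>t\<in>T. Y t \<omega>)"

end

theory Submission
  imports Defs
begin

text \<open>Write \<open>Z = (X, (Y - X) / \<epsilon>)\<close>, a planar process with stationary independent isotropic Gaussian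
  increments. With \<open>a = (1 - \<epsilon>\<^sup>2) / (1 + \<epsilon>\<^sup>2)\<close> and \<open>b = 2\<epsilon> / (1 + \<epsilon>\<^sup>2)\<close>, the reflection
  \<open>(x, y) \<mapsto> (ax + by, bx - ay)\<close> of the plane preserves both the law of \<open>Z\<close> and the observation
  \<open>Y = x + \<epsilon> y\<close>. Hence, if \<open>\<tau>'\<close> is the hitting time of \<open>\<l>\<close> by the first component \<open>X'\<close> of the
  reflected process, \<open>|\<tau> - \<eta>(Y)|\<close> and \<open>|\<tau>' - \<eta>(Y)|\<close> have the same law, and
  \<open>f(|\<tau> - \<tau>'| / 2) \<le> f(|\<tau> - \<eta>|) + f(|\<tau>' - \<eta>|)\<close>. With positive probability, for a suitable time \<open>u\<close>,
  \<open>X\<close> has reached \<open>\<l>\<close> by \<open>u\<close> whereas \<open>X'\<close> has stayed below \<open>\<l>\<close> and is at most \<open>\<l> - h\<close> at \<open>u\<close>; then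
  \<open>\<tau>' - \<tau>\<close> is at least the time that the increments of \<open>X'\<close> after \<open>u\<close> take to reach \<open>h\<close>, which is
  distributed as \<open>\<tau>\<^sub>h\<close> and independent of the past. For the powers, Levy's maximal inequality gives
  \<open>P(\<tau>\<^sub>h \<ge> t) \<ge> P(|X\<^sub>t| < h / 2) \<ge> c / \<surd>t\<close>, so that \<open>\<tau>\<^sub>h\<close> has no moment of order \<open>1/2\<close>.\<close>

section \<open>The planar Gaussian law and its reflections\<close>

text \<open>The reflection is the one across the line spanned by \<open>(1, \<epsilon>)\<close>:
  with tan(theta) = \<epsilon>, the coefficients are a = cos(2 theta) and b = sin(2 theta). Apart
  from the identity it is the only linear isometry of the plane that fixes
  \<open>(1, \<epsilon>)\<close>, hence the only nontrivial one that preserves the observation.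
  Since \<epsilon> > 0, also b > 0: the noise component enters the reflected signal with a nonzero
  coefficient and can push it down while X rises. The separating event has to control a whole path
  of X' together with the endpoints of X and X', in discrete and in continuous time. It is assembled
  from n independent short blocks: on a short interval the constraint on the path is almost free,
  the endpoints are controlled by scaling, and repetition carries the separation to any size. No
  joint law of a running maximum and an endpoint is needed. Laws are compared on the product
  sigma-algebra, where an infimum over uncountably many times need not be measurable. Path
  functionals are therefore read at rational times, and almost sure continuity translates them
  back.\<close>

definition std_normal :: "real measure" where
  "std_normal = density lborel std_normal_density"

lemma prob_space_std_normal: "prob_space std_normal"
  unfolding std_normal_def by (rule prob_space_normal_density) simp

interpretation std_normal: prob_space std_normal
  by (rule prob_space_std_normal)

interpretation std_normal_pair: pair_prob_space std_normal std_normal ..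

lemma sets_std_normal [measurable_cong]: "sets std_normal = sets borel"
  by (simp add: std_normal_def)

lemma space_std_normal [simp]: "space std_normal = UNIV"
  by (simp add: std_normal_def)

text \<open>The centred normal law with covariance \<open>s\<close> times the identity. Defining it
  as an image of the standard pair, rather than by a density, builds the scaling by
  \<open>sqrt s\<close> into the definition.\<close>

definition gauss2 :: "real \<Rightarrow> (real \<times> real) measure" where
  "gauss2 s = distr (std_normal \<Otimes>\<^sub>M std_normal) borel (\<lambda>z. sqrt s *\<^sub>R z)"

lemma nn_integral_std_normal_pair:
  fixes g :: "real \<times> real \<Rightarrow> ennreal"
  assumes [measurable]: "g \<in> borel_measurable borel"
  shows "(\<integral>\<^sup>+z. g z \<partial>(std_normal \<Otimes>\<^sub>M std_normal)) =
    (\<integral>\<^sup>+x. \<integral>\<^sup>+y. ennreal (std_normal_density x * std_normal_density y) * g (x, y) \<partial>lborel \<partial>lborel)"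
proof -
  have [measurable]: "g \<in> borel_measurable (borel \<Otimes>\<^sub>M borel)" by (simp add: borel_prod)
  have m: "g \<in> borel_measurable (std_normal \<Otimes>\<^sub>M std_normal)" by measurable
  have "(\<integral>\<^sup>+z. g z \<partial>(std_normal \<Otimes>\<^sub>M std_normal)) = (\<integral>\<^sup>+x. \<integral>\<^sup>+y. g (x, y) \<partial>std_normal \<partial>std_normal)"
    by (rule std_normal.nn_integral_fst[OF m, symmetric])
  also have "\<dots> = (\<integral>\<^sup>+x. ennreal (std_normal_density x) * (\<integral>\<^sup>+y. g (x, y) \<partial>std_normal) \<partial>lborel)"
    unfolding std_normal_def by (subst nn_integral_density) (auto simp flip: std_normal_def)
  also have "\<dots> = (\<integral>\<^sup>+x. \<integral>\<^sup>+y. ennreal (std_normal_density x * std_normal_density y) * g (x, y) \<partial>lborel \<partial>lborel)"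
    unfolding std_normal_def
    by (intro nn_integral_cong, subst nn_integral_density)
      (auto simp: nn_integral_cmult[symmetric] ennreal_mult mult.assoc)
  finally show ?thesis .
qed

definition refl2 :: "real \<Rightarrow> real \<Rightarrow> real \<times> real \<Rightarrow> real \<times> real" where
  "refl2 a b z = (a * fst z + b * snd z, b * fst z - a * snd z)"

lemma measurable_refl2 [measurable]: "refl2 a b \<in> borel_measurable borel"
  unfolding refl2_def borel_prod[symmetric] by measurable

lemma refl2_linear: "linear (refl2 a b)"
  by (auto intro!: linearI simp: refl2_def algebra_simps)

text \<open>Two successive affine substitutions, first in the inner variable and then, after exchanging
  the order of integration, in the other one, avoid the planar change of variables formula.\<close>

lemma distr_std_normal_pair_refl2:
  assumes ab: "a\<^sup>2 + b\<^sup>2 = 1" and b: "b > 0"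
  shows "distr (std_normal \<Otimes>\<^sub>M std_normal) borel (refl2 a b) = distr (std_normal \<Otimes>\<^sub>M std_normal) borel id"
proof (rule measure_eqI)
  fix A :: "(real \<times> real) set" assume "A \<in> sets (distr (std_normal \<Otimes>\<^sub>M std_normal) borel (refl2 a b))"
  then have [measurable]: "A \<in> sets borel" by simp
  let ?g = "indicator A :: real \<times> real \<Rightarrow> ennreal"
  let ?\<phi> = std_normal_density
  have gm [measurable]: "?g \<in> borel_measurable (borel \<Otimes>\<^sub>M borel)"
    by (simp add: borel_prod)
  have [measurable]: "refl2 a b \<in> measurable (borel \<Otimes>\<^sub>M borel) borel" "id \<in> measurable (borel \<Otimes>\<^sub>M borel) (borel :: (real \<times> real) measure)"
    by (simp_all add: borel_prod)
  have bb: "b \<noteq> 0" using b by simp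
  have aa: "a * a = 1 - b * b" using ab by (simp add: power2_eq_square)
  have "emeasure (distr (std_normal \<Otimes>\<^sub>M std_normal) borel (refl2 a b)) A
      = (\<integral>\<^sup>+z. ?g (refl2 a b z) \<partial>(std_normal \<Otimes>\<^sub>M std_normal))"
    by (simp flip: nn_integral_indicator add: nn_integral_distr)
  also have "\<dots> = (\<integral>\<^sup>+x. \<integral>\<^sup>+y. ennreal (?\<phi> x * ?\<phi> y) * ?g (a * x + b * y, b * x - a * y) \<partial>lborel \<partial>lborel)"
    by (subst nn_integral_std_normal_pair) (measurable, simp add: refl2_def)
  \<comment> \<open>For fixed \<open>x\<close> the new inner variable is
    \<open>v = a * x + b * y\<close>. The relation \<open>a\<^sup>2 + b\<^sup>2 = 1\<close> turns
    the second coordinate \<open>b * x - a * y\<close> into \<open>(x - a * v) / b\<close>.\<close>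
  also have "\<dots> = (\<integral>\<^sup>+x. \<integral>\<^sup>+v. ennreal (1 / b) * (ennreal (?\<phi> x * ?\<phi> ((v - a * x) / b)) * ?g (v, (x - a * v) / b)) \<partial>lborel \<partial>lborel)"
  proof (rule nn_integral_cong)
    fix x :: real
    have "(\<integral>\<^sup>+y. ennreal (?\<phi> x * ?\<phi> y) * ?g (a * x + b * y, b * x - a * y) \<partial>lborel) =
      ennreal (1 / b) * (\<integral>\<^sup>+v. ennreal (?\<phi> x * ?\<phi> (- (a * x / b) + (1 / b) * v)) *
         ?g (a * x + b * (- (a * x / b) + (1 / b) * v), b * x - a * (- (a * x / b) + (1 / b) * v)) \<partial>lborel)"
      using b by (subst nn_integral_real_affine[where c="1 / b" and t="- (a * x / b)"]) auto
    also have "\<dots> = (\<integral>\<^sup>+v. ennreal (1 / b) * (ennreal (?\<phi> x * ?\<phi> ((v - a * x) / b)) * ?g (v, (x - a * v) / b)) \<partial>lborel)"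
    proof (subst nn_integral_cmult[symmetric])
      have eq: "a * x + b * ((v - a * x) / b) = v"
        "b * x - a * ((v - a * x) / b) = (x - a * v) / b"
        "- (a * x / b) + (1 / b) * v = (v - a * x) / b" for v
      proof -
        have "a * (a * x) = (1 - b * b) * x" using aa by (simp add: mult.assoc[symmetric])
        then show "b * x - a * ((v - a * x) / b) = (x - a * v) / b"
          using bb by (simp add: field_simps)
      qed (use bb in \<open>simp_all add: field_simps\<close>)
      show "(\<integral>\<^sup>+v. ennreal (1 / b) * (ennreal (?\<phi> x * ?\<phi> (- (a * x / b) + (1 / b) * v)) *
         ?g (a * x + b * (- (a * x / b) + (1 / b) * v), b * x - a * (- (a * x / b) + (1 / b) * v))) \<partial>lborel)
        = (\<integral>\<^sup>+v. ennreal (1 / b) * (ennreal (?\<phi> x * ?\<phi> ((v - a * x) / b)) * ?g (v, (x - a * v) / b)) \<partial>lborel)"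
        by (simp only: eq)
    qed measurable
    finally show "(\<integral>\<^sup>+y. ennreal (?\<phi> x * ?\<phi> y) * ?g (a * x + b * y, b * x - a * y) \<partial>lborel) = \<dots>" .
  qed
  also have "\<dots> = (\<integral>\<^sup>+v. \<integral>\<^sup>+x. ennreal (1 / b) * (ennreal (?\<phi> x * ?\<phi> ((v - a * x) / b)) * ?g (v, (x - a * v) / b)) \<partial>lborel \<partial>lborel)"
    by (rule lborel_pair.Fubini'[symmetric]) measurable
  \<comment> \<open>Now \<open>v\<close> is fixed and \<open>x = a * v + b * w\<close>. The Jacobian
    \<open>b\<close> cancels the factor \<open>1 / b\<close> of the first substitution.\<close>
  also have "\<dots> = (\<integral>\<^sup>+v. \<integral>\<^sup>+w. ennreal (?\<phi> v * ?\<phi> w) * ?g (v, w) \<partial>lborel \<partial>lborel)"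
  proof (rule nn_integral_cong)
    fix v :: real
    have dens: "?\<phi> (a * v + b * w) * ?\<phi> ((v - a * (a * v + b * w)) / b) = ?\<phi> v * ?\<phi> w" for w
    proof -
      have "a * (a * v) = (1 - b * b) * v" using aa by (simp add: mult.assoc[symmetric])
      then have 1: "(v - a * (a * v + b * w)) / b = b * v - a * w"
        using bb by (simp add: field_simps)
      \<comment> \<open>The map is an isometry, and the product density depends only on the
        Euclidean norm.\<close>
      have "(a * v + b * w)\<^sup>2 + (b * v - a * w)\<^sup>2 = (a\<^sup>2 + b\<^sup>2) * (v\<^sup>2 + w\<^sup>2)"
        by (simp add: power2_eq_square algebra_simps)
      then have "(a * v + b * w)\<^sup>2 + (b * v - a * w)\<^sup>2 = v\<^sup>2 + w\<^sup>2" using ab by simp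
      then have "- (a * v + b * w)\<^sup>2 / 2 + - (b * v - a * w)\<^sup>2 / 2 = - v\<^sup>2 / 2 + - w\<^sup>2 / 2" by argo
      then have "exp (- (a * v + b * w)\<^sup>2 / 2) * exp (- (b * v - a * w)\<^sup>2 / 2) = exp (- v\<^sup>2 / 2) * exp (- w\<^sup>2 / 2)"
        by (simp only: exp_add[symmetric])
      then show ?thesis
        unfolding 1 by (simp add: std_normal_density_def)
    qed
    have "(\<integral>\<^sup>+x. ennreal (1 / b) * (ennreal (?\<phi> x * ?\<phi> ((v - a * x) / b)) * ?g (v, (x - a * v) / b)) \<partial>lborel)
      = ennreal b * (\<integral>\<^sup>+w. ennreal (1 / b) * (ennreal (?\<phi> (a * v + b * w) * ?\<phi> ((v - a * (a * v + b * w)) / b))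
           * ?g (v, (a * v + b * w - a * v) / b)) \<partial>lborel)"
      using b by (subst nn_integral_real_affine[where c=b and t="a * v"]) auto
    also have "\<dots> = (\<integral>\<^sup>+w. ennreal b * (ennreal (1 / b) * (ennreal (?\<phi> v * ?\<phi> w) * ?g (v, w))) \<partial>lborel)"
      using bb by (simp only: dens) (subst nn_integral_cmult[symmetric], simp_all)
    also have "\<dots> = (\<integral>\<^sup>+w. ennreal (?\<phi> v * ?\<phi> w) * ?g (v, w) \<partial>lborel)"
      using b by (simp add: mult.assoc[symmetric] ennreal_mult[symmetric])
    finally show "(\<integral>\<^sup>+x. ennreal (1 / b) * (ennreal (?\<phi> x * ?\<phi> ((v - a * x) / b)) * ?g (v, (x - a * v) / b)) \<partial>lborel) = \<dots>" .
  qed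
  also have "\<dots> = (\<integral>\<^sup>+z. ?g z \<partial>(std_normal \<Otimes>\<^sub>M std_normal))"
    by (subst nn_integral_std_normal_pair) simp_all
  also have "\<dots> = emeasure (distr (std_normal \<Otimes>\<^sub>M std_normal) borel id) A"
    by (simp flip: nn_integral_indicator add: nn_integral_distr)
  finally show "emeasure (distr (std_normal \<Otimes>\<^sub>M std_normal) borel (refl2 a b)) A =
      emeasure (distr (std_normal \<Otimes>\<^sub>M std_normal) borel id) A" .
qed simp

lemma sets_gauss2 [simp, measurable_cong]: "sets (gauss2 s) = sets borel"
  by (simp add: gauss2_def)

lemma measurable_scaleR_std_normal_pair [measurable]:
  "(\<lambda>z. c *\<^sub>R z) \<in> measurable (std_normal \<Otimes>\<^sub>M std_normal) (borel :: (real \<times> real) measure)"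
proof -
  have "(\<lambda>z. c *\<^sub>R z) \<in> measurable (borel \<Otimes>\<^sub>M borel) (borel :: (real \<times> real) measure)"
    by (simp add: borel_prod)
  then show ?thesis by measurable
qed

text \<open>A linear map commutes with the scaling by \<open>sqrt s\<close>, which leaves only the
  case of unit variance.\<close>

lemma distr_gauss2_refl2:
  assumes "a\<^sup>2 + b\<^sup>2 = 1" and "b > 0"
  shows "distr (gauss2 s) borel (refl2 a b) = gauss2 s"
proof -
  have [measurable]: "refl2 a b \<in> measurable (std_normal \<Otimes>\<^sub>M std_normal) borel"
    "id \<in> measurable (std_normal \<Otimes>\<^sub>M std_normal) (borel :: (real \<times> real) measure)"
  proof -
    have "refl2 a b \<in> measurable (borel \<Otimes>\<^sub>M borel) borel" "id \<in> measurable (borel \<Otimes>\<^sub>M borel) (borel :: (real \<times> real) measure)"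
      by (simp_all add: borel_prod)
    then show "refl2 a b \<in> measurable (std_normal \<Otimes>\<^sub>M std_normal) borel"
      "id \<in> measurable (std_normal \<Otimes>\<^sub>M std_normal) (borel :: (real \<times> real) measure)" by measurable
  qed
  have "distr (gauss2 s) borel (refl2 a b) = distr (std_normal \<Otimes>\<^sub>M std_normal) borel (\<lambda>z. refl2 a b (sqrt s *\<^sub>R z))"
    unfolding gauss2_def by (subst distr_distr) (auto simp: comp_def)
  also have "\<dots> = distr (distr (std_normal \<Otimes>\<^sub>M std_normal) borel (refl2 a b)) borel (\<lambda>z. sqrt s *\<^sub>R z)"
    by (subst distr_distr) (auto simp: comp_def linear_scale[OF refl2_linear])
  also have "\<dots> = gauss2 s"
    unfolding distr_std_normal_pair_refl2[OF assms] gauss2_def by (subst distr_distr) (auto simp: comp_def)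
  finally show ?thesis .
qed

section \<open>Processes with stationary independent Gaussian increments\<close>

text \<open>A pi-system argument: preimages of the stable generators are again stable under
  intersection, and independence passes from them to the generated sigma-algebras. It will be
  applied to cylinder sets of paths.\<close>

lemma (in prob_space) indep_varI_generator:
  assumes X: "X \<in> measurable M S" and Y: "Y \<in> measurable M S'"
    and E: "sets S = sigma_sets (space S) E" "Int_stable E" "E \<subseteq> Pow (space S)"
    and F: "sets S' = sigma_sets (space S') F" "Int_stable F" "F \<subseteq> Pow (space S')"
    and eq: "\<And>A B. A \<in> E \<Longrightarrow> B \<in> F \<Longrightarrow>
      prob ((X -` A \<inter> space M) \<inter> (Y -` B \<inter> space M)) = prob (X -` A \<inter> space M) * prob (Y -` B \<inter> space M)"
  shows "indep_var S X S' Y"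
proof -
  let ?E = "{X -` A \<inter> space M |A. A \<in> E}" and ?F = "{Y -` B \<inter> space M |B. B \<in> F}"
  have "?E \<subseteq> events" using X E by (auto intro!: measurable_sets[OF X])
  moreover have "?F \<subseteq> events" using Y F by (auto intro!: measurable_sets[OF Y])
  ultimately have "indep_set ?E ?F"
    by (auto intro!: indep_setI simp: eq)
  moreover have "Int_stable ?E"
  proof (rule Int_stableI)
    fix a b assume "a \<in> ?E" "b \<in> ?E"
    then obtain A B where "A \<in> E" "B \<in> E" "a = X -` A \<inter> space M" "b = X -` B \<inter> space M" by auto
    then show "a \<inter> b \<in> ?E" using E(2) by (auto simp: Int_stable_def intro!: exI[of _ "A \<inter> B"])
  qed
  moreover have "Int_stable ?F"
  proof (rule Int_stableI)
    fix a b assume "a \<in> ?F" "b \<in> ?F"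
    then obtain A B where "A \<in> F" "B \<in> F" "a = Y -` A \<inter> space M" "b = Y -` B \<inter> space M" by auto
    then show "a \<inter> b \<in> ?F" using F(2) by (auto simp: Int_stable_def intro!: exI[of _ "A \<inter> B"])
  qed
  ultimately have "indep_set (sigma_sets (space M) ?E) (sigma_sets (space M) ?F)"
    by (rule indep_set_sigma_sets)
  moreover have "{X -` A \<inter> space M |A. A \<in> sets S} = sigma_sets (space M) ?E"
    unfolding E(1) by (rule sigma_sets_vimage_commute) (use X in \<open>auto simp: measurable_def\<close>)
  moreover have "{Y -` A \<inter> space M |A. A \<in> sets S'} = sigma_sets (space M) ?F"
    unfolding F(1) by (rule sigma_sets_vimage_commute) (use Y in \<open>auto simp: measurable_def\<close>)
  moreover have "sigma_sets (space M) (sigma_sets (space M) ?E) = sigma_sets (space M) ?E"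
    "sigma_sets (space M) (sigma_sets (space M) ?F) = sigma_sets (space M) ?F"
    by (intro sigma_sets_sigma_sets_eq; blast)+
  ultimately show ?thesis
    unfolding indep_var_eq using X Y by simp
qed

text \<open>Sorting turns an event at finitely many arbitrary times into one about successive
  increments. Having \<open>0\<close> in the set makes the chain start where the process
  vanishes.\<close>

lemma strict_chain_enumeration:
  fixes K :: "real set"
  assumes "finite K" and "K \<subseteq> {0..}" and "0 \<in> K"
  obtains n t where "t 0 = 0" and "\<And>i j. i < j \<Longrightarrow> j \<le> n \<Longrightarrow> t i < t j" and "t ` {..n::nat} = K"
proof -
  define xs where "xs = sorted_list_of_set K"
  have xs: "sorted xs" "distinct xs" "set xs = K"
    using assms by (auto simp: xs_def)
  then have len: "length xs > 0"
    using assms(3) by (auto intro: length_pos_if_in_set)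
  define n where "n = length xs - 1"
  have "i < j \<Longrightarrow> j \<le> n \<Longrightarrow> xs ! i < xs ! j" for i j
    using sorted_wrt_nth_less[of "(<)" xs i j] xs len
    by (auto simp: n_def strict_sorted_iff)
  moreover have img: "(\<lambda>i. xs ! i) ` {..n} = K"
  proof -
    have "{..n} = {..<length xs}" using len by (cases xs) (auto simp: n_def)
    then show ?thesis using xs(3) nth_image[of "length xs" xs] by (simp add: lessThan_atLeast0)
  qed
  moreover have "xs ! 0 = 0"
  proof -
    obtain j where "j < length xs" "xs ! j = 0" using assms(3) xs(3) by (metis in_set_conv_nth)
    then have "xs ! 0 \<le> 0" using xs(1) by (metis le0 sorted_iff_nth_mono)
    moreover have "xs ! 0 \<in> K" using xs(3) len nth_mem by blast
    ultimately show ?thesis using assms(2) by force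
  qed
  ultimately show ?thesis by (intro that[of "\<lambda>i. xs ! i" n])
qed

lemma sets_sums_cylinder:
  fixes B :: "nat \<Rightarrow> (real \<times> real) set"
  assumes "finite I" and "\<And>i. i \<in> I \<Longrightarrow> L i \<subseteq> K" and "\<And>i. i \<in> I \<Longrightarrow> B i \<in> sets borel"
  shows "{d \<in> space (PiM K (\<lambda>_. borel)). \<forall>i\<in>I. (\<Sum>k\<in>L i. d k) \<in> B i} \<in> sets (PiM K (\<lambda>_. borel))"
proof (rule sets.sets_Collect_finite_All)
  fix i assume i: "i \<in> I"
  then have "(\<lambda>d. \<Sum>k\<in>L i. d k :: real \<times> real) \<in> borel_measurable (PiM K (\<lambda>_. borel))"
    using assms(2)[OF i] by (intro borel_measurable_sum measurable_component_singleton) auto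
  from measurable_sets[OF this assms(3)[OF i]]
  show "{d \<in> space (PiM K (\<lambda>_. borel)). (\<Sum>k\<in>L i. d k) \<in> B i} \<in> sets (PiM K (\<lambda>_. borel))"
    by (simp add: vimage_def Int_def conj_commute)
qed fact

text \<open>The common interface through which both settings are treated at once. \<open>Z 0\<close>
  vanishes at every point of the space, not merely almost surely, so that \<open>Z\<close> is
  exactly the sum of its increments.\<close>

locale gauss2_incs = prob_space M for M :: "'a measure" +
  fixes T :: "real set" and Z :: "real \<Rightarrow> 'a \<Rightarrow> real \<times> real"
  assumes T_cases: "T = \<nat> \<or> T = {0..}"
    and Z_0: "\<omega> \<in> space M \<Longrightarrow> Z 0 \<omega> = 0"
    and Z_borel: "t \<in> T \<Longrightarrow> Z t \<in> borel_measurable M"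
    and indep_incs: "(\<And>i. i \<le> n \<Longrightarrow> c i \<in> T) \<Longrightarrow> (\<And>i. i < n \<Longrightarrow> c i < c (Suc i)) \<Longrightarrow>
      indep_vars (\<lambda>_. borel) (\<lambda>i \<omega>. Z (c (Suc i)) \<omega> - Z (c i) \<omega>) {..<n::nat}"
    and distr_inc: "s \<in> T \<Longrightarrow> t \<in> T \<Longrightarrow> s < t \<Longrightarrow> distr M borel (\<lambda>\<omega>. Z t \<omega> - Z s \<omega>) = gauss2 (t - s)"
begin

lemma T_0 [simp]: "0 \<in> T"
  and T_1 [simp]: "1 \<in> T"
  and T_nonneg: "t \<in> T \<Longrightarrow> 0 \<le> t"
  and T_add: "s \<in> T \<Longrightarrow> t \<in> T \<Longrightarrow> s + t \<in> T"
  and T_diff: "s \<in> T \<Longrightarrow> t \<in> T \<Longrightarrow> s \<le> t \<Longrightarrow> t - s \<in> T"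
  using T_cases by (auto elim: Nats_cases)

lemma T_mult_nat: "s \<in> T \<Longrightarrow> real k * s \<in> T"
  using T_cases by auto

lemma sum_increments:
  assumes "t 0 = 0" "\<omega> \<in> space M"
  shows "(\<Sum>i<j. Z (t (Suc i)) \<omega> - Z (t i) \<omega>) = Z (t j) \<omega>"
  using sum_lessThan_telescope[of "\<lambda>i. Z (t i) \<omega>" j] assms by (simp add: Z_0)

lemma distr_increments:
  assumes "n > 0" "\<And>i. i \<le> n \<Longrightarrow> t i \<in> T" "\<And>i. i < n \<Longrightarrow> t i < t (Suc i)"
  shows "distr M (PiM {..<n} (\<lambda>_. borel)) (\<lambda>\<omega>. \<lambda>i\<in>{..<n}. Z (t (Suc i)) \<omega> - Z (t i) \<omega>) =
    PiM {..<n} (\<lambda>i. gauss2 (t (Suc i) - t i))"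
proof -
  have "distr M (PiM {..<n} (\<lambda>_. borel)) (\<lambda>\<omega>. \<lambda>i\<in>{..<n}. Z (t (Suc i)) \<omega> - Z (t i) \<omega>) =
    PiM {..<n} (\<lambda>i. distr M borel (\<lambda>\<omega>. Z (t (Suc i)) \<omega> - Z (t i) \<omega>))"
    using assms by (subst indep_vars_iff_distr_eq_PiM'[symmetric])
      (auto intro!: indep_incs borel_measurable_diff Z_borel)
  also have "\<dots> = PiM {..<n} (\<lambda>i. gauss2 (t (Suc i) - t i))"
    using assms by (intro PiM_cong) (auto intro!: distr_inc)
  finally show ?thesis .
qed

text \<open>Each value of the process is a partial sum of independent Gaussian increments. The point
  is that \<open>Z\<close> no longer occurs on the right-hand side.\<close>

lemma emeasure_cylinder:
  assumes "n > 0" "t 0 = 0" "\<And>i. i \<le> n \<Longrightarrow> t i \<in> T" "\<And>i. i < n \<Longrightarrow> t i < t (Suc i)"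
    and J: "J \<subseteq> t ` {..n}" and A: "\<And>j. j \<in> J \<Longrightarrow> A j \<in> sets borel"
  shows "emeasure M {\<omega>\<in>space M. \<forall>j\<in>J. Z j \<omega> \<in> A j} =
    emeasure (PiM {..<n} (\<lambda>i. gauss2 (t (Suc i) - t i)))
      {d \<in> space (PiM {..<n} (\<lambda>_. borel)). \<forall>i\<in>{i. i \<le> n \<and> t i \<in> J}. (\<Sum>k<i. d k) \<in> A (t i)}"
    (is "_ = emeasure _ ?S")
proof -
  let ?D = "\<lambda>\<omega>. \<lambda>i\<in>{..<n}. Z (t (Suc i)) \<omega> - Z (t i) \<omega>"
  have D: "?D \<in> measurable M (PiM {..<n} (\<lambda>_. borel))"
    using assms(3) by (auto intro!: measurable_restrict borel_measurable_diff Z_borel)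
  have S: "?S \<in> sets (PiM {..<n} (\<lambda>_. borel))"
    by (rule sets_sums_cylinder) (use A in auto)
  have "emeasure (PiM {..<n} (\<lambda>i. gauss2 (t (Suc i) - t i))) ?S = emeasure (distr M (PiM {..<n} (\<lambda>_. borel)) ?D) ?S"
    using assms by (subst distr_increments) auto
  also have "\<dots> = emeasure M (?D -` ?S \<inter> space M)"
    using D S by (rule emeasure_distr)
  also have "?D -` ?S \<inter> space M = {\<omega>\<in>space M. \<forall>j\<in>J. Z j \<omega> \<in> A j}"
  proof -
    have "?D \<omega> \<in> ?S \<longleftrightarrow> (\<forall>j\<in>J. Z j \<omega> \<in> A j)" if \<omega>: "\<omega> \<in> space M" for \<omega>
    proof -
      have "(\<Sum>k<i. ?D \<omega> k) = Z (t i) \<omega>" if "i \<le> n" for i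
        using that by (subst sum_increments[of t \<omega> i, OF assms(2) \<omega>, symmetric]) (auto intro!: sum.cong)
      moreover have "?D \<omega> \<in> space (PiM {..<n} (\<lambda>_. borel))" by (simp add: space_PiM)
      ultimately have "?D \<omega> \<in> ?S \<longleftrightarrow> (\<forall>i\<in>{i. i \<le> n \<and> t i \<in> J}. Z (t i) \<omega> \<in> A (t i))"
        by auto
      also have "\<dots> \<longleftrightarrow> (\<forall>j\<in>J. Z j \<omega> \<in> A j)"
        using J by (auto 4 4 simp: subset_iff image_iff)
      finally show ?thesis .
    qed
    then show ?thesis by blast
  qed
  finally show ?thesis by simp
qed

definition path :: "'a \<Rightarrow> real \<Rightarrow> real \<times> real" where
  "path \<omega> = (\<lambda>t\<in>T. Z t \<omega>)"

lemma measurable_path [measurable]: "path \<in> measurable M (PiM T (\<lambda>_. borel))"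
  unfolding path_def by (intro measurable_restrict Z_borel)

lemma path_vimage_cylinder:
  assumes "J \<subseteq> T"
  shows "path -` prod_emb T (\<lambda>_. borel) J (Pi\<^sub>E J A) \<inter> space M = {\<omega>\<in>space M. \<forall>j\<in>J. Z j \<omega> \<in> A j}"
  using assms by (auto simp: path_def prod_emb_def PiE_iff subset_iff)

end

text \<open>Cylinder sets determine a finite measure on the product space, and
  \<open>emeasure_cylinder\<close> evaluates them by an expression common to both processes.\<close>

lemma gauss2_incs_law_unique:
  assumes M: "gauss2_incs M T Z" and M': "gauss2_incs M' T Z'"
  shows "distr M (PiM T (\<lambda>_. borel)) (gauss2_incs.path T Z) =
    distr M' (PiM T (\<lambda>_. borel)) (gauss2_incs.path T Z')"
proof -
  interpret A: gauss2_incs M T Z by fact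
  interpret B: gauss2_incs M' T Z' by fact
  show ?thesis
  proof (rule measure_eqI_PiM_infinite[where I=T and M="\<lambda>_. borel"])
    fix J and A :: "real \<Rightarrow> (real \<times> real) set"
    assume J: "finite J" "J \<subseteq> T" and A: "\<And>i. i \<in> J \<Longrightarrow> A i \<in> sets borel"
    \<comment> \<open>The extra time \<open>1\<close> ensures at least one increment even if
      \<open>J\<close> is empty or \<open>{0}\<close>; the product formula for increments needs a
      nonempty index set.\<close>
    let ?K = "insert 0 (insert 1 J)"
    have K: "?K \<subseteq> T" using J by auto
    obtain n t where t: "t 0 = 0" "\<And>i j. i < j \<Longrightarrow> j \<le> n \<Longrightarrow> t i < t j" "t ` {..n::nat} = ?K"
    proof (rule strict_chain_enumeration)
      show "finite ?K" "?K \<subseteq> {0..}" using J A.T_nonneg by auto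
    qed auto
    have "n \<noteq> 0"
    proof
      assume "n = 0"
      then have "?K = {0}" using t(1,3) by auto
      then show False by (metis insertI1 insertI2 singletonD zero_neq_one)
    qed
    moreover have "\<And>i. i \<le> n \<Longrightarrow> t i \<in> T" using t(3) K by (metis atMost_iff image_eqI subsetD)
    moreover have "\<And>i. i < n \<Longrightarrow> t i < t (Suc i)" using t(2) by auto
    moreover have "J \<subseteq> t ` {..n}" using t(3) by auto
    ultimately have "emeasure M {\<omega>\<in>space M. \<forall>j\<in>J. Z j \<omega> \<in> A j} = emeasure M' {\<omega>\<in>space M'. \<forall>j\<in>J. Z' j \<omega> \<in> A j}"
      using A t(1) by (subst A.emeasure_cylinder[of n t], simp_all) (subst B.emeasure_cylinder[of n t], simp_all)
    then show "emeasure (distr M (PiM T (\<lambda>_. borel)) A.path) (prod_emb T (\<lambda>_. borel) J (Pi\<^sub>E J A)) =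
        emeasure (distr M' (PiM T (\<lambda>_. borel)) B.path) (prod_emb T (\<lambda>_. borel) J (Pi\<^sub>E J A))"
      using J A by (subst (1 2) emeasure_distr)
        (auto intro!: sets_PiM_I simp: A.path_vimage_cylinder B.path_vimage_cylinder)
  next
    show "finite_measure (distr M (PiM T (\<lambda>_. borel)) A.path)"
      by (intro prob_space.finite_measure A.prob_space_distr A.measurable_path)
  qed simp_all
qed

section \<open>Independence of past and future, and stability under shift and reflection\<close>

context gauss2_incs
begin

text \<open>The Markov property at a fixed time. Cylinder events of the past and of the shifted path
  are functions of disjoint groups of increments along one common chain of times.\<close>

lemma indep_shift:
  assumes u: "u \<in> T"
  shows "indep_var (PiM (T \<inter> {..u}) (\<lambda>_. borel)) (\<lambda>\<omega>. \<lambda>t\<in>T \<inter> {..u}. Z t \<omega>)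
    (PiM T (\<lambda>_. borel)) (\<lambda>\<omega>. \<lambda>t\<in>T. Z (u + t) \<omega> - Z u \<omega>)"
proof (rule indep_varI_generator[where E="prod_algebra (T \<inter> {..u}) (\<lambda>_. borel)" and F="prod_algebra T (\<lambda>_. borel)"])
  show "(\<lambda>\<omega>. \<lambda>t\<in>T \<inter> {..u}. Z t \<omega>) \<in> measurable M (PiM (T \<inter> {..u}) (\<lambda>_. borel))"
    by (intro measurable_restrict Z_borel) auto
  show "(\<lambda>\<omega>. \<lambda>t\<in>T. Z (u + t) \<omega> - Z u \<omega>) \<in> measurable M (PiM T (\<lambda>_. borel))"
    using u by (intro measurable_restrict borel_measurable_diff Z_borel T_add) auto
next
  fix A B
  assume "A \<in> prod_algebra (T \<inter> {..u}) (\<lambda>_. borel :: (real \<times> real) measure)"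
    and "B \<in> prod_algebra T (\<lambda>_. borel :: (real \<times> real) measure)"
  then obtain J E J' E' where A: "A = prod_emb (T \<inter> {..u}) (\<lambda>_. borel) J (Pi\<^sub>E J E)"
    and J: "finite J" "J \<subseteq> T \<inter> {..u}" and E: "\<And>j. j \<in> J \<Longrightarrow> E j \<in> sets borel"
    and B: "B = prod_emb T (\<lambda>_. borel) J' (Pi\<^sub>E J' E')"
    and J': "finite J'" "J' \<subseteq> T" and E': "\<And>j. j \<in> J' \<Longrightarrow> E' j \<in> sets borel"
    by (elim prod_algebraE) blast
  \<comment> \<open>The chain contains the past times, the shifted future times and
    \<open>u = t m\<close> itself, so no increment straddles \<open>u\<close>: indices below
    \<open>m\<close> belong to the past and those from \<open>m\<close> on to the future.\<close>
  let ?K = "insert 0 (insert u (J \<union> (\<lambda>j. u + j) ` J'))"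
  have K: "?K \<subseteq> T" using J J' u by (auto intro: T_add)
  obtain n t where t: "t 0 = 0" "\<And>i j. i < j \<Longrightarrow> j \<le> n \<Longrightarrow> t i < t j" "t ` {..n::nat} = ?K"
  proof (rule strict_chain_enumeration)
    show "finite ?K" "?K \<subseteq> {0..}" using J J' K T_nonneg by auto
  qed auto
  obtain m where m: "m \<le> n" "t m = u" using t(3) by (metis atMost_iff imageE insertI1 insertI2)
  have tT: "\<And>i. i \<le> n \<Longrightarrow> t i \<in> T" using t(3) K by (metis atMost_iff image_eqI subsetD)
  define D where "D i \<omega> = Z (t (Suc i)) \<omega> - Z (t i) \<omega>" for i \<omega>
  have ind: "indep_vars (\<lambda>_. borel) D {..<n}"
    unfolding D_def using tT t(2) by (intro indep_incs) auto
  have ind2: "indep_var (PiM {..<m} (\<lambda>_. borel)) (\<lambda>\<omega>. \<lambda>i\<in>{..<m}. D i \<omega>)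
      (PiM {m..<n} (\<lambda>_. borel)) (\<lambda>\<omega>. \<lambda>i\<in>{m..<n}. D i \<omega>)"
    using m by (intro indep_var_restrict[OF ind]) auto
  define I1 I2 where "I1 = {i. i \<le> m \<and> t i \<in> J}" and "I2 = {i. m \<le> i \<and> i \<le> n \<and> t i - u \<in> J'}"
  have fin: "finite I1" "finite I2" by (auto simp: I1_def I2_def)
  define S1 where "S1 = {d \<in> space (PiM {..<m} (\<lambda>_. borel)). \<forall>i\<in>I1. (\<Sum>k<i. d k) \<in> E (t i)}"
  define S2 where "S2 = {d \<in> space (PiM {m..<n} (\<lambda>_. borel)). \<forall>i\<in>I2. (\<Sum>k=m..<i. d k) \<in> E' (t i - u)}"
  have S1: "S1 \<in> sets (PiM {..<m} (\<lambda>_. borel))"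
    unfolding S1_def using fin E by (intro sets_sums_cylinder) (auto simp: I1_def)
  have S2: "S2 \<in> sets (PiM {m..<n} (\<lambda>_. borel))"
    unfolding S2_def using fin E' by (intro sets_sums_cylinder) (auto simp: I2_def)
  have 1: "(\<lambda>\<omega>. \<lambda>i\<in>{..<m}. D i \<omega>) -` S1 \<inter> space M = (\<lambda>\<omega>. \<lambda>t\<in>T \<inter> {..u}. Z t \<omega>) -` A \<inter> space M"
  proof -
    have le_m: "i \<le> m" if "i \<le> n" "t i \<le> u" for i
      using t(2)[of m i] m that by (metis leD not_le_imp_less)
    have "(\<lambda>i\<in>{..<m}. D i \<omega>) \<in> S1 \<longleftrightarrow> (\<lambda>t\<in>T \<inter> {..u}. Z t \<omega>) \<in> A" if \<omega>: "\<omega> \<in> space M" for \<omega>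
    proof -
      have "(\<Sum>k<i. (\<lambda>i\<in>{..<m}. D i \<omega>) k) = Z (t i) \<omega>" if "i \<le> m" for i
        using that by (subst sum_increments[of t \<omega> i, OF t(1) \<omega>, symmetric]) (auto intro!: sum.cong simp: D_def)
      then have "(\<lambda>i\<in>{..<m}. D i \<omega>) \<in> S1 \<longleftrightarrow> (\<forall>i\<in>I1. Z (t i) \<omega> \<in> E (t i))"
        by (auto simp: S1_def space_PiM I1_def)
      also have "\<dots> \<longleftrightarrow> (\<forall>j\<in>J. Z j \<omega> \<in> E j)"
      proof
        assume L: "\<forall>i\<in>I1. Z (t i) \<omega> \<in> E (t i)"
        show "\<forall>j\<in>J. Z j \<omega> \<in> E j"
        proof
          fix j assume j: "j \<in> J"
          then have "j \<in> t ` {..n}" using t(3) by auto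
          then obtain i where "i \<le> n" "j = t i" by auto
          then show "Z j \<omega> \<in> E j" using L j J(2) le_m[of i] by (auto simp: I1_def)
        qed
      qed (auto simp: I1_def)
      also have "\<dots> \<longleftrightarrow> (\<lambda>t\<in>T \<inter> {..u}. Z t \<omega>) \<in> A"
        using J by (auto simp: A prod_emb_def PiE_iff subset_iff)
      finally show ?thesis .
    qed
    then show ?thesis by blast
  qed
  have 2: "(\<lambda>\<omega>. \<lambda>i\<in>{m..<n}. D i \<omega>) -` S2 \<inter> space M = (\<lambda>\<omega>. \<lambda>t\<in>T. Z (u + t) \<omega> - Z u \<omega>) -` B \<inter> space M"
  proof -
    have ge_m: "m \<le> i" if "i \<le> n" "u \<le> t i" for i
      using t(2)[of i m] m that by (metis leD not_le_imp_less)
    have "(\<lambda>i\<in>{m..<n}. D i \<omega>) \<in> S2 \<longleftrightarrow> (\<lambda>t\<in>T. Z (u + t) \<omega> - Z u \<omega>) \<in> B" if \<omega>: "\<omega> \<in> space M" for \<omega>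
    proof -
      have "(\<Sum>k=m..<i. (\<lambda>i\<in>{m..<n}. D i \<omega>) k) = Z (t i) \<omega> - Z u \<omega>" if "m \<le> i" "i \<le> n" for i
      proof -
        have "(\<Sum>k=m..<i. (\<lambda>i\<in>{m..<n}. D i \<omega>) k) = (\<Sum>k=m..<i. Z (t (Suc k)) \<omega> - Z (t k) \<omega>)"
          using that by (intro sum.cong) (auto simp: D_def)
        then show ?thesis
          using sum_Suc_diff'[OF that(1), of "\<lambda>k. Z (t k) \<omega>"] m(2) by simp
      qed
      then have "(\<lambda>i\<in>{m..<n}. D i \<omega>) \<in> S2 \<longleftrightarrow> (\<forall>i\<in>I2. Z (t i) \<omega> - Z u \<omega> \<in> E' (t i - u))"
        by (auto simp: S2_def space_PiM I2_def)
      also have "\<dots> \<longleftrightarrow> (\<forall>j\<in>J'. Z (u + j) \<omega> - Z u \<omega> \<in> E' j)"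
      proof
        assume L: "\<forall>i\<in>I2. Z (t i) \<omega> - Z u \<omega> \<in> E' (t i - u)"
        show "\<forall>j\<in>J'. Z (u + j) \<omega> - Z u \<omega> \<in> E' j"
        proof
          fix j assume j: "j \<in> J'"
          then have "u + j \<in> t ` {..n}" using t(3) by auto
          then obtain i where i: "i \<le> n" "u + j = t i" by auto
          moreover have "0 \<le> j" using j J'(2) T_nonneg by auto
          moreover have "t i - u = j" using i(2) by simp
          ultimately have "i \<in> I2" using j ge_m[of i] by (auto simp: I2_def)
          with \<open>t i - u = j\<close> show "Z (u + j) \<omega> - Z u \<omega> \<in> E' j" using L i(2) by metis
        qed
      next
        assume R: "\<forall>j\<in>J'. Z (u + j) \<omega> - Z u \<omega> \<in> E' j"
        show "\<forall>i\<in>I2. Z (t i) \<omega> - Z u \<omega> \<in> E' (t i - u)"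
        proof
          fix i assume "i \<in> I2"
          then have "t i - u \<in> J'" by (simp add: I2_def)
          from R[rule_format, OF this] show "Z (t i) \<omega> - Z u \<omega> \<in> E' (t i - u)" by simp
        qed
      qed
      also have "\<dots> \<longleftrightarrow> (\<lambda>t\<in>T. Z (u + t) \<omega> - Z u \<omega>) \<in> B"
        using J' by (auto simp: B prod_emb_def PiE_iff subset_iff)
      finally show ?thesis .
    qed
    then show ?thesis by blast
  qed
  have "prob ((\<lambda>x. ((\<lambda>i\<in>{..<m}. D i x), (\<lambda>i\<in>{m..<n}. D i x))) -` (S1 \<times> S2) \<inter> space M) =
    prob ((\<lambda>\<omega>. \<lambda>i\<in>{..<m}. D i \<omega>) -` S1 \<inter> space M) * prob ((\<lambda>\<omega>. \<lambda>i\<in>{m..<n}. D i \<omega>) -` S2 \<inter> space M)"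
    by (rule indep_varD[OF ind2 S1 S2])
  also have "(\<lambda>x. ((\<lambda>i\<in>{..<m}. D i x), (\<lambda>i\<in>{m..<n}. D i x))) -` (S1 \<times> S2) \<inter> space M =
      ((\<lambda>\<omega>. \<lambda>i\<in>{..<m}. D i \<omega>) -` S1 \<inter> space M) \<inter> ((\<lambda>\<omega>. \<lambda>i\<in>{m..<n}. D i \<omega>) -` S2 \<inter> space M)"
    by auto
  finally show "prob ((\<lambda>\<omega>. \<lambda>t\<in>T \<inter> {..u}. Z t \<omega>) -` A \<inter> space M \<inter> ((\<lambda>\<omega>. \<lambda>t\<in>T. Z (u + t) \<omega> - Z u \<omega>) -` B \<inter> space M)) =
      prob ((\<lambda>\<omega>. \<lambda>t\<in>T \<inter> {..u}. Z t \<omega>) -` A \<inter> space M) * prob ((\<lambda>\<omega>. \<lambda>t\<in>T. Z (u + t) \<omega> - Z u \<omega>) -` B \<inter> space M)"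
    unfolding 1 2 .
qed (use prod_algebra_sets_into_space[of "T \<inter> {..u}" "\<lambda>_. borel :: (real \<times> real) measure"]
    prod_algebra_sets_into_space[of T "\<lambda>_. borel :: (real \<times> real) measure"]
    in \<open>simp_all add: sets_PiM space_PiM Int_stable_prod_algebra\<close>)

lemma gauss2_incs_shift:
  assumes "u \<in> T"
  shows "gauss2_incs M T (\<lambda>t \<omega>. Z (u + t) \<omega> - Z u \<omega>)"
proof
  fix n :: nat and c :: "nat \<Rightarrow> real"
  assume "\<And>i. i \<le> n \<Longrightarrow> c i \<in> T" "\<And>i. i < n \<Longrightarrow> c i < c (Suc i)"
  then have "indep_vars (\<lambda>_. borel) (\<lambda>i \<omega>. Z (u + c (Suc i)) \<omega> - Z (u + c i) \<omega>) {..<n}"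
    using indep_incs[of n "\<lambda>i. u + c i"] assms by (simp add: T_add)
  then show "indep_vars (\<lambda>_. borel) (\<lambda>i \<omega>. (Z (u + c (Suc i)) \<omega> - Z u \<omega>) - (Z (u + c i) \<omega> - Z u \<omega>)) {..<n}"
    by simp
next
  fix s t assume "s \<in> T" "t \<in> T" "s < t"
  then show "distr M borel (\<lambda>\<omega>. (Z (u + t) \<omega> - Z u \<omega>) - (Z (u + s) \<omega> - Z u \<omega>)) = gauss2 (t - s)"
    using distr_inc[of "u + s" "u + t"] assms by (simp add: T_add)
qed (use T_cases assms in \<open>auto intro!: borel_measurable_diff Z_borel T_add\<close>)

lemma gauss2_incs_refl2:
  assumes ab: "a\<^sup>2 + b\<^sup>2 = 1" "b > 0"
  shows "gauss2_incs M T (\<lambda>t \<omega>. refl2 a b (Z t \<omega>))"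
proof
  fix n :: nat and c :: "nat \<Rightarrow> real"
  assume "\<And>i. i \<le> n \<Longrightarrow> c i \<in> T" "\<And>i. i < n \<Longrightarrow> c i < c (Suc i)"
  then have "indep_vars (\<lambda>_. borel) (\<lambda>i \<omega>. refl2 a b (Z (c (Suc i)) \<omega> - Z (c i) \<omega>)) {..<n}"
    by (intro indep_vars_compose2[OF indep_incs]) auto
  then show "indep_vars (\<lambda>_. borel) (\<lambda>i \<omega>. refl2 a b (Z (c (Suc i)) \<omega>) - refl2 a b (Z (c i) \<omega>)) {..<n}"
    by (simp add: linear_diff[OF refl2_linear])
next
  fix s t assume st: "s \<in> T" "t \<in> T" "s < t"
  then have [measurable]: "(\<lambda>\<omega>. Z t \<omega> - Z s \<omega>) \<in> borel_measurable M"
    by (intro borel_measurable_diff Z_borel)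
  have "distr M borel (\<lambda>\<omega>. refl2 a b (Z t \<omega>) - refl2 a b (Z s \<omega>)) =
    distr (distr M borel (\<lambda>\<omega>. Z t \<omega> - Z s \<omega>)) borel (refl2 a b)"
    by (subst distr_distr) (auto simp: comp_def linear_diff[OF refl2_linear])
  also have "\<dots> = gauss2 (t - s)"
    using st by (simp add: distr_inc distr_gauss2_refl2[OF ab])
  finally show "distr M borel (\<lambda>\<omega>. refl2 a b (Z t \<omega>) - refl2 a b (Z s \<omega>)) = gauss2 (t - s)" .
qed (use T_cases in \<open>auto intro!: measurable_compose[OF Z_borel measurable_refl2] simp: Z_0 linear_0[OF refl2_linear]\<close>)

end

section \<open>Gaussian estimates\<close>

lemma emeasure_std_normal:
  assumes [measurable]: "A \<in> sets borel"
  shows "emeasure std_normal A = (\<integral>\<^sup>+x. ennreal (std_normal_density x) * indicator A x \<partial>lborel)"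
  unfolding std_normal_def by (rule emeasure_density) auto

lemma std_normal_symmetric: "measure std_normal {d..} = measure std_normal {..-d}"
proof -
  have "emeasure std_normal {d..} = (\<integral>\<^sup>+x. ennreal (std_normal_density (- x)) * indicator {d..} (- x) \<partial>lborel)"
    by (subst emeasure_std_normal, simp, subst nn_integral_real_affine[where c="-1" and t=0]) simp_all
  also have "\<dots> = emeasure std_normal {..-d}"
    by (subst emeasure_std_normal) (auto simp: std_normal_density_def intro!: nn_integral_cong split: split_indicator)
  finally show ?thesis
    by (simp add: measure_def)
qed

lemma std_normal_halfline: "1 / 2 \<le> measure std_normal {0..}"
proof -
  have "{0..} \<union> {..0::real} = space std_normal" by auto
  then have "1 = measure std_normal ({0..} \<union> {..0})" using std_normal.prob_space by simp
  also have "\<dots> \<le> measure std_normal {0..} + measure std_normal {..0}"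
    by (rule measure_Un_le) (auto simp: sets_std_normal)
  finally show ?thesis using std_normal_symmetric[of 0] by simp
qed

text \<open>On the interval the density is at least its value at \<open>c\<close>. Using a fixed
  \<open>c\<close> instead of \<open>d\<close> keeps the bound linear in \<open>d\<close> while
  \<open>d\<close> tends to 0.\<close>

lemma std_normal_centered_interval:
  assumes "0 \<le> d" "d \<le> c"
  shows "2 * d * std_normal_density c \<le> measure std_normal {-d<..<d}"
proof -
  have "ennreal (2 * d * std_normal_density c) = ennreal (std_normal_density c) * emeasure lborel {-d<..<d}"
    using assms by (simp add: ennreal_mult[symmetric] mult.commute)
  also have "\<dots> = (\<integral>\<^sup>+x. ennreal (std_normal_density c) * indicator {-d<..<d} x \<partial>lborel)"
    by (simp add: nn_integral_cmult_indicator)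
  also have "\<dots> \<le> (\<integral>\<^sup>+x. ennreal (std_normal_density x) * indicator {-d<..<d} x \<partial>lborel)"
  proof (rule nn_integral_mono)
    fix x :: real
    have "std_normal_density c \<le> std_normal_density x" if "-d < x" "x < d"
    proof -
      have "\<bar>x\<bar> \<le> \<bar>c\<bar>" using that assms by auto
      then have "x\<^sup>2 \<le> c\<^sup>2" by (simp add: abs_le_square_iff)
      then show ?thesis by (simp add: std_normal_density_def divide_right_mono)
    qed
    then show "ennreal (std_normal_density c) * indicator {-d<..<d} x \<le> ennreal (std_normal_density x) * indicator {-d<..<d} x"
      by (auto split: split_indicator intro!: ennreal_leI)
  qed
  also have "\<dots> = emeasure std_normal {-d<..<d}"
    by (rule emeasure_std_normal[symmetric]) simp
  finally show ?thesis
    using assms by (simp add: std_normal.emeasure_eq_measure)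
qed

lemma std_normal_interval_pos:
  assumes "x < y"
  shows "0 < measure std_normal {x..y}"
proof (rule ccontr)
  assume "\<not> ?thesis"
  then have "measure std_normal {x..y} = 0" by (simp add: zero_less_measure_iff)
  then have "{x..y} \<in> null_sets std_normal"
    by (auto simp: null_sets_def std_normal.emeasure_eq_measure sets_std_normal)
  then have "AE z\<in>{x..y} in lborel. ennreal (std_normal_density z) = 0"
    unfolding std_normal_def by (subst (asm) null_sets_density_iff) auto
  then have "AE z in lborel. z \<notin> {x..y}"
  proof eventually_elim
    case (elim z)
    have "0 < std_normal_density z" by (simp add: normal_density_pos)
    with elim show ?case by (auto simp: ennreal_eq_0_iff)
  qed
  then have "emeasure lborel {x..y} = 0"
    by (subst (asm) AE_iff_measurable[of "{x..y}"]) auto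
  then show False using assms by simp
qed

section \<open>Planar events reduced to the standard normal law\<close>

lemma measure_std_normal_pair_Times:
  assumes "A \<in> sets borel" "B \<in> sets borel"
  shows "measure (std_normal \<Otimes>\<^sub>M std_normal) (A \<times> B) = measure std_normal A * measure std_normal B"
proof -
  have "emeasure (std_normal \<Otimes>\<^sub>M std_normal) (A \<times> B) = emeasure std_normal A * emeasure std_normal B"
    using assms by (intro std_normal.emeasure_pair_measure_Times) (auto simp: sets_std_normal)
  then show ?thesis by (simp add: measure_def enn2real_mult)
qed

lemma measure_gauss2:
  assumes "A \<in> sets borel"
  shows "measure (gauss2 s) A = measure (std_normal \<Otimes>\<^sub>M std_normal) {z. sqrt s *\<^sub>R z \<in> A}"
proof -
  have "{z. sqrt s *\<^sub>R z \<in> A} = (\<lambda>z. sqrt s *\<^sub>R z) -` A \<inter> space (std_normal \<Otimes>\<^sub>M std_normal)"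
    by (auto simp: space_pair_measure)
  then show ?thesis
    unfolding gauss2_def using assms by (simp add: measure_distr)
qed

lemma borel_fst_snd [measurable]:
  "fst \<in> borel_measurable (borel :: (real \<times> real) measure)"
  "snd \<in> borel_measurable (borel :: (real \<times> real) measure)"
  unfolding borel_prod[symmetric] by measurable

lemma sets_std_normal_pair: "sets (std_normal \<Otimes>\<^sub>M std_normal) = sets (borel :: (real \<times> real) measure)"
  unfolding borel_prod[symmetric] by (intro sets_pair_measure_cong sets_std_normal)

lemma gauss2_halfplane:
  assumes "0 \<le> s"
  shows "1 / 2 \<le> measure (gauss2 s) {z. 0 \<le> fst z}"
proof -
  have "1 / 2 \<le> measure (std_normal \<Otimes>\<^sub>M std_normal) ({0..} \<times> UNIV)"
    using std_normal_halfline std_normal.prob_space by (subst measure_std_normal_pair_Times) auto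
  also have "\<dots> \<le> measure (std_normal \<Otimes>\<^sub>M std_normal) {z. sqrt s *\<^sub>R z \<in> {z. 0 \<le> fst z}}"
    using assms by (intro std_normal_pair.finite_measure_mono) (auto simp: sets_std_normal_pair)
  also have "\<dots> = measure (gauss2 s) {z. 0 \<le> fst z}"
    by (intro measure_gauss2[symmetric]) measurable
  finally show ?thesis .
qed

text \<open>By symmetry, twice a tail is at most the total mass minus that of the centred interval
  of radius \<open>c / sqrt s\<close>. Since \<open>s \<ge> 1\<close>, this radius is at most
  \<open>c\<close>. The resulting decay of order \<open>1 / sqrt s\<close> is the source of the
  critical exponent 1/2.\<close>

lemma gauss2_tail:
  assumes "1 \<le> s" "0 < c"
  shows "2 * measure (gauss2 s) {z. c \<le> fst z} \<le> 1 - 2 * c * std_normal_density c / sqrt s"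
proof -
  have s: "1 \<le> sqrt s" using assms by simp
  define d where "d = c / sqrt s"
  have d: "0 \<le> d" "d \<le> c" using assms s by (auto simp: d_def divide_le_eq mult_le_cancel_left1)
  have "{z :: real \<times> real. sqrt s *\<^sub>R z \<in> {z. c \<le> fst z}} = {d..} \<times> UNIV"
    using s by (auto simp: d_def field_simps)
  moreover have "{z. c \<le> fst z} \<in> sets (borel :: (real \<times> real) measure)" by measurable
  ultimately have "measure (gauss2 s) {z. c \<le> fst z} = measure (std_normal \<Otimes>\<^sub>M std_normal) ({d..} \<times> UNIV)"
    by (simp only: measure_gauss2)
  also have "\<dots> = measure std_normal {d..}"
    using std_normal.prob_space by (subst measure_std_normal_pair_Times) auto
  finally have 1: "measure (gauss2 s) {z. c \<le> fst z} = measure std_normal {d..}" .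
  have "measure std_normal {d..} + measure std_normal {..-d} + measure std_normal {-d<..<d} \<le> 1"
  proof (cases "d = 0")
    case False
    with d have "measure std_normal {d..} + measure std_normal {..-d} = measure std_normal ({d..} \<union> {..-d})"
      by (intro std_normal.finite_measure_Union[symmetric]) (auto simp: sets_std_normal)
    also have "measure std_normal ({d..} \<union> {..-d}) + measure std_normal {-d<..<d} = measure std_normal (({d..} \<union> {..-d}) \<union> {-d<..<d})"
      using d by (intro std_normal.finite_measure_Union[symmetric]) (auto simp: sets_std_normal)
    finally show ?thesis by simp
  qed (use assms s in \<open>simp add: d_def\<close>)
  moreover have "2 * d * std_normal_density c \<le> measure std_normal {-d<..<d}"
    by (rule std_normal_centered_interval[OF d])
  ultimately show ?thesis
    unfolding 1 using std_normal_symmetric[of d] by (simp add: d_def)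
qed

text \<open>Both inequalities scale like \<open>sqrt s\<close>, so they describe one fixed event of
  the standard pair and \<open>p\<close> does not depend on \<open>s\<close>. That event has
  positive probability because \<open>b > 0\<close>: a very negative second coordinate pulls the
  reflected first coordinate down.\<close>

lemma gauss2_wedge:
  assumes "b > 0"
  obtains p where "0 < p" and
    "\<And>s. 0 < s \<Longrightarrow> p \<le> measure (gauss2 s) {z. sqrt s \<le> fst z \<and> fst (refl2 a b z) \<le> - sqrt s}"
proof
  \<comment> \<open>A rectangle inside the wedge makes the mass a product. For first coordinate in
    \<open>{1..2}\<close> and second at most \<open>K\<close>, the reflected first coordinate is at
    most \<open>2 * \<bar>a\<bar> + b * K = - 1\<close>.\<close>
  define K where "K = - (1 + 2 * \<bar>a\<bar>) / b"
  let ?p = "measure std_normal {1..2} * measure std_normal {K - 1..K}"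
  show "0 < ?p" by (simp add: std_normal_interval_pos)
  fix s :: real assume s: "0 < s"
  let ?W = "{z. sqrt s \<le> fst z \<and> fst (refl2 a b z) \<le> - sqrt s}"
  have W: "?W \<in> sets borel" by measurable
  have mW: "{z. sqrt s *\<^sub>R z \<in> ?W} \<in> sets (borel :: (real \<times> real) measure)" by measurable
  have "?p = measure (std_normal \<Otimes>\<^sub>M std_normal) ({1..2} \<times> {K - 1..K})"
    by (subst measure_std_normal_pair_Times) auto
  also have "\<dots> \<le> measure (std_normal \<Otimes>\<^sub>M std_normal) {z. sqrt s *\<^sub>R z \<in> ?W}"
  proof (intro std_normal_pair.finite_measure_mono subsetI)
    fix z :: "real \<times> real" assume "z \<in> {1..2} \<times> {K - 1..K}"
    then have x: "1 \<le> fst z" "fst z \<le> 2" and y: "snd z \<le> K" by auto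
    have "a * fst z \<le> \<bar>a\<bar> * fst z" using x by (intro mult_right_mono) auto
    also have "\<dots> \<le> \<bar>a\<bar> * 2" using x by (intro mult_left_mono) auto
    finally have "a * fst z \<le> 2 * \<bar>a\<bar>" by simp
    moreover have "b * snd z \<le> b * K" using y assms by simp
    moreover have "b * K = - (1 + 2 * \<bar>a\<bar>)" using assms by (simp add: K_def)
    ultimately have "a * fst z + b * snd z \<le> - 1" by linarith
    then have "sqrt s * (a * fst z + b * snd z) \<le> sqrt s * (- 1)"
      using s by (intro mult_left_mono) auto
    then show "z \<in> {z. sqrt s *\<^sub>R z \<in> ?W}"
      using x s by (simp add: refl2_def algebra_simps)
  qed (use mW in \<open>simp add: sets_std_normal_pair\<close>)
  also have "\<dots> = measure (gauss2 s) ?W"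
    by (rule measure_gauss2[OF W, symmetric])
  finally show "?p \<le> measure (gauss2 s) ?W" .
qed

text \<open>A version of the hitting time that is measurable on the path space: for a continuous path it
  is the limit of the times at which the open half lines above \<open>h - 1 / (m + 1)\<close> are entered, and
  these can be read off at rational times.\<close>

definition hit :: "real set \<Rightarrow> real \<Rightarrow> (real \<Rightarrow> real) \<Rightarrow> ereal" where
  "hit T h x = (SUP m. INF r\<in>T \<inter> \<rat>. if h - 1 / real (Suc m) < x r then ereal r else \<infinity>)"

lemma countable_T_Rats: "countable (T \<inter> \<rat> :: real set)"
  by (simp add: countable_Int2 countable_rat)

lemma measurable_hit:
  assumes "\<And>t. t \<in> T \<Longrightarrow> (\<lambda>\<omega>. x \<omega> t) \<in> borel_measurable N"
  shows "(\<lambda>\<omega>. hit T h (x \<omega>)) \<in> borel_measurable N"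
  unfolding hit_def
proof (intro borel_measurable_SUP borel_measurable_INF countable_T_Rats)
  fix m r assume "r \<in> T \<inter> \<rat>"
  then have [measurable]: "(\<lambda>\<omega>. x \<omega> r) \<in> borel_measurable N" using assms by auto
  show "(\<lambda>\<omega>. if h - 1 / real (Suc m) < x \<omega> r then ereal r else \<infinity>) \<in> borel_measurable N"
    by measurable
qed auto

text \<open>The bound \<open>r \<le> t\<close> is what matters later: a rational time found this way
  neither overshoots a hitting time nor leaves the interval of a block. A rational \<open>t\<close>
  serves as its own approximation, which covers discrete time; an irrational one is positive, so
  there is room on its left.\<close>

lemma rational_time_near:
  fixes x :: "real \<Rightarrow> real"
  assumes T: "T = \<nat> \<or> T = {0..}" and x: "continuous_on T x" and t: "t \<in> T" and e: "e > 0"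
  obtains r where "r \<in> T \<inter> \<rat>" "r \<le> t" "\<bar>x r - x t\<bar> < e"
proof (cases "t \<in> \<rat>")
  case True
  then show ?thesis using that[of t] t e by auto
next
  case False
  then have "T \<noteq> \<nat>" using t Nats_subset_Rats by blast
  with T have T': "T = {0..}" by simp
  have "t > 0" using t T' False by (cases "t = 0") auto
  from x t e obtain d where d: "d > 0" "\<And>y. y \<in> T \<Longrightarrow> dist y t < d \<Longrightarrow> dist (x y) (x t) < e"
    unfolding continuous_on_iff by blast
  obtain r where r: "r \<in> \<rat>" "max 0 (t - d) < r" "r < t"
    using Rats_dense_in_real[of "max 0 (t - d)" t] d \<open>t > 0\<close> by auto
  then show ?thesis using that[of r] d(2)[of r] T' by (auto simp: dist_real_def)
qed

text \<open>For one inequality, each open level below \<open>h\<close> is already exceeded at a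
  rational time not later than a time of reaching \<open>h\<close>. For the other, times at which
  the path exceeds \<open>h - 1 / (m + 1)\<close> and which lie below
  \<open>l + 1 / (m + 1)\<close>, where \<open>l\<close> is the value of \<open>hit\<close>,
  accumulate by compactness at some \<open>t \<le> l\<close> in the closed set \<open>T\<close>, and
  continuity gives \<open>h \<le> x t\<close>.\<close>

lemma hit_eq:
  fixes x :: "real \<Rightarrow> real"
  assumes T: "T = \<nat> \<or> T = {0..}" and x: "continuous_on T x"
  shows "hit T h x = Inf {ereal t |t. t \<in> T \<and> h \<le> x t}"
proof (rule antisym)
  show "hit T h x \<le> Inf {ereal t |t. t \<in> T \<and> h \<le> x t}"
    unfolding hit_def
  proof (intro SUP_least Inf_greatest)
    fix m :: nat and z assume "z \<in> {ereal t |t. t \<in> T \<and> h \<le> x t}"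
    then obtain t where t: "z = ereal t" "t \<in> T" "h \<le> x t" by auto
    obtain r where r: "r \<in> T \<inter> \<rat>" "r \<le> t" "\<bar>x r - x t\<bar> < 1 / real (Suc m)"
      by (rule rational_time_near[OF T x t(2), of "1 / real (Suc m)"]) auto
    then have "h - 1 / real (Suc m) < x r" using t(3) by linarith
    then have "(if h - 1 / real (Suc m) < x r then ereal r else \<infinity>) \<le> z" using r(2) t(1) by simp
    then show "(INF r\<in>T \<inter> \<rat>. if h - 1 / real (Suc m) < x r then ereal r else \<infinity>) \<le> z"
      using r(1) by (rule INF_lower2[rotated])
  qed
next
  let ?L = "hit T h x"
  let ?I = "\<lambda>m. INF r\<in>T \<inter> \<rat>. if h - 1 / real (Suc m) < x r then ereal r else \<infinity>"
  have T0: "\<And>t. t \<in> T \<Longrightarrow> 0 \<le> t" using T by (auto elim: Nats_cases)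
  have le: "?I m \<le> ?L" for m unfolding hit_def by (rule SUP_upper) simp
  have "0 \<le> ?I 0" by (rule INF_greatest) (auto intro: T0)
  then have L0: "0 \<le> ?L" using le[of 0] by (rule order_trans)
  show "Inf {ereal t |t. t \<in> T \<and> h \<le> x t} \<le> ?L"
  proof (cases "?L = \<infinity>")
    case False
    with L0 obtain l where l: "?L = ereal l" by (cases ?L) auto
    have "\<exists>r. r \<in> T \<and> h - 1 / real (Suc m) < x r \<and> r \<le> l + 1 / real (Suc m)" for m
    proof -
      have "?I m < ereal (l + 1 / real (Suc m))" using le[of m] l by (simp add: order_le_less_trans)
      then obtain r where r: "r \<in> T \<inter> \<rat>" "(if h - 1 / real (Suc m) < x r then ereal r else \<infinity>) < ereal (l + 1 / real (Suc m))"
        unfolding INF_less_iff by blast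
      then show ?thesis by (intro exI[of _ r]) (auto split: if_splits)
    qed
    then obtain r where r: "\<And>m. r m \<in> T" "\<And>m. h - 1 / real (Suc m) < x (r m)" "\<And>m. r m \<le> l + 1 / real (Suc m)"
      by metis
    have "closed T" using T closed_Nats by auto
    then have "compact (T \<inter> {0..l + 1})" by (intro closed_Int_compact) auto
    moreover have "r m \<in> T \<inter> {0..l + 1}" for m
    proof -
      have "1 / real (Suc m) \<le> 1" by simp
      then have "r m \<le> l + 1" using r(3)[of m] by linarith
      then show ?thesis using r(1)[of m] T0[of "r m"] by auto
    qed
    ultimately obtain t g where t: "t \<in> T" "strict_mono g" "(r \<circ> g) \<longlonglongrightarrow> t"
      unfolding compact_def by blast
    have lim0: "(\<lambda>m. 1 / real (Suc (g m))) \<longlonglongrightarrow> 0"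
      using LIMSEQ_subseq_LIMSEQ[OF LIMSEQ_Suc[OF lim_1_over_n] t(2)] by (simp add: comp_def)
    have "t \<le> l"
    proof (rule LIMSEQ_le[OF t(3)])
      show "(\<lambda>m. l + 1 / real (Suc (g m))) \<longlonglongrightarrow> l" using tendsto_add[OF tendsto_const[of l] lim0] by simp
    qed (use r(3) in auto)
    moreover have "(\<lambda>m. x (r (g m))) \<longlonglongrightarrow> x t"
      using x t r(1) unfolding continuous_on_sequentially by (auto simp: comp_def)
    then have "h \<le> x t"
    proof (rule LIMSEQ_le[rotated])
      show "(\<lambda>m. h - 1 / real (Suc (g m))) \<longlonglongrightarrow> h" using tendsto_diff[OF tendsto_const[of h] lim0] by simp
    qed (use r(2) in \<open>auto intro: less_imp_le\<close>)
    ultimately show ?thesis unfolding l using t(1) by (intro Inf_lower2[of "ereal t"]) auto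
  qed simp
qed

section \<open>Hitting times as functionals of the path and the blocks separating a path from its reflection\<close>

lemma extend_sup_mono:
  assumes f: "mono_on {0..} f" and xy: "0 \<le> x" "x \<le> y"
  shows "extend_sup f x \<le> extend_sup f y"
proof (cases x)
  case (real r)
  show ?thesis
  proof (cases y)
    case (real r')
    with \<open>x = ereal r\<close> xy mono_onD[OF f, of r r'] show ?thesis
      by (auto simp: extend_sup_def intro!: ennreal_leI)
  next
    case PInf
    with real xy show ?thesis
      by (auto simp: extend_sup_def intro!: SUP_upper)
  qed (use real xy in simp)
qed (use xy in \<open>auto simp: extend_sup_def\<close>)

text \<open>By monotonicity every superlevel set is upward closed, so it is a half line starting at
  its infimum. Whether the infimum belongs to it decides between a closed and an open half
  line.\<close>

lemma extend_sup_measurable: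
  assumes f: "mono_on {0..} f" and g [measurable]: "g \<in> borel_measurable N" and "\<And>\<omega>. 0 \<le> g \<omega>"
  shows "(\<lambda>\<omega>. extend_sup f (g \<omega>)) \<in> borel_measurable N"
proof (rule borel_measurableI_greater)
  fix y
  define U where "U = {x. 0 \<le> x \<and> y < extend_sup f x}"
  have up: "x \<in> U" if "Inf U < x" for x
  proof -
    from that have "\<exists>x'\<in>U. x' < x" by (simp only: Inf_less_iff)
    then obtain x' where "x' \<in> U" "x' < x" by (elim bexE)
    then show ?thesis using extend_sup_mono[OF f, of x' x] by (auto simp: U_def intro: less_le_trans)
  qed
  have low: "Inf U \<le> x" if "x \<in> U" for x using that by (rule Inf_lower)
  have eq: "y < extend_sup f (g \<omega>) \<longleftrightarrow> g \<omega> \<in> U" for \<omega> using assms(3) by (simp add: U_def)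
  show "{\<omega>\<in>space N. y < extend_sup f (g \<omega>)} \<in> sets N"
  proof (cases "Inf U \<in> U")
    case True
    then have "g \<omega> \<in> U \<longleftrightarrow> Inf U \<le> g \<omega>" for \<omega> using up low by (metis order.order_iff_strict)
    then show ?thesis by (simp add: eq)
  next
    case False
    then have "g \<omega> \<in> U \<longleftrightarrow> Inf U < g \<omega>" for \<omega> using up low by (metis order.order_iff_strict)
    then show ?thesis by (simp add: eq)
  qed
qed

lemma (in prob_space) nn_integral_mult_indep:
  fixes U V :: "'a \<Rightarrow> ennreal"
  assumes "indep_var borel U borel V"
  shows "(\<integral>\<^sup>+\<omega>. U \<omega> * V \<omega> \<partial>M) = (\<integral>\<^sup>+\<omega>. U \<omega> \<partial>M) * (\<integral>\<^sup>+\<omega>. V \<omega> \<partial>M)"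
proof -
  have "case_bool borel borel = (\<lambda>_. borel :: ennreal measure)" by (auto simp: fun_eq_iff split: bool.split)
  then have "indep_vars (\<lambda>_. borel) (case_bool U V) UNIV" using assms by (simp add: indep_var_def)
  from indep_vars_nn_integral[OF _ this] show ?thesis by (simp add: UNIV_bool mult.commute)
qed

lemma hit_nonneg:
  assumes "\<And>t. t \<in> T \<Longrightarrow> 0 \<le> t"
  shows "0 \<le> hit T h x"
proof -
  have "0 \<le> (INF r\<in>T \<inter> \<rat>. if h - 1 / real (Suc 0) < x r then ereal r else \<infinity>)"
    by (rule INF_greatest) (auto intro: assms)
  also have "\<dots> \<le> hit T h x"
    unfolding hit_def by (rule SUP_upper) simp
  finally show ?thesis .
qed

lemma hit_cong:
  assumes "\<And>t. t \<in> T \<Longrightarrow> x t = y t"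
  shows "hit T h x = hit T h y"
  unfolding hit_def using assms by (auto intro!: SUP_cong INF_cong)

text \<open>If one path reaches its level before time \<open>u\<close> and another one only at \<open>u + \<sigma>\<close>, then no
  number \<open>e\<close> is within \<open>\<sigma> / 2\<close> of both times.\<close>

lemma extend_sup_split:
  assumes f: "mono_on {0..} f" and "0 \<le> \<sigma>" "0 \<le> \<tau>" "\<tau> \<le> ereal u" "ereal u + \<sigma> \<le> \<tau>'"
  shows "extend_sup f (\<sigma> / 2) \<le> extend_sup f \<bar>\<tau> - e\<bar> + extend_sup f \<bar>\<tau>' - e\<bar>"
proof -
  \<comment> \<open>The triangle inequality. Since \<open>\<tau>\<close> is finite, an infinite
    \<open>e\<close> is infinitely far from \<open>\<tau>\<close>, and if \<open>e\<close> is
    finite, an infinite \<open>\<tau>'\<close> is infinitely far from \<open>e\<close>.\<close>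
  have "\<sigma> / 2 \<le> \<bar>\<tau> - e\<bar> \<or> \<sigma> / 2 \<le> \<bar>\<tau>' - e\<bar>"
    using assms(2-)
    by (cases \<sigma>; cases \<tau>; cases \<tau>'; cases e) (auto simp: abs_if split: if_splits)
  moreover have "0 \<le> \<sigma> / 2" using assms(2) by (cases \<sigma>) auto
  ultimately show ?thesis
    using extend_sup_mono[OF f, of "\<sigma> / 2"] by (meson add_increasing add_increasing2 zero_le)
qed

text \<open>The first component gains \<open>\<kappa>\<close> during \<open>[0, s]\<close> while the first component of the reflected path
  loses \<open>\<kappa>\<close> and does not exceed \<open>c\<close> in between.\<close>

definition block :: "real set \<Rightarrow> real \<Rightarrow> real \<Rightarrow> real \<Rightarrow> real \<Rightarrow> real \<Rightarrow> (real \<Rightarrow> real \<times> real) \<Rightarrow> bool" where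
  "block T a b c s \<kappa> z \<longleftrightarrow> \<kappa> \<le> fst (z s) \<and> fst (refl2 a b (z s)) \<le> - \<kappa> \<and>
    (\<forall>r\<in>T \<inter> \<rat> \<inter> {..s}. fst (refl2 a b (z r)) \<le> c)"

text \<open>The starting time \<open>q\<close> and the index set \<open>K\<close> are free, so that
  the same lemma serves for the whole path and for a block inside the past up to a fixed
  time.\<close>

lemma pred_block:
  assumes "s \<in> T" "q \<in> K" and K: "\<And>r. r \<in> T \<Longrightarrow> r \<le> s \<Longrightarrow> q + r \<in> K"
  shows "Measurable.pred (PiM K (\<lambda>_. borel)) (\<lambda>w. block T a b c s \<kappa> (\<lambda>t. w (q + t) - w q))"
proof -
  have [measurable]: "(\<lambda>w. w (q + r) - w q) \<in> borel_measurable (PiM K (\<lambda>_. borel :: (real \<times> real) measure))"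
    if "r \<in> T" "r \<le> s" for r
    using assms that by (intro borel_measurable_diff measurable_component_singleton) auto
  have [measurable]: "(\<lambda>w. w (q + s) - w q) \<in> borel_measurable (PiM K (\<lambda>_. borel :: (real \<times> real) measure))"
    using assms by auto
  have "Measurable.pred (PiM K (\<lambda>_. borel)) (\<lambda>w. \<forall>r\<in>T \<inter> \<rat> \<inter> {..s}. fst (refl2 a b (w (q + r) - w q)) \<le> c)"
    unfolding pred_def
  proof (rule sets.sets_Collect_countable_All')
    show "countable (T \<inter> \<rat> \<inter> {..s})" using countable_T_Rats by (rule countable_Int1)
    fix r assume "r \<in> T \<inter> \<rat> \<inter> {..s}"
    then have [measurable]: "(\<lambda>w. w (q + r) - w q) \<in> borel_measurable (PiM K (\<lambda>_. borel :: (real \<times> real) measure))"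
      using assms by (intro borel_measurable_diff measurable_component_singleton) auto
    show "{w\<in>space (PiM K (\<lambda>_. borel)). fst (refl2 a b (w (q + r) - w q)) \<le> c} \<in> sets (PiM K (\<lambda>_. borel))"
      by measurable
  qed
  then show ?thesis unfolding block_def by measurable
qed

text \<open>Gains and losses of successive blocks add up. Each block starts with the reflected first
  component at or below 0, so the bound \<open>c\<close> relative to the start of the block is also
  an absolute bound.\<close>

lemma blocks_path_bounds:
  fixes z :: "real \<Rightarrow> real \<times> real"
  assumes T: "T = \<nat> \<or> T = {0..}" and z: "continuous_on T z" "z 0 = 0" and s: "s \<in> T" "0 < s"
    and \<kappa>: "0 < \<kappa>" and blk: "\<And>k. k < n \<Longrightarrow> block T a b c s \<kappa> (\<lambda>t. z (real k * s + t) - z (real k * s))"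
  shows "real n * \<kappa> \<le> fst (z (real n * s))" (is ?A)
    and "fst (refl2 a b (z (real n * s))) \<le> - (real n * \<kappa>)" (is ?B)
    and "\<And>t. t \<in> T \<Longrightarrow> t < real n * s \<Longrightarrow> fst (refl2 a b (z t)) \<le> c"
proof -
  have T_add: "\<And>x y. x \<in> T \<Longrightarrow> y \<in> T \<Longrightarrow> x + y \<in> T" and T_diff: "\<And>x y. x \<in> T \<Longrightarrow> y \<in> T \<Longrightarrow> x \<le> y \<Longrightarrow> y - x \<in> T"
    and T0: "\<And>t. t \<in> T \<Longrightarrow> 0 \<le> t" and Tk: "\<And>k. real k * s \<in> T"
    using T s by (auto elim: Nats_cases)
  have rd: "refl2 a b (x - y) = refl2 a b x - refl2 a b y" for x y
    by (rule linear_diff[OF refl2_linear])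
  have AB: "real k * \<kappa> \<le> fst (z (real k * s)) \<and> fst (refl2 a b (z (real k * s))) \<le> - (real k * \<kappa>)" if "k \<le> n" for k
    using that
  proof (induction k)
    case 0
    then show ?case using z(2) by (simp add: refl2_def)
  next
    case (Suc k)
    then have "block T a b c s \<kappa> (\<lambda>t. z (real k * s + t) - z (real k * s))" by (intro blk) simp
    moreover have "real k * s + s = real (Suc k) * s" by (simp add: algebra_simps)
    ultimately show ?case using Suc by (simp add: block_def rd algebra_simps)
  qed
  then show ?A ?B by auto
  fix t assume t: "t \<in> T" "t < real n * s"
  \<comment> \<open>The index of the block that contains \<open>t\<close>.\<close>
  define k where "k = nat \<lfloor>t / s\<rfloor>"
  have "0 \<le> t / s" using T0[OF t(1)] s by simp
  then have "real k = of_int \<lfloor>t / s\<rfloor>" by (simp add: k_def)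
  then have "real k \<le> t / s" "t / s < real k + 1" by linarith+
  then have k: "real k * s \<le> t" "t \<le> real k * s + s" using s by (simp_all add: field_simps)
  have "real k < real n" using k(1) t(2) s(2) by (meson le_less_trans mult_less_cancel_right_pos)
  then have kn: "k < n" by simp
  define q where "q = real k * s"
  have q: "q \<in> T" using Tk by (simp add: q_def)
  let ?x = "\<lambda>r. fst (refl2 a b (z (q + r) - z q))"
  have "continuous_on T (\<lambda>r. z (q + r))"
    by (rule continuous_on_compose2[OF z(1)]) (auto intro!: continuous_intros T_add q)
  then have x: "continuous_on T ?x"
    unfolding refl2_def by (auto intro!: continuous_intros)
  have tq: "t - q \<in> T" "t - q \<le> s" using k T_diff[OF q t(1)] by (auto simp: q_def)
  \<comment> \<open>A block constrains rational times only; continuity extends the bound to all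
    times, approaching from the left so as to stay in the block.\<close>
  have "?x (t - q) \<le> c + e" if e: "e > 0" for e
  proof -
    obtain r where "r \<in> T \<inter> \<rat>" "r \<le> t - q" "\<bar>?x r - ?x (t - q)\<bar> < e"
      by (rule rational_time_near[where x="?x" and t="t - q", OF T x tq(1) e])
    moreover from this have "?x r \<le> c" using blk[OF kn] tq(2) by (auto simp: block_def q_def)
    ultimately show ?thesis by linarith
  qed
  then have "?x (t - q) \<le> c" by (rule field_le_epsilon)
  moreover have "fst (refl2 a b (z q)) \<le> 0"
  proof -
    have "0 \<le> real k * \<kappa>" using \<kappa> by simp
    then show ?thesis using AB[of k] kn by (auto simp: q_def)
  qed
  ultimately show "fst (refl2 a b (z t)) \<le> c" by (simp add: rd)
qed

section \<open>Equality of laws and the Markov property, stated for path functionals\<close>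

context gauss2_incs
begin

lemma distr_Z:
  assumes "t \<in> T" "0 < t"
  shows "distr M borel (Z t) = gauss2 t"
proof -
  have "distr M borel (Z t) = distr M borel (\<lambda>\<omega>. Z t \<omega> - Z 0 \<omega>)"
    by (intro distr_cong) (auto simp: Z_0)
  then show ?thesis using distr_inc[of 0 t] assms by simp
qed

lemma prob_Z:
  assumes "t \<in> T" "0 < t" "A \<in> sets borel"
  shows "prob {\<omega>\<in>space M. Z t \<omega> \<in> A} = measure (gauss2 t) A"
  using assms by (simp flip: distr_Z add: measure_distr Z_borel vimage_def Int_def conj_commute)

lemma nn_integral_path_cong:
  assumes "gauss2_incs M T Z'" and "F \<in> borel_measurable (PiM T (\<lambda>_. borel))"
  shows "(\<integral>\<^sup>+\<omega>. F (\<lambda>t\<in>T. Z' t \<omega>) \<partial>M) = (\<integral>\<^sup>+\<omega>. F (\<lambda>t\<in>T. Z t \<omega>) \<partial>M)"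
proof -
  interpret Z': gauss2_incs M T Z' by fact
  have "(\<integral>\<^sup>+\<omega>. F (Z'.path \<omega>) \<partial>M) = (\<integral>\<^sup>+w. F w \<partial>distr M (PiM T (\<lambda>_. borel)) Z'.path)"
    using assms by (intro nn_integral_distr[symmetric] Z'.measurable_path) simp
  also have "\<dots> = (\<integral>\<^sup>+w. F w \<partial>distr M (PiM T (\<lambda>_. borel)) path)"
    by (simp add: gauss2_incs_law_unique[OF assms(1) gauss2_incs_axioms])
  also have "\<dots> = (\<integral>\<^sup>+\<omega>. F (path \<omega>) \<partial>M)"
    using assms by (intro nn_integral_distr measurable_path) simp
  finally show ?thesis by (simp add: path_def Z'.path_def)
qed

lemma prob_path_cong:
  assumes "gauss2_incs M T Z'" and "Measurable.pred (PiM T (\<lambda>_. borel)) P"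
  shows "prob {\<omega>\<in>space M. P (\<lambda>t\<in>T. Z' t \<omega>)} = prob {\<omega>\<in>space M. P (\<lambda>t\<in>T. Z t \<omega>)}"
proof -
  interpret Z': gauss2_incs M T Z' by fact
  have [measurable]: "Measurable.pred (PiM T (\<lambda>_. borel)) P" by fact
  have S: "{w\<in>space (PiM T (\<lambda>_. borel)). P w} \<in> sets (PiM T (\<lambda>_. borel))" by measurable
  have "prob {\<omega>\<in>space M. P (Z'.path \<omega>)} = measure (distr M (PiM T (\<lambda>_. borel)) Z'.path) {w\<in>space (PiM T (\<lambda>_. borel)). P w}"
    using measurable_space[OF Z'.measurable_path]
    by (subst measure_distr[OF Z'.measurable_path S]) (auto intro!: arg_cong[where f=prob])
  also have "\<dots> = measure (distr M (PiM T (\<lambda>_. borel)) path) {w\<in>space (PiM T (\<lambda>_. borel)). P w}"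
    by (simp add: gauss2_incs_law_unique[OF assms(1) gauss2_incs_axioms])
  also have "\<dots> = prob {\<omega>\<in>space M. P (path \<omega>)}"
    using measurable_space[OF measurable_path]
    by (subst measure_distr[OF measurable_path S]) (auto intro!: arg_cong[where f=prob])
  finally show ?thesis by (simp add: path_def Z'.path_def)
qed

lemma prob_past_future:
  assumes u: "u \<in> T" and P: "Measurable.pred (PiM (T \<inter> {..u}) (\<lambda>_. borel)) P"
    and Q: "Measurable.pred (PiM T (\<lambda>_. borel)) Q"
  shows "prob {\<omega>\<in>space M. P (\<lambda>t\<in>T \<inter> {..u}. Z t \<omega>) \<and> Q (\<lambda>t\<in>T. Z (u + t) \<omega> - Z u \<omega>)} =
    prob {\<omega>\<in>space M. P (\<lambda>t\<in>T \<inter> {..u}. Z t \<omega>)} * prob {\<omega>\<in>space M. Q (\<lambda>t\<in>T. Z (u + t) \<omega> - Z u \<omega>)}"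
proof -
  note [measurable] = P Q
  let ?P = "{w\<in>space (PiM (T \<inter> {..u}) (\<lambda>_. borel)). P w}" and ?Q = "{w\<in>space (PiM T (\<lambda>_. borel)). Q w}"
  have "?P \<in> sets (PiM (T \<inter> {..u}) (\<lambda>_. borel))" "?Q \<in> sets (PiM T (\<lambda>_. borel))" by measurable
  from indep_varD[OF indep_shift[OF u] this] show ?thesis
    by (simp add: vimage_def Int_def space_PiM conj_commute)
qed

end

text \<open>Continuity is kept apart because comparison of laws and independence take place on the
  product sigma-algebra and do not involve it. It enters in identifying hitting times and in
  controlling paths near time 0.\<close>

locale gauss2_path = gauss2_incs +
  assumes cont: "AE \<omega> in M. continuous_on T (\<lambda>t. Z t \<omega>)"
begin

lemma gauss2_path_shift:
  assumes u: "u \<in> T"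
  shows "gauss2_path M T (\<lambda>t \<omega>. Z (u + t) \<omega> - Z u \<omega>)"
proof -
  interpret S: gauss2_incs M T "\<lambda>t \<omega>. Z (u + t) \<omega> - Z u \<omega>"
    by (rule gauss2_incs_shift[OF u])
  have "continuous_on T (\<lambda>t. Z (u + t) \<omega> - Z u \<omega>)" if "continuous_on T (\<lambda>t. Z t \<omega>)" for \<omega>
  proof -
    have "continuous_on T (\<lambda>t. Z (u + t) \<omega>)"
      by (rule continuous_on_compose2[OF that]) (auto intro!: continuous_intros T_add u)
    then show ?thesis by (intro continuous_intros)
  qed
  then show ?thesis using cont by unfold_locales auto
qed

lemma gauss2_path_refl2:
  assumes "a\<^sup>2 + b\<^sup>2 = 1" "b > 0"
  shows "gauss2_path M T (\<lambda>t \<omega>. refl2 a b (Z t \<omega>))"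
proof -
  interpret S: gauss2_incs M T "\<lambda>t \<omega>. refl2 a b (Z t \<omega>)"
    by (rule gauss2_incs_refl2[OF assms])
  have "continuous_on T (\<lambda>t. refl2 a b (Z t \<omega>))" if "continuous_on T (\<lambda>t. Z t \<omega>)" for \<omega>
    unfolding refl2_def by (intro continuous_intros that)
  then show ?thesis using cont by unfold_locales auto
qed

lemma prob_wedge:
  assumes "p \<le> measure (gauss2 s) {z. sqrt s \<le> fst z \<and> fst (refl2 a b z) \<le> - sqrt s}" "s \<in> T" "0 < s"
  shows "p \<le> prob {\<omega>\<in>space M. sqrt s \<le> fst (Z s \<omega>) \<and> fst (refl2 a b (Z s \<omega>)) \<le> - sqrt s}"
proof -
  have "{z. sqrt s \<le> fst z \<and> fst (refl2 a b z) \<le> - sqrt s} \<in> sets borel" by measurable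
  from prob_Z[OF assms(2,3) this] show ?thesis using assms(1) by simp
qed

text \<open>In continuous time the reflected path stays below \<open>c\<close> up to a short time \<open>s\<close> with
  probability close to one, whereas by Brownian scaling the constraint at time \<open>s\<close> has a probability
  not depending on \<open>s\<close>.\<close>

lemma block_prob_pos:
  assumes b: "b > 0" and c: "c > 0"
  obtains s \<kappa> where "s \<in> T" "0 < s" "0 < \<kappa>" "0 < prob {\<omega>\<in>space M. block T a b c s \<kappa> (\<lambda>t. Z t \<omega>)}"
proof -
  obtain p where p: "0 < p" "\<And>s. 0 < s \<Longrightarrow> p \<le> measure (gauss2 s) {z. sqrt s \<le> fst z \<and> fst (refl2 a b z) \<le> - sqrt s}"
    using gauss2_wedge[OF b] by metis
  define W where "W s = {\<omega>\<in>space M. sqrt s \<le> fst (Z s \<omega>) \<and> fst (refl2 a b (Z s \<omega>)) \<le> - sqrt s}" for s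
  have W: "p \<le> prob (W s)" if "s \<in> T" "0 < s" for s
    unfolding W_def by (rule prob_wedge[OF p(2)]) (use that in auto)
  have Wm: "W s \<in> events" if "s \<in> T" for s
    using Z_borel[OF that] unfolding W_def by measurable
  define E where "E s = {\<omega>\<in>space M. block T a b c s (sqrt s) (\<lambda>t. Z t \<omega>)}" for s
  have Em: "E s \<in> events" if "s \<in> T" for s
  proof -
    have m: "Measurable.pred (PiM T (\<lambda>_. borel)) (\<lambda>w. block T a b c s (sqrt s) (\<lambda>t. w (0 + t) - w 0))"
      by (rule pred_block) (use that in auto)
    have "{\<omega>\<in>space M. block T a b c s (sqrt s) (\<lambda>t. path \<omega> (0 + t) - path \<omega> 0)} \<in> events"
      using measurable_compose[OF measurable_path m] by simp
    also have "{\<omega>\<in>space M. block T a b c s (sqrt s) (\<lambda>t. path \<omega> (0 + t) - path \<omega> 0)} = E s"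
      unfolding E_def using that by (intro Collect_cong conj_cong refl) (auto simp: block_def path_def Z_0)
    finally show ?thesis .
  qed
  from T_cases show ?thesis
  proof
    assume T: "T = \<nat>"
    \<comment> \<open>In discrete time a single step is a block: the only times involved are 0 and
      1, and at time 1 the reflected component is already negative.\<close>
    have "W 1 \<subseteq> E 1"
    proof
      fix \<omega> assume \<omega>: "\<omega> \<in> W 1"
      have "fst (refl2 a b (Z r \<omega>)) \<le> c" if r: "r \<in> T \<inter> \<rat> \<inter> {..1}" for r
      proof -
        from r obtain k where k: "r = real k" "real k \<le> 1" using T by (auto elim: Nats_cases)
        then have "r = 0 \<or> r = 1" by (cases k) auto
        moreover have "fst (refl2 a b (Z 0 \<omega>)) = 0" using \<omega> by (simp add: W_def Z_0 refl2_def)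
        ultimately show ?thesis using \<omega> c by (auto simp: W_def)
      qed
      then show "\<omega> \<in> E 1" using \<omega> by (auto simp: E_def W_def block_def)
    qed
    then have "prob (W 1) \<le> prob (E 1)" using Em by (intro finite_measure_mono) auto
    then have "0 < prob (E 1)" using W[of 1] p(1) by auto
    then show ?thesis by (intro that[of 1 "sqrt 1"]) (auto simp: E_def)
  next
    assume T: "T = {0..}"
    \<comment> \<open>The bad events decrease to a null set, since a continuous path starting at 0
      stays below \<open>c > 0\<close> for a while.\<close>
    define U where "U k = {\<omega>\<in>space M. \<exists>r\<in>T \<inter> \<rat> \<inter> {..1 / real (Suc k)}. c < fst (refl2 a b (Z r \<omega>))}" for k
    have Um: "U k \<in> events" for k
      unfolding U_def
    proof (rule sets.sets_Collect_countable_Ex')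
      show "countable (T \<inter> \<rat> \<inter> {..1 / real (Suc k)})" by (rule countable_Int1[OF countable_T_Rats])
      fix r assume "r \<in> T \<inter> \<rat> \<inter> {..1 / real (Suc k)}"
      then have [measurable]: "Z r \<in> borel_measurable M" by (intro Z_borel) auto
      show "{\<omega>\<in>space M. c < fst (refl2 a b (Z r \<omega>))} \<in> events" by measurable
    qed
    have "decseq U"
    proof (rule decseq_SucI)
      fix k show "U (Suc k) \<subseteq> U k"
      proof
        fix \<omega> assume "\<omega> \<in> U (Suc k)"
        then obtain r where r: "\<omega> \<in> space M" "r \<in> T \<inter> \<rat>" "r \<le> 1 / real (Suc (Suc k))" "c < fst (refl2 a b (Z r \<omega>))"
          by (auto simp: U_def)
        have "1 / real (Suc (Suc k)) \<le> 1 / real (Suc k)" by (intro divide_left_mono) auto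
        then have "r \<le> 1 / real (Suc k)" using r(3) by linarith
        then show "\<omega> \<in> U k" using r by (auto simp: U_def)
      qed
    qed
    moreover have "prob (\<Inter>k. U k) = 0"
    proof -
      have "AE \<omega> in M. \<omega> \<notin> (\<Inter>k. U k)"
        using cont AE_space
      proof eventually_elim
        case (elim \<omega>)
        have "continuous_on T (\<lambda>t. fst (refl2 a b (Z t \<omega>)))"
          unfolding refl2_def using elim(1) by (auto intro!: continuous_intros)
        moreover have "fst (refl2 a b (Z 0 \<omega>)) = 0" using elim(2) by (simp add: Z_0 refl2_def)
        ultimately obtain d where d: "d > 0" "\<And>t. t \<in> T \<Longrightarrow> \<bar>t\<bar> < d \<Longrightarrow> \<bar>fst (refl2 a b (Z t \<omega>))\<bar> < c"
          using c T_0 unfolding continuous_on_iff dist_real_def by (metis diff_zero)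
        obtain k where k: "1 / real (Suc k) < d" using d(1) nat_approx_posE by blast
        have "\<omega> \<notin> U k"
        proof
          assume "\<omega> \<in> U k"
          then obtain r where r: "r \<in> T" "r \<le> 1 / real (Suc k)" "c < fst (refl2 a b (Z r \<omega>))"
            by (auto simp: U_def)
          then show False using d(2)[of r] k T_nonneg[of r] by auto
        qed
        then show ?case by blast
      qed
      moreover have "(\<Inter>k. U k) \<in> events" using Um by auto
      ultimately show ?thesis using prob_eq_0 by blast
    qed
    ultimately have "(\<lambda>k. prob (U k)) \<longlonglongrightarrow> 0"
      using finite_Lim_measure_decseq[of U] Um by auto
    then have "eventually (\<lambda>k. prob (U k) < p) sequentially" using p(1) by (rule order_tendstoD)
    then obtain k where k: "prob (U k) < p" by (auto simp: eventually_sequentially)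
    define s where "s = 1 / real (Suc k)"
    have s: "s \<in> T" "0 < s" using T by (auto simp: s_def)
    \<comment> \<open>The endpoint event has probability at least \<open>p\<close> and the bad event
      less than \<open>p\<close>, so what remains has positive probability.\<close>
    have "W s \<subseteq> E s \<union> U k"
      by (auto simp: W_def E_def U_def block_def not_le s_def)
    then have "prob (W s) \<le> prob (E s \<union> U k)" using Em[OF s(1)] Um by (intro finite_measure_mono) auto
    also have "\<dots> \<le> prob (E s) + prob (U k)" using Em[OF s(1)] Um by (intro measure_Un_le) auto
    finally have "0 < prob (E s)" using W[OF s] k by linarith
    then show ?thesis using s by (intro that[of s "sqrt s"]) (auto simp: E_def)
  qed
qed

lemma pred_blocks:
  assumes "s \<in> T" "0 < s"
  shows "Measurable.pred (PiM (T \<inter> {..real n * s}) (\<lambda>_. borel))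
    (\<lambda>w. \<forall>k<n. block T a b c s \<kappa> (\<lambda>t. w (real k * s + t) - w (real k * s)))"
proof -
  have "Measurable.pred (PiM (T \<inter> {..real n * s}) (\<lambda>_. borel))
    (\<lambda>w. block T a b c s \<kappa> (\<lambda>t. w (real k * s + t) - w (real k * s)))" if k: "k < n" for k
  proof (rule pred_block)
    have "real (Suc k) * s \<le> real n * s" using k assms by (intro mult_right_mono) auto
    then have *: "real k * s + s \<le> real n * s" by (simp add: algebra_simps)
    have "real k * s \<le> real n * s" using * assms(2) by linarith
    then show "real k * s \<in> T \<inter> {..real n * s}" using T_mult_nat[OF assms(1)] by (simp del: mult_le_cancel_right mult_le_cancel_right_pos)
    fix r assume "r \<in> T" "r \<le> s"
    then show "real k * s + r \<in> T \<inter> {..real n * s}" using * assms T_mult_nat by (auto intro!: T_add)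
  qed (rule assms)
  then show ?thesis by measurable
qed

lemma blocks_restrict:
  assumes "s \<in> T" "0 < s"
  shows "(\<forall>k<n. block T a b c s \<kappa> (\<lambda>t. (\<lambda>t\<in>T \<inter> {..real n * s}. Z t \<omega>) (real k * s + t) - (\<lambda>t\<in>T \<inter> {..real n * s}. Z t \<omega>) (real k * s)))
    \<longleftrightarrow> (\<forall>k<n. block T a b c s \<kappa> (\<lambda>t. Z (real k * s + t) \<omega> - Z (real k * s) \<omega>))"
proof (intro all_cong)
  fix k assume k: "k < n"
  have "real (Suc k) * s \<le> real n * s" using k assms by (intro mult_right_mono) auto
  then have "real k * s + r \<in> T \<inter> {..real n * s}" if "r \<in> T" "r \<le> s" for r
    using that assms T_mult_nat by (auto intro!: T_add simp: algebra_simps)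
  from this this[OF T_0] show "block T a b c s \<kappa> (\<lambda>t. (\<lambda>t\<in>T \<inter> {..real n * s}. Z t \<omega>) (real k * s + t) - (\<lambda>t\<in>T \<inter> {..real n * s}. Z t \<omega>) (real k * s))
    \<longleftrightarrow> block T a b c s \<kappa> (\<lambda>t. Z (real k * s + t) \<omega> - Z (real k * s) \<omega>)"
    using assms by (auto simp: block_def)
qed

text \<open>Induction on the number of blocks: the last one is a function of the increments after
  \<open>real n * s\<close>, which are independent of the earlier blocks and have the law of the
  original process.\<close>

lemma blocks_prob_pos:
  assumes s: "s \<in> T" "0 < s" and pos: "0 < prob {\<omega>\<in>space M. block T a b c s \<kappa> (\<lambda>t. Z t \<omega>)}"
  shows "0 < prob {\<omega>\<in>space M. \<forall>k<n. block T a b c s \<kappa> (\<lambda>t. Z (real k * s + t) \<omega> - Z (real k * s) \<omega>)}"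
proof (induction n)
  case 0
  then show ?case by (simp add: prob_space)
next
  case (Suc n)
  define P where "P w \<longleftrightarrow> (\<forall>k<n. block T a b c s \<kappa> (\<lambda>t. w (real k * s + t) - w (real k * s)))" for w
  \<comment> \<open>The form \<open>w (0 + t) - w 0\<close> matches \<open>pred_block\<close> with
    \<open>q = 0\<close>; on paths starting at 0 the subtraction changes nothing.\<close>
  define Q where "Q w \<longleftrightarrow> block T a b c s \<kappa> (\<lambda>t. w (0 + t) - w 0)" for w
  define u where "u = real n * s"
  have u: "u \<in> T" unfolding u_def using s by (intro T_mult_nat)
  have P: "Measurable.pred (PiM (T \<inter> {..u}) (\<lambda>_. borel)) P"
    unfolding P_def u_def by (rule pred_blocks[OF s])
  have Q: "Measurable.pred (PiM T (\<lambda>_. borel)) Q"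
    unfolding Q_def by (rule pred_block) (use s in auto)
  have PP: "P (\<lambda>t\<in>T \<inter> {..u}. Z t \<omega>) \<longleftrightarrow> (\<forall>k<n. block T a b c s \<kappa> (\<lambda>t. Z (real k * s + t) \<omega> - Z (real k * s) \<omega>))" for \<omega>
    unfolding P_def u_def by (rule blocks_restrict[OF s])
  have QQ: "Q (\<lambda>t\<in>T. Z (u + t) \<omega> - Z u \<omega>) \<longleftrightarrow> block T a b c s \<kappa> (\<lambda>t. Z (u + t) \<omega> - Z u \<omega>)" for \<omega>
    using s by (simp add: Q_def block_def)
  have Q0: "{\<omega>\<in>space M. Q (\<lambda>t\<in>T. Z t \<omega>)} = {\<omega>\<in>space M. block T a b c s \<kappa> (\<lambda>t. Z t \<omega>)}"
    using s by (intro Collect_cong conj_cong refl) (simp add: Q_def block_def Z_0)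
  have "prob {\<omega>\<in>space M. Q (\<lambda>t\<in>T. Z (u + t) \<omega> - Z u \<omega>)} = prob {\<omega>\<in>space M. Q (\<lambda>t\<in>T. Z t \<omega>)}"
    by (rule prob_path_cong[OF gauss2_incs_shift[OF u] Q])
  then have "0 < prob {\<omega>\<in>space M. Q (\<lambda>t\<in>T. Z (u + t) \<omega> - Z u \<omega>)}"
    using pos by (simp only: Q0)
  moreover have "0 < prob {\<omega>\<in>space M. P (\<lambda>t\<in>T \<inter> {..u}. Z t \<omega>)}"
    using Suc.IH by (simp only: PP)
  ultimately have "0 < prob {\<omega>\<in>space M. P (\<lambda>t\<in>T \<inter> {..u}. Z t \<omega>) \<and> Q (\<lambda>t\<in>T. Z (u + t) \<omega> - Z u \<omega>)}"
    by (simp add: prob_past_future[OF u P Q])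
  then show ?case
    unfolding PP QQ by (simp add: All_less_Suc u_def conj_commute)
qed

end

lemma measurable_component_fst:
  assumes "i \<in> I" and "g \<in> borel_measurable borel"
  shows "(\<lambda>w. fst (g (w i) :: real \<times> real)) \<in> borel_measurable (PiM I (\<lambda>_. borel))"
proof -
  have "(\<lambda>w. w i) \<in> measurable (PiM I (\<lambda>_. borel)) borel"
    using assms(1) by (rule measurable_component_singleton)
  with assms(2) show ?thesis by measurable
qed

section \<open>The lower bound for the estimation error\<close>

context gauss2_path
begin

lemma measurable_extend_sup_hit_half:
  fixes x :: "'c \<Rightarrow> real \<Rightarrow> real"
  assumes "mono_on {0..} f" and "\<And>t. t \<in> T \<Longrightarrow> (\<lambda>w. x w t) \<in> borel_measurable N"
  shows "(\<lambda>w. extend_sup f (hit T h (x w) / 2)) \<in> borel_measurable N"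
proof (rule extend_sup_measurable[OF assms(1)])
  have [measurable]: "(\<lambda>w. hit T h (x w)) \<in> borel_measurable N"
    by (rule measurable_hit) (rule assms(2))
  show "(\<lambda>w. hit T h (x w) / 2) \<in> borel_measurable N" by measurable
  show "0 \<le> hit T h (x w) / 2" for w
    using hit_nonneg[of T h "x w", OF T_nonneg] by (cases "hit T h (x w)") auto
qed

text \<open>The reflection \<^const>\<open>refl2\<close> preserves the law of the process and the observation, so that an
  estimator has to be close both to the hitting time of the path and to that of its reflection.\<close>

lemma estimation_error_infinite:
  assumes \<epsilon>: "\<epsilon> > 0" and \<l>: "\<l> > 0" and f: "mono_on {0..} f"
    and \<eta> [measurable]: "\<eta> \<in> borel_measurable (PiM T (\<lambda>_. borel))"
    and inf: "(\<integral>\<^sup>+\<omega>. extend_sup f (hit T h (\<lambda>t. fst (Z t \<omega>)) / 2) \<partial>M) = \<infinity>"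
  shows "(\<integral>\<^sup>+\<omega>. extend_sup f \<bar>hit T \<l> (\<lambda>t. fst (Z t \<omega>)) - \<eta> (\<lambda>t\<in>T. fst (Z t \<omega>) + \<epsilon> * snd (Z t \<omega>))\<bar> \<partial>M) = \<infinity>"
proof -
  define a where "a = (1 - \<epsilon>\<^sup>2) / (1 + \<epsilon>\<^sup>2)"
  define b where "b = 2 * \<epsilon> / (1 + \<epsilon>\<^sup>2)"
  have pos: "1 + \<epsilon>\<^sup>2 > 0" by (simp add: add_pos_nonneg)
  have b: "b > 0" using \<epsilon> pos by (simp add: b_def)
  have "(1 - \<epsilon>\<^sup>2)\<^sup>2 + (2 * \<epsilon>)\<^sup>2 = (1 + \<epsilon>\<^sup>2)\<^sup>2" by (simp add: power2_eq_square algebra_simps)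
  then have ab: "a\<^sup>2 + b\<^sup>2 = 1"
    using pos by (simp add: a_def b_def power_divide add_divide_distrib[symmetric])
  have aD: "a * (1 + \<epsilon>\<^sup>2) = 1 - \<epsilon>\<^sup>2" and bD: "b * (1 + \<epsilon>\<^sup>2) = 2 * \<epsilon>"
    using pos by (simp_all add: a_def b_def)
  \<comment> \<open>These identities say that \<open>refl2 a b\<close> fixes the vector
    \<open>(1, \<epsilon>)\<close>. Its matrix being symmetric, the pairing with that vector, which
    is the observation, is preserved.\<close>
  have "(a + \<epsilon> * b) * (1 + \<epsilon>\<^sup>2) = 1 * (1 + \<epsilon>\<^sup>2)" "(b - \<epsilon> * a) * (1 + \<epsilon>\<^sup>2) = \<epsilon> * (1 + \<epsilon>\<^sup>2)"
    unfolding distrib_right[of a] left_diff_distrib[of b] mult.assoc[of \<epsilon>] aD bD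
    by (simp_all add: power2_eq_square algebra_simps)
  moreover have "1 + \<epsilon>\<^sup>2 \<noteq> 0" using pos by simp
  ultimately have "a + \<epsilon> * b = 1" "b - \<epsilon> * a = \<epsilon>"
    using mult_right_cancel by blast+
  then have obs: "fst (refl2 a b z) + \<epsilon> * snd (refl2 a b z) = fst z + \<epsilon> * snd z" for z
  proof -
    have "fst (refl2 a b z) + \<epsilon> * snd (refl2 a b z) = (a + \<epsilon> * b) * fst z + (b - \<epsilon> * a) * snd z"
      by (simp add: refl2_def algebra_simps)
    then show ?thesis using \<open>a + \<epsilon> * b = 1\<close> \<open>b - \<epsilon> * a = \<epsilon>\<close> by simp
  qed
  \<comment> \<open>Any level strictly between 0 and \<open>\<l>\<close> would do: it must be
    positive for the blocks to have positive probability, and below \<open>\<l>\<close> to keep the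
    reflected path from hitting.\<close>
  have "\<l> / 2 > 0" using \<l> by simp
  from block_prob_pos[OF b this, of a] obtain s \<kappa> where s: "s \<in> T" "0 < s" and \<kappa>: "0 < \<kappa>"
    and blk: "0 < prob {\<omega>\<in>space M. block T a b (\<l> / 2) s \<kappa> (\<lambda>t. Z t \<omega>)}" by blast
  \<comment> \<open>\<open>n * \<kappa> \<ge> \<l>\<close> lets the path reach its level by the end
    of the blocks. \<open>n * \<kappa> \<ge> h\<close> puts the reflected path at or below
    \<open>- h\<close> there, so that reaching \<open>\<l>\<close> takes a further rise of more than
    \<open>h\<close>.\<close>
  obtain n :: nat where n: "max \<l> h / \<kappa> < real n" using reals_Archimedean2 by blast
  then have n\<kappa>: "\<l> \<le> real n * \<kappa>" "h \<le> real n * \<kappa>"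
    using \<kappa> by (simp_all add: pos_divide_less_eq)
  define u where "u = real n * s"
  have u: "u \<in> T" unfolding u_def using s by (intro T_mult_nat)
  define P where "P w \<longleftrightarrow> (\<forall>k<n. block T a b (\<l> / 2) s \<kappa> (\<lambda>t. w (real k * s + t) - w (real k * s)))" for w
  have P [measurable]: "Measurable.pred (PiM (T \<inter> {..u}) (\<lambda>_. borel)) P"
    unfolding P_def u_def by (rule pred_blocks[OF s])
  define A where "A = {\<omega>\<in>space M. P (\<lambda>t\<in>T \<inter> {..u}. Z t \<omega>)}"
  have A_eq: "A = {\<omega>\<in>space M. \<forall>k<n. block T a b (\<l> / 2) s \<kappa> (\<lambda>t. Z (real k * s + t) \<omega> - Z (real k * s) \<omega>)}"
    unfolding A_def P_def u_def by (simp only: blocks_restrict[OF s])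
  have "prob A > 0" unfolding A_eq by (rule blocks_prob_pos[OF s blk])
  have past: "(\<lambda>\<omega>. \<lambda>t\<in>T \<inter> {..u}. Z t \<omega>) \<in> measurable M (PiM (T \<inter> {..u}) (\<lambda>_. borel))"
    by (intro measurable_restrict Z_borel) auto
  have A [measurable]: "A \<in> events"
    using measurable_compose[OF past P] unfolding A_def by simp
  define e where "e \<omega> = \<eta> (\<lambda>t\<in>T. fst (Z t \<omega>) + \<epsilon> * snd (Z t \<omega>))" for \<omega>
  define \<sigma> where "\<sigma> \<omega> = hit T h (\<lambda>t. fst (refl2 a b (Z (u + t) \<omega> - Z u \<omega>)))" for \<omega>
  define \<tau> where "\<tau> \<omega> = hit T \<l> (\<lambda>t. fst (Z t \<omega>))" for \<omega>
  define \<tau>' where "\<tau>' \<omega> = hit T \<l> (\<lambda>t. fst (refl2 a b (Z t \<omega>)))" for \<omega>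
  have "AE \<omega> in M. indicator A \<omega> * extend_sup f (\<sigma> \<omega> / 2) \<le> extend_sup f \<bar>\<tau> \<omega> - e \<omega>\<bar> + extend_sup f \<bar>\<tau>' \<omega> - e \<omega>\<bar>"
    using cont AE_space
  proof eventually_elim
    case (elim \<omega>)
    show ?case
    proof (cases "\<omega> \<in> A")
      case True
      let ?z = "\<lambda>t. Z t \<omega>"
      have z: "continuous_on T ?z" "?z 0 = 0" using elim Z_0 by auto
      have bl: "block T a b (\<l> / 2) s \<kappa> (\<lambda>t. ?z (real k * s + t) - ?z (real k * s))" if "k < n" for k
        using True that unfolding A_eq by blast
      note bounds = blocks_path_bounds[where n=n, OF T_cases z s \<kappa> bl, simplified, folded u_def]
      have c1: "continuous_on T (\<lambda>t. fst (?z t))" "continuous_on T (\<lambda>t. fst (refl2 a b (?z t)))"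
        unfolding refl2_def using z(1) by (auto intro!: continuous_intros)
      have "continuous_on T (\<lambda>t. ?z (u + t))"
        by (rule continuous_on_compose2[OF z(1)]) (auto intro!: continuous_intros T_add u)
      then have c2: "continuous_on T (\<lambda>t. fst (refl2 a b (?z (u + t) - ?z u)))"
        unfolding refl2_def by (auto intro!: continuous_intros)
      have "\<tau> \<omega> \<le> ereal u"
        unfolding \<tau>_def hit_eq[OF T_cases c1(1)]
        using bounds(1) n\<kappa>(1) u by (intro Inf_lower) auto
      moreover have "ereal u + \<sigma> \<omega> \<le> \<tau>' \<omega>"
        unfolding \<tau>'_def hit_eq[OF T_cases c1(2)]
      proof (rule Inf_greatest)
        fix x assume "x \<in> {ereal t |t. t \<in> T \<and> \<l> \<le> fst (refl2 a b (?z t))}"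
        then obtain t where t: "x = ereal t" "t \<in> T" "\<l> \<le> fst (refl2 a b (?z t))" by auto
        \<comment> \<open>Before \<open>u\<close> the reflected component is at most
          \<open>\<l> / 2\<close>, hence cannot have hit.\<close>
        have ut: "u \<le> t" using bounds(3)[OF t(2)] t(3) \<l> by (cases "t < u") auto
        have "h \<le> fst (refl2 a b (?z (u + (t - u)) - ?z u))"
          using bounds(2) n\<kappa>(2) t(3) \<l> by (simp add: linear_diff[OF refl2_linear])
        then have "\<sigma> \<omega> \<le> ereal (t - u)"
          unfolding \<sigma>_def hit_eq[OF T_cases c2] using T_diff[OF u t(2) ut] by (intro Inf_lower) blast
        then have "ereal u + \<sigma> \<omega> \<le> ereal u + ereal (t - u)" by (rule add_left_mono)
        then show "ereal u + \<sigma> \<omega> \<le> x" by (simp add: t(1))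
      qed
      moreover have "0 \<le> \<sigma> \<omega>" "0 \<le> \<tau> \<omega>"
        unfolding \<sigma>_def \<tau>_def by (intro hit_nonneg T_nonneg; assumption)+
      ultimately have "extend_sup f (\<sigma> \<omega> / 2) \<le> extend_sup f \<bar>\<tau> \<omega> - e \<omega>\<bar> + extend_sup f \<bar>\<tau>' \<omega> - e \<omega>\<bar>"
        by (intro extend_sup_split[OF f])
      then show ?thesis using True by simp
    qed simp
  qed
  then have 1: "(\<integral>\<^sup>+\<omega>. indicator A \<omega> * extend_sup f (\<sigma> \<omega> / 2) \<partial>M) \<le>
      (\<integral>\<^sup>+\<omega>. extend_sup f \<bar>\<tau> \<omega> - e \<omega>\<bar> + extend_sup f \<bar>\<tau>' \<omega> - e \<omega>\<bar> \<partial>M)"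
    by (rule nn_integral_mono_AE)

  \<comment> \<open>The error as a functional of the planar path. Evaluated at the path and at its
    reflection it involves the same estimate \<open>e\<close>, because the observations coincide;
    equality of laws then gives equal integrals.\<close>
  define F where "F z = extend_sup f \<bar>hit T \<l> (\<lambda>t. fst (z t)) - \<eta> (\<lambda>t\<in>T. fst (z t) + \<epsilon> * snd (z t))\<bar>"
    for z :: "real \<Rightarrow> real \<times> real"
  have F [measurable]: "F \<in> borel_measurable (PiM T (\<lambda>_. borel))"
    unfolding F_def
  proof (rule extend_sup_measurable[OF f])
    have c: "(\<lambda>z. z t) \<in> measurable (PiM T (\<lambda>_. borel :: (real \<times> real) measure)) borel" if "t \<in> T" for t
      using that by (rule measurable_component_singleton)
    have [measurable]: "(\<lambda>z. hit T \<l> (\<lambda>t. fst (z t))) \<in> borel_measurable (PiM T (\<lambda>_. borel :: (real \<times> real) measure))"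
      by (rule measurable_hit) (use c in measurable)
    have [measurable]: "(\<lambda>z. \<lambda>t\<in>T. fst (z t) + \<epsilon> * snd (z t)) \<in> measurable (PiM T (\<lambda>_. borel :: (real \<times> real) measure)) (PiM T (\<lambda>_. borel))"
      by (intro measurable_restrict) (use c in measurable)
    show "(\<lambda>z. \<bar>hit T \<l> (\<lambda>t. fst (z t)) - \<eta> (\<lambda>t\<in>T. fst (z t) + \<epsilon> * snd (z t))\<bar>) \<in> borel_measurable (PiM T (\<lambda>_. borel))"
      by measurable
  qed simp
  have FZ: "F (\<lambda>t\<in>T. Z t \<omega>) = extend_sup f \<bar>\<tau> \<omega> - e \<omega>\<bar>" for \<omega>
  proof -
    have "hit T \<l> (\<lambda>t. fst ((\<lambda>t\<in>T. Z t \<omega>) t)) = \<tau> \<omega>" unfolding \<tau>_def by (rule hit_cong) simp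
    moreover have "(\<lambda>t\<in>T. fst ((\<lambda>t\<in>T. Z t \<omega>) t) + \<epsilon> * snd ((\<lambda>t\<in>T. Z t \<omega>) t)) = (\<lambda>t\<in>T. fst (Z t \<omega>) + \<epsilon> * snd (Z t \<omega>))"
      by (rule restrict_ext) simp
    ultimately show ?thesis by (simp only: F_def e_def)
  qed
  have FRZ: "F (\<lambda>t\<in>T. refl2 a b (Z t \<omega>)) = extend_sup f \<bar>\<tau>' \<omega> - e \<omega>\<bar>" for \<omega>
  proof -
    have "hit T \<l> (\<lambda>t. fst ((\<lambda>t\<in>T. refl2 a b (Z t \<omega>)) t)) = \<tau>' \<omega>" unfolding \<tau>'_def by (rule hit_cong) simp
    moreover have "(\<lambda>t\<in>T. fst ((\<lambda>t\<in>T. refl2 a b (Z t \<omega>)) t) + \<epsilon> * snd ((\<lambda>t\<in>T. refl2 a b (Z t \<omega>)) t)) = (\<lambda>t\<in>T. fst (Z t \<omega>) + \<epsilon> * snd (Z t \<omega>))"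
      by (rule restrict_ext) (simp add: obs)
    ultimately show ?thesis by (simp only: F_def e_def)
  qed
  interpret R: gauss2_path M T "\<lambda>t \<omega>. refl2 a b (Z t \<omega>)" by (rule gauss2_path_refl2[OF ab b])
  have m1: "(\<lambda>\<omega>. extend_sup f \<bar>\<tau> \<omega> - e \<omega>\<bar>) \<in> borel_measurable M"
    using measurable_compose[OF measurable_path F] by (simp add: path_def FZ)
  have m2: "(\<lambda>\<omega>. extend_sup f \<bar>\<tau>' \<omega> - e \<omega>\<bar>) \<in> borel_measurable M"
    using measurable_compose[OF R.measurable_path F] by (simp add: R.path_def FRZ)
  have "(\<integral>\<^sup>+\<omega>. F (\<lambda>t\<in>T. refl2 a b (Z t \<omega>)) \<partial>M) = (\<integral>\<^sup>+\<omega>. F (\<lambda>t\<in>T. Z t \<omega>) \<partial>M)"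
    by (rule nn_integral_path_cong[OF R.gauss2_incs_axioms F])
  then have 2: "(\<integral>\<^sup>+\<omega>. extend_sup f \<bar>\<tau> \<omega> - e \<omega>\<bar> + extend_sup f \<bar>\<tau>' \<omega> - e \<omega>\<bar> \<partial>M) =
      (\<integral>\<^sup>+\<omega>. extend_sup f \<bar>\<tau> \<omega> - e \<omega>\<bar> \<partial>M) + (\<integral>\<^sup>+\<omega>. extend_sup f \<bar>\<tau> \<omega> - e \<omega>\<bar> \<partial>M)"
    by (simp add: nn_integral_add[OF m1 m2] FZ FRZ)

  interpret S: gauss2_path M T "\<lambda>t \<omega>. Z (u + t) \<omega> - Z u \<omega>" by (rule gauss2_path_shift[OF u])
  have G: "(\<lambda>w. extend_sup f (hit T h (\<lambda>t. fst (w t)) / 2)) \<in> borel_measurable (PiM T (\<lambda>_. borel :: (real \<times> real) measure))"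
    by (rule measurable_extend_sup_hit_half[OF f])
      (rule measurable_component_fst[where g="\<lambda>z. z"], simp_all)
  \<comment> \<open>Two readings of \<open>\<sigma>\<close> are needed. As a function of the
    reflected increments (\<open>G\<close>) it has the law of the original hitting time; as a
    function of the increments themselves (\<open>GR\<close>) it is independent of the past.\<close>
  have GR: "(\<lambda>w. extend_sup f (hit T h (\<lambda>t. fst (refl2 a b (w t))) / 2)) \<in> borel_measurable (PiM T (\<lambda>_. borel :: (real \<times> real) measure))"
    by (rule measurable_extend_sup_hit_half[OF f])
      (rule measurable_component_fst, simp_all)
  have \<sigma>1: "hit T h (\<lambda>t. fst (refl2 a b ((\<lambda>t\<in>T. Z (u + t) \<omega> - Z u \<omega>) t))) = \<sigma> \<omega>" for \<omega>
    unfolding \<sigma>_def by (rule hit_cong) simp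
  have \<sigma>2: "hit T h (\<lambda>t. fst ((\<lambda>t\<in>T. refl2 a b (Z (u + t) \<omega> - Z u \<omega>)) t)) = \<sigma> \<omega>" for \<omega>
    unfolding \<sigma>_def by (rule hit_cong) simp
  have \<sigma>3: "hit T h (\<lambda>t. fst ((\<lambda>t\<in>T. Z t \<omega>) t)) = hit T h (\<lambda>t. fst (Z t \<omega>))" for \<omega>
    by (rule hit_cong) simp
  have "(\<integral>\<^sup>+\<omega>. extend_sup f (\<sigma> \<omega> / 2) \<partial>M) = (\<integral>\<^sup>+\<omega>. extend_sup f (hit T h (\<lambda>t. fst (Z t \<omega>)) / 2) \<partial>M)"
    using nn_integral_path_cong[OF S.gauss2_incs_refl2[OF ab b] G] by (simp only: \<sigma>2 \<sigma>3)
  then have "(\<integral>\<^sup>+\<omega>. extend_sup f (\<sigma> \<omega> / 2) \<partial>M) = \<infinity>" using inf by simp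
  have "(\<lambda>w. indicator {w\<in>space (PiM (T \<inter> {..u}) (\<lambda>_. borel)). P w} w :: ennreal) \<in> borel_measurable (PiM (T \<inter> {..u}) (\<lambda>_. borel))"
    by measurable
  from indep_var_compose[OF indep_shift[OF u] this GR]
  have "indep_var borel (\<lambda>\<omega>. indicator {w\<in>space (PiM (T \<inter> {..u}) (\<lambda>_. borel)). P w} (\<lambda>t\<in>T \<inter> {..u}. Z t \<omega>) :: ennreal)
     borel (\<lambda>\<omega>. extend_sup f (\<sigma> \<omega> / 2))"
    by (simp only: comp_def \<sigma>1)
  from nn_integral_mult_indep[OF this]
  have "(\<integral>\<^sup>+\<omega>. indicator {w\<in>space (PiM (T \<inter> {..u}) (\<lambda>_. borel)). P w} (\<lambda>t\<in>T \<inter> {..u}. Z t \<omega>) * extend_sup f (\<sigma> \<omega> / 2) \<partial>M) =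
      (\<integral>\<^sup>+\<omega>. indicator {w\<in>space (PiM (T \<inter> {..u}) (\<lambda>_. borel)). P w} (\<lambda>t\<in>T \<inter> {..u}. Z t \<omega>) \<partial>M) * \<infinity>"
    using \<open>(\<integral>\<^sup>+\<omega>. extend_sup f (\<sigma> \<omega> / 2) \<partial>M) = \<infinity>\<close> by simp
  moreover have "indicator {w\<in>space (PiM (T \<inter> {..u}) (\<lambda>_. borel)). P w} (\<lambda>t\<in>T \<inter> {..u}. Z t \<omega>) = (indicator A \<omega> :: ennreal)"
    if "\<omega> \<in> space M" for \<omega>
    using that by (auto simp: A_def space_PiM split: split_indicator)
  ultimately have "(\<integral>\<^sup>+\<omega>. indicator A \<omega> * extend_sup f (\<sigma> \<omega> / 2) \<partial>M) = (\<integral>\<^sup>+\<omega>. indicator A \<omega> \<partial>M) * \<infinity>"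
    by (simp cong: nn_integral_cong_simp)
  \<comment> \<open>Positivity of \<open>prob A\<close> is decisive here, since
    \<open>0 * \<infinity> = 0\<close>.\<close>
  also have "\<dots> = \<infinity>"
    using \<open>prob A > 0\<close> by (simp add: emeasure_eq_measure ennreal_mult_eq_top_iff)
  finally have "(\<integral>\<^sup>+\<omega>. extend_sup f \<bar>\<tau> \<omega> - e \<omega>\<bar> \<partial>M) + (\<integral>\<^sup>+\<omega>. extend_sup f \<bar>\<tau> \<omega> - e \<omega>\<bar> \<partial>M) = \<infinity>"
    using 1 2 by (simp add: top_unique)
  then show ?thesis by (simp add: ennreal_add_eq_top \<tau>_def e_def)
qed

end

section \<open>The tail of the hitting time\<close>

context gauss2_incs
begin

lemma prob_inc_nonneg:
  assumes "r \<in> T" "t \<in> T" "r \<le> t"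
  shows "1 / 2 \<le> prob {\<omega>\<in>space M. 0 \<le> fst (Z t \<omega> - Z r \<omega>)}"
proof (cases "r = t")
  case True
  then show ?thesis by (simp add: prob_space)
next
  case False
  with assms have rt: "r < t" by simp
  have "{z. 0 \<le> fst z} \<in> sets (borel :: (real \<times> real) measure)" by measurable
  moreover have "(\<lambda>\<omega>. Z t \<omega> - Z r \<omega>) \<in> borel_measurable M"
    using assms by (intro borel_measurable_diff Z_borel)
  ultimately have "prob {\<omega>\<in>space M. 0 \<le> fst (Z t \<omega> - Z r \<omega>)} = measure (gauss2 (t - r)) {z. 0 \<le> fst z}"
    using assms rt by (simp flip: distr_inc add: measure_distr vimage_def Int_def conj_commute)
  then show ?thesis using gauss2_halfplane[of "t - r"] rt by simp
qed

text \<open>Levy's maximal inequality, by decomposition according to the first time in \<open>F\<close> at which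
  the level is reached.\<close>

lemma levy_inequality:
  assumes t: "t \<in> T" and F: "finite F" "F \<subseteq> T \<inter> {..t}"
  shows "prob {\<omega>\<in>space M. \<exists>r\<in>F. c \<le> fst (Z r \<omega>)} \<le> 2 * prob {\<omega>\<in>space M. c \<le> fst (Z t \<omega>)}"
proof -
  define A where "A r = {\<omega>\<in>space M. c \<le> fst (Z r \<omega>) \<and> (\<forall>q\<in>F \<inter> {..<r}. fst (Z q \<omega>) < c)}" for r
  define H where "H r = {\<omega>\<in>space M. 0 \<le> fst (Z t \<omega> - Z r \<omega>)}" for r
  have Zm [measurable]: "Z r \<in> borel_measurable M" if "r \<in> F" for r
    using that F by (intro Z_borel) auto
  have Ztm [measurable]: "Z t \<in> borel_measurable M" by (rule Z_borel[OF t])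
  have Am: "A r \<in> events" if "r \<in> F" for r
  proof -
    have [measurable]: "Z r \<in> borel_measurable M" using that by (rule Zm)
    have "{\<omega>\<in>space M. \<forall>q\<in>F \<inter> {..<r}. fst (Z q \<omega>) < c} \<in> events"
    proof (rule sets.sets_Collect_finite_All)
      fix q assume "q \<in> F \<inter> {..<r}"
      then have [measurable]: "Z q \<in> borel_measurable M" by (intro Zm) auto
      show "{\<omega>\<in>space M. fst (Z q \<omega>) < c} \<in> events" by measurable
    qed (use F in auto)
    then show ?thesis unfolding A_def by measurable
  qed
  have Hm: "H r \<in> events" if "r \<in> F" for r
  proof -
    have [measurable]: "Z r \<in> borel_measurable M" using that by (rule Zm)
    show ?thesis unfolding H_def by measurable
  qed
  \<comment> \<open>\<open>A r\<close> depends on the path up to \<open>r\<close> and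
    \<open>H r\<close> on the increment from \<open>r\<close> to \<open>t\<close>, which is
    nonnegative with probability at least 1/2.\<close>
  have half: "prob (A r) \<le> 2 * prob (A r \<inter> H r)" if r: "r \<in> F" for r
  proof -
    have rT: "r \<in> T" "r \<le> t" "t - r \<in> T" using r F t by (auto intro: T_diff)
    define P where "P w \<longleftrightarrow> c \<le> fst (w r) \<and> (\<forall>q\<in>F \<inter> {..<r}. fst (w q) < c)" for w :: "real \<Rightarrow> real \<times> real"
    define Q where "Q w \<longleftrightarrow> 0 \<le> fst (w (t - r))" for w :: "real \<Rightarrow> real \<times> real"
    have comp: "(\<lambda>w. fst (w q)) \<in> borel_measurable (PiM K (\<lambda>_. borel :: (real \<times> real) measure))" if "q \<in> K" for q K
      using measurable_component_fst[OF that, of "\<lambda>z. z"] by simp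
    have P: "Measurable.pred (PiM (T \<inter> {..r}) (\<lambda>_. borel)) P"
    proof -
      have [measurable]: "(\<lambda>w. fst (w r)) \<in> borel_measurable (PiM (T \<inter> {..r}) (\<lambda>_. borel :: (real \<times> real) measure))"
        using rT by (intro comp) auto
      have "Measurable.pred (PiM (T \<inter> {..r}) (\<lambda>_. borel)) (\<lambda>w :: real \<Rightarrow> real \<times> real. \<forall>q\<in>F \<inter> {..<r}. fst (w q) < c)"
      proof (rule pred_intros_finite(3))
        fix q assume "q \<in> F \<inter> {..<r}"
        then have [measurable]: "(\<lambda>w. fst (w q)) \<in> borel_measurable (PiM (T \<inter> {..r}) (\<lambda>_. borel :: (real \<times> real) measure))"
          using F by (intro comp) auto
        show "Measurable.pred (PiM (T \<inter> {..r}) (\<lambda>_. borel)) (\<lambda>w :: real \<Rightarrow> real \<times> real. fst (w q) < c)" by measurable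
      qed (use F in auto)
      then show ?thesis unfolding P_def by measurable
    qed
    have Q: "Measurable.pred (PiM T (\<lambda>_. borel)) Q"
    proof -
      have [measurable]: "(\<lambda>w. fst (w (t - r))) \<in> borel_measurable (PiM T (\<lambda>_. borel :: (real \<times> real) measure))"
        using rT by (intro comp) auto
      show ?thesis unfolding Q_def by measurable
    qed
    have PA: "P (\<lambda>t\<in>T \<inter> {..r}. Z t \<omega>) \<longleftrightarrow> c \<le> fst (Z r \<omega>) \<and> (\<forall>q\<in>F \<inter> {..<r}. fst (Z q \<omega>) < c)" for \<omega>
      using F rT by (auto simp: P_def)
    have QH: "Q (\<lambda>t\<in>T. Z (r + t) \<omega> - Z r \<omega>) \<longleftrightarrow> 0 \<le> fst (Z t \<omega> - Z r \<omega>)" for \<omega>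
      using rT by (simp add: Q_def)
    have "A r \<inter> H r = {\<omega>\<in>space M. P (\<lambda>t\<in>T \<inter> {..r}. Z t \<omega>) \<and> Q (\<lambda>t\<in>T. Z (r + t) \<omega> - Z r \<omega>)}"
      unfolding PA QH by (auto simp: A_def H_def)
    then have "prob (A r \<inter> H r) = prob (A r) * prob (H r)"
      using prob_past_future[OF rT(1) P Q] by (simp only: PA QH A_def H_def)
    moreover have "1 / 2 \<le> prob (H r)" unfolding H_def by (rule prob_inc_nonneg[OF rT(1) t rT(2)])
    ultimately show ?thesis
      using mult_left_mono[of "1 / 2" "prob (H r)" "prob (A r)"] by simp
  qed
  have disj: "disjoint_family_on A F"
  proof (unfold disjoint_family_on_def, intro ballI impI)
    fix q r assume qr: "q \<in> F" "r \<in> F" "q \<noteq> r"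
    have "False" if "\<omega> \<in> A q" "\<omega> \<in> A r" for \<omega>
    proof (cases "q < r")
      case True
      then have "fst (Z q \<omega>) < c" using that(2) qr by (auto simp: A_def)
      then show False using that(1) by (auto simp: A_def)
    next
      case False
      then have "r < q" using qr by simp
      then have "fst (Z r \<omega>) < c" using that(1) qr by (auto simp: A_def)
      then show False using that(2) by (auto simp: A_def)
    qed
    then show "A q \<inter> A r = {}" by blast
  qed
  have "{\<omega>\<in>space M. \<exists>r\<in>F. c \<le> fst (Z r \<omega>)} = (\<Union>r\<in>F. A r)"
  proof (intro equalityI subsetI)
    fix \<omega> assume \<omega>: "\<omega> \<in> {\<omega>\<in>space M. \<exists>r\<in>F. c \<le> fst (Z r \<omega>)}"
    define R where "R = {r\<in>F. c \<le> fst (Z r \<omega>)}"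
    have R: "finite R" "R \<noteq> {}" using \<omega> F by (auto simp: R_def)
    have "Min R \<in> R" using R by (rule Min_in)
    moreover have "fst (Z q \<omega>) < c" if "q \<in> F" "q < Min R" for q
      using that R Min_le[of R q] by (force simp: R_def not_le)
    ultimately show "\<omega> \<in> (\<Union>r\<in>F. A r)" using \<omega> by (auto simp: A_def R_def intro!: bexI[of _ "Min R"])
  qed (auto simp: A_def)
  then have "prob {\<omega>\<in>space M. \<exists>r\<in>F. c \<le> fst (Z r \<omega>)} = (\<Sum>r\<in>F. prob (A r))"
    using finite_measure_finite_Union[OF F(1) _ disj] Am by auto
  also have "\<dots> \<le> (\<Sum>r\<in>F. 2 * prob (A r \<inter> H r))"
    by (rule sum_mono) (rule half)
  also have "\<dots> = 2 * prob (\<Union>r\<in>F. A r \<inter> H r)"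
  proof -
    have "disjoint_family_on (\<lambda>r. A r \<inter> H r) F" using disj by (auto simp: disjoint_family_on_def)
    then show ?thesis
      using Am Hm by (subst finite_measure_finite_Union[OF F(1)]) (auto simp: sum_distrib_left)
  qed
  \<comment> \<open>A path at or above \<open>c\<close> at time \<open>r\<close> with a nonnegative
    later increment is at or above \<open>c\<close> at time \<open>t\<close>.\<close>
  also have "\<dots> \<le> 2 * prob {\<omega>\<in>space M. c \<le> fst (Z t \<omega>)}"
  proof -
    have "{\<omega>\<in>space M. c \<le> fst (Z t \<omega>)} \<in> events" by measurable
    then have "prob (\<Union>r\<in>F. A r \<inter> H r) \<le> prob {\<omega>\<in>space M. c \<le> fst (Z t \<omega>)}"
      by (intro finite_measure_mono) (auto simp: A_def H_def)
    then show ?thesis by simp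
  qed
  finally show ?thesis .
qed

text \<open>The bound for finite sets does not depend on the set, so it survives exhausting the
  countable set of rational times.\<close>

lemma levy_inequality_rational:
  assumes t: "t \<in> T"
  shows "prob {\<omega>\<in>space M. \<exists>r\<in>T \<inter> \<rat> \<inter> {..t}. c \<le> fst (Z r \<omega>)} \<le> 2 * prob {\<omega>\<in>space M. c \<le> fst (Z t \<omega>)}"
proof -
  define D where "D = T \<inter> \<rat> \<inter> {..t}"
  have "0 \<in> D" using T_nonneg[OF t] by (simp add: D_def)
  moreover have "countable D" unfolding D_def by (rule countable_Int1[OF countable_T_Rats])
  ultimately have D: "countable D" "D \<noteq> {}" "D \<subseteq> T \<inter> {..t}"
    by (auto simp only: D_def)
  define F where "F n = from_nat_into D ` {..n}" for n
  have F: "finite (F n)" "F n \<subseteq> T \<inter> {..t}" for n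
    using from_nat_into[OF D(2)] D(3) by (auto simp: F_def)
  have FD: "(\<Union>n. F n) = D"
    using range_from_nat_into[OF D(2,1)] by (simp add: F_def image_UN[symmetric] UN_atMost_UNIV)
  define B where "B n = {\<omega>\<in>space M. \<exists>r\<in>F n. c \<le> fst (Z r \<omega>)}" for n
  have Bm: "B n \<in> events" for n
    unfolding B_def
  proof (rule sets.sets_Collect_finite_Ex)
    fix r assume "r \<in> F n"
    then have [measurable]: "Z r \<in> borel_measurable M" using F(2) by (intro Z_borel) auto
    show "{\<omega>\<in>space M. c \<le> fst (Z r \<omega>)} \<in> events" by measurable
  qed (rule F)
  have "incseq B" by (rule incseq_SucI) (auto simp: B_def F_def)
  then have "(\<lambda>n. prob (B n)) \<longlonglongrightarrow> prob (\<Union>n. B n)"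
    using Bm by (intro finite_Lim_measure_incseq) auto
  moreover have "prob (B n) \<le> 2 * prob {\<omega>\<in>space M. c \<le> fst (Z t \<omega>)}" for n
    unfolding B_def by (rule levy_inequality[OF t F])
  ultimately have "prob (\<Union>n. B n) \<le> 2 * prob {\<omega>\<in>space M. c \<le> fst (Z t \<omega>)}"
    by (auto intro: LIMSEQ_le_const2)
  also have "(\<Union>n. B n) = {\<omega>\<in>space M. \<exists>r\<in>D. c \<le> fst (Z r \<omega>)}"
    unfolding FD[symmetric] by (auto simp: B_def)
  finally show ?thesis by (simp only: D_def)
qed

text \<open>Staying below \<open>h / 2\<close> at all rational times up to \<open>t\<close> delays
  \<open>hit\<close> to at least \<open>t\<close>. Level \<open>h / 2\<close> replaces
  \<open>h\<close> because \<open>hit\<close> watches levels slightly below \<open>h\<close>; this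
  argument does not involve path continuity.\<close>

lemma hit_tail:
  assumes t: "t \<in> T" "1 \<le> t" and h: "h > 0"
  shows "h * std_normal_density (h / 2) / sqrt t \<le> prob {\<omega>\<in>space M. ereal t \<le> hit T h (\<lambda>t. fst (Z t \<omega>))}"
proof -
  let ?B = "{\<omega>\<in>space M. \<exists>r\<in>T \<inter> \<rat> \<inter> {..t}. h / 2 \<le> fst (Z r \<omega>)}"
  have B: "?B \<in> events"
  proof (rule sets.sets_Collect_countable_Ex')
    show "countable (T \<inter> \<rat> \<inter> {..t})" by (rule countable_Int1[OF countable_T_Rats])
    fix r assume "r \<in> T \<inter> \<rat> \<inter> {..t}"
    then have [measurable]: "Z r \<in> borel_measurable M" by (intro Z_borel) auto
    show "{\<omega>\<in>space M. h / 2 \<le> fst (Z r \<omega>)} \<in> events" by measurable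
  qed
  have hm: "{\<omega>\<in>space M. ereal t \<le> hit T h (\<lambda>t. fst (Z t \<omega>))} \<in> events"
  proof -
    have [measurable]: "(\<lambda>\<omega>. hit T h (\<lambda>t. fst (Z t \<omega>))) \<in> borel_measurable M"
      by (rule measurable_hit) (rule measurable_compose[OF Z_borel borel_fst_snd(1)])
    show ?thesis by measurable
  qed
  have "space M - ?B \<subseteq> {\<omega>\<in>space M. ereal t \<le> hit T h (\<lambda>t. fst (Z t \<omega>))}"
  proof
    fix \<omega> assume \<omega>: "\<omega> \<in> space M - ?B"
    \<comment> \<open>A single index suffices, as \<open>hit\<close> is a supremum: this one watches
      a level above \<open>h / 2\<close>.\<close>
    obtain m where m: "1 / real (Suc m) < h / 2" using h nat_approx_posE[of "h / 2"] by auto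
    have "ereal t \<le> (INF r\<in>T \<inter> \<rat>. if h - 1 / real (Suc m) < fst (Z r \<omega>) then ereal r else \<infinity>)"
    proof (rule INF_greatest)
      fix r assume r: "r \<in> T \<inter> \<rat>"
      have "t \<le> r" if "h - 1 / real (Suc m) < fst (Z r \<omega>)"
      proof (rule ccontr)
        assume "\<not> t \<le> r"
        then have "fst (Z r \<omega>) < h / 2" using \<omega> r by (force simp: not_le)
        then show False using that m by linarith
      qed
      then show "ereal t \<le> (if h - 1 / real (Suc m) < fst (Z r \<omega>) then ereal r else \<infinity>)" by simp
    qed
    also have "\<dots> \<le> hit T h (\<lambda>t. fst (Z t \<omega>))" unfolding hit_def by (rule SUP_upper) simp
    finally show "\<omega> \<in> {\<omega>\<in>space M. ereal t \<le> hit T h (\<lambda>t. fst (Z t \<omega>))}" using \<omega> by simp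
  qed
  then have "prob (space M - ?B) \<le> prob {\<omega>\<in>space M. ereal t \<le> hit T h (\<lambda>t. fst (Z t \<omega>))}"
    by (rule finite_measure_mono[OF _ hm])
  moreover have "prob (space M - ?B) = 1 - prob ?B" by (rule prob_compl[OF B])
  moreover have "prob ?B \<le> 2 * prob {\<omega>\<in>space M. h / 2 \<le> fst (Z t \<omega>)}"
    by (rule levy_inequality_rational[OF t(1)])
  moreover have "prob {\<omega>\<in>space M. h / 2 \<le> fst (Z t \<omega>)} = measure (gauss2 t) {z. h / 2 \<le> fst z}"
  proof -
    have "{z. h / 2 \<le> fst z} \<in> sets (borel :: (real \<times> real) measure)" by measurable
    from prob_Z[OF t(1) _ this] show ?thesis using t(2) by simp
  qed
  moreover have "2 * measure (gauss2 t) {z. h / 2 \<le> fst z} \<le> 1 - 2 * (h / 2) * std_normal_density (h / 2) / sqrt t"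
    using t(2) h by (intro gauss2_tail) auto
  ultimately show ?thesis by simp
qed

end

text \<open>A discrete layer-cake bound for the square root. At a level that is not reached the new
  term vanishes; at one that is reached, the geometric sum is at most twice its last term
  \<open>2 ^ Suc N = sqrt (4 ^ Suc N)\<close>.\<close>

lemma sum_powers_below_le_sqrt:
  fixes x :: real
  assumes "0 \<le> x"
  shows "(\<Sum>k<N. 2 ^ Suc k * of_bool (4 ^ Suc k \<le> x)) \<le> 2 * sqrt x"
proof (induction N)
  case (Suc N)
  show ?case
  proof (cases "4 ^ Suc N \<le> x")
    case True
    have "(\<Sum>k<Suc N. 2 ^ Suc k * of_bool (4 ^ Suc k \<le> x)) \<le> (\<Sum>k<Suc N. 2 ^ Suc k :: real)"
      by (intro sum_mono) simp
    also have "\<dots> = 2 * (\<Sum>k<Suc N. 2 ^ k)" by (simp add: sum_distrib_left)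
    also have "\<dots> \<le> 2 * 2 ^ Suc N" by (simp only: sum_gp_strict) simp
    also have "(2::real) ^ Suc N = sqrt (4 ^ Suc N)"
      by (rule real_sqrt_unique[symmetric]) (simp_all add: power_mult_distrib[symmetric] power2_eq_square)
    also have "2 * sqrt (4 ^ Suc N) \<le> 2 * sqrt x" using True by simp
    finally show ?thesis .
  next
    case False
    then show ?thesis using Suc by simp
  qed
qed (use assms in simp)

lemma mono_on_powr:
  "0 \<le> p \<Longrightarrow> mono_on {0..} (\<lambda>x::real. x powr p)"
  by (auto intro!: mono_onI powr_mono2)

text \<open>This step function minorizes the power, and its integral involves only the tail
  probabilities at the levels \<open>4 ^ Suc k\<close>. The factor 1/4 absorbs the constant 2 of the
  geometric sum and the halving of the argument.\<close>

lemma extend_sup_powr_ge_sum: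
  fixes p :: real and x :: ereal
  assumes p: "1 / 2 \<le> p" and x: "0 \<le> x"
  shows "(\<Sum>k<N. ennreal (2 ^ Suc k / 4) * indicator {y. ereal (4 ^ Suc k) \<le> y} x) \<le> extend_sup (\<lambda>x. x powr p) (x / 2)"
proof -
  have main: "(\<Sum>k<N. 2 ^ Suc k / 4 * of_bool (4 ^ Suc k \<le> y) :: real) \<le> (y / 2) powr p" if "0 \<le> y" for y :: real
  \<comment> \<open>Below 4 no level is reached and the sum is 0. From 4 on, \<open>y / 2\<close>
    exceeds 1, so raising the exponent from 1/2 to \<open>p\<close> only increases the
    power.\<close>
  proof (cases "4 \<le> y")
    case True
    have "(\<Sum>k<N. 2 ^ Suc k / 4 * of_bool (4 ^ Suc k \<le> y) :: real) = (\<Sum>k<N. 2 ^ Suc k * of_bool (4 ^ Suc k \<le> y)) / 4"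
      by (simp only: sum_divide_distrib times_divide_eq_left)
    also have "\<dots> \<le> sqrt y / 2" using sum_powers_below_le_sqrt[OF that, of N] by simp
    also have "\<dots> = sqrt (y / 4)" by (simp add: real_sqrt_divide)
    also have "\<dots> \<le> sqrt (y / 2)" using that by simp
    also have "\<dots> = (y / 2) powr (1 / 2)" using that by (simp add: powr_half_sqrt)
    also have "\<dots> \<le> (y / 2) powr p" using p True by (intro powr_mono) auto
    finally show ?thesis .
  next
    case False
    have "\<not> 4 ^ Suc k \<le> y" for k
    proof -
      have "(1::real) \<le> 4 ^ k" by (rule one_le_power) simp
      then show ?thesis using False unfolding power_Suc by linarith
    qed
    then show ?thesis by simp
  qed
  show ?thesis
  proof (cases x)
    case (real y)
    with x have y: "0 \<le> y" by simp
    have "(\<Sum>k<N. ennreal (2 ^ Suc k / 4) * indicator {y. ereal (4 ^ Suc k) \<le> y} x) =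
        (\<Sum>k<N. ennreal (2 ^ Suc k / 4 * of_bool (4 ^ Suc k \<le> y)))"
      unfolding real by (intro sum.cong refl) (simp split: split_indicator)
    also have "\<dots> = ennreal (\<Sum>k<N. 2 ^ Suc k / 4 * of_bool (4 ^ Suc k \<le> y))"
      by (intro sum_ennreal) simp
    also have "\<dots> \<le> ennreal ((y / 2) powr p)" by (rule ennreal_leI) (rule main[OF y])
    finally show ?thesis unfolding real by (simp add: extend_sup_def)
  next
    case PInf
    define K where "K = (\<Sum>k<N. 2 ^ Suc k / 4 :: real)"
    \<comment> \<open>A finite argument at which all the levels in the sum are already reached, as
      they are at infinity.\<close>
    define y where "y = (4::real) ^ Suc N"
    have "(\<Sum>k<N. ennreal (2 ^ Suc k / 4) * indicator {y. ereal (4 ^ Suc k) \<le> y} x) = (\<Sum>k<N. ennreal (2 ^ Suc k / 4 * of_bool (4 ^ Suc k \<le> y)))"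
      unfolding PInf y_def by (intro sum.cong refl) (simp add: power_increasing del: power_Suc)
    also have "\<dots> = ennreal (\<Sum>k<N. 2 ^ Suc k / 4 * of_bool (4 ^ Suc k \<le> y))"
      by (intro sum_ennreal) simp
    also have "\<dots> \<le> ennreal ((y / 2) powr p)" by (rule ennreal_leI) (rule main, simp add: y_def)
    also have "\<dots> \<le> (SUP z\<in>{0..}. ennreal (z powr p))" by (rule SUP_upper) (simp add: y_def)
    finally show ?thesis unfolding PInf by (simp add: extend_sup_def)
  qed (use x in simp)
qed

text \<open>Level \<open>4 ^ Suc k\<close> has weight \<open>2 ^ Suc k / 4\<close> and tail
  probability at least a constant over \<open>2 ^ Suc k\<close>, so every level contributes at least
  the same \<open>c > 0\<close> and \<open>N\<close> levels give \<open>N * c\<close>.\<close>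

lemma (in gauss2_incs) hit_powr_infinite:
  assumes p: "1 / 2 \<le> p" and h: "h > 0"
  shows "(\<integral>\<^sup>+\<omega>. extend_sup (\<lambda>x. x powr p) (hit T h (\<lambda>t. fst (Z t \<omega>)) / 2) \<partial>M) = \<infinity>" (is "?I = _")
proof (rule ccontr)
  assume "?I \<noteq> \<infinity>"
  then obtain C where C: "?I = ennreal C" "0 \<le> C" by (cases ?I) auto
  define c where "c = h * std_normal_density (h / 2) / 4"
  have c: "c > 0" using h by (simp add: c_def normal_density_pos)
  let ?\<tau> = "\<lambda>\<omega>. hit T h (\<lambda>t. fst (Z t \<omega>))"
  have [measurable]: "?\<tau> \<in> borel_measurable M"
    by (rule measurable_hit) (rule measurable_compose[OF Z_borel borel_fst_snd(1)])
  have "real N * c \<le> C" for N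
  proof -
    \<comment> \<open>Being natural numbers, the levels are admissible times in both
      settings.\<close>
    have t4: "(4::real) ^ Suc k \<in> T" for k
    proof -
      have "real (4 ^ Suc k) \<in> T" using T_mult_nat[OF T_1] by (metis mult.right_neutral)
      then show ?thesis by simp
    qed
    have "ennreal (real N * c) = (\<Sum>k<N. ennreal c)" using c by (subst sum_ennreal) auto
    also have "\<dots> \<le> (\<Sum>k<N. ennreal (2 ^ Suc k / 4) * emeasure M {\<omega>\<in>space M. ereal (4 ^ Suc k) \<le> ?\<tau> \<omega>})"
    proof (rule sum_mono)
      fix k
      have s: "sqrt (4 ^ Suc k) = (2::real) ^ Suc k"
        by (rule real_sqrt_unique) (simp_all add: power_mult_distrib[symmetric] power2_eq_square)
      have "h * std_normal_density (h / 2) / sqrt (4 ^ Suc k) \<le> prob {\<omega>\<in>space M. ereal (4 ^ Suc k) \<le> ?\<tau> \<omega>}"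
        by (rule hit_tail[OF t4 _ h]) (rule one_le_power, simp)
      from mult_left_mono[OF this, of "2 ^ Suc k / 4"]
      have "c \<le> 2 ^ Suc k / 4 * prob {\<omega>\<in>space M. ereal (4 ^ Suc k) \<le> ?\<tau> \<omega>}"
        unfolding s by (simp add: c_def)
      then have "ennreal c \<le> ennreal (2 ^ Suc k / 4 * prob {\<omega>\<in>space M. ereal (4 ^ Suc k) \<le> ?\<tau> \<omega>})"
        by (rule ennreal_leI)
      then show "ennreal c \<le> ennreal (2 ^ Suc k / 4) * emeasure M {\<omega>\<in>space M. ereal (4 ^ Suc k) \<le> ?\<tau> \<omega>}"
        by (simp only: emeasure_eq_measure ennreal_mult measure_nonneg zero_le_divide_iff zero_le_numeral zero_le_power simp_thms)
    qed
    also have "\<dots> = (\<integral>\<^sup>+\<omega>. (\<Sum>k<N. ennreal (2 ^ Suc k / 4) * indicator {y. ereal (4 ^ Suc k) \<le> y} (?\<tau> \<omega>)) \<partial>M)"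
    proof (subst nn_integral_sum)
      show "(\<Sum>k<N. ennreal (2 ^ Suc k / 4) * emeasure M {\<omega>\<in>space M. ereal (4 ^ Suc k) \<le> ?\<tau> \<omega>}) =
        (\<Sum>k<N. \<integral>\<^sup>+\<omega>. ennreal (2 ^ Suc k / 4) * indicator {y. ereal (4 ^ Suc k) \<le> y} (?\<tau> \<omega>) \<partial>M)"
      proof (rule sum.cong[OF refl])
        fix k
        have "(\<integral>\<^sup>+\<omega>. ennreal (2 ^ Suc k / 4) * indicator {y. ereal (4 ^ Suc k) \<le> y} (?\<tau> \<omega>) \<partial>M) =
          (\<integral>\<^sup>+\<omega>. ennreal (2 ^ Suc k / 4) * indicator {\<omega>\<in>space M. ereal (4 ^ Suc k) \<le> ?\<tau> \<omega>} \<omega> \<partial>M)"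
          by (intro nn_integral_cong) (simp split: split_indicator)
        also have "\<dots> = ennreal (2 ^ Suc k / 4) * emeasure M {\<omega>\<in>space M. ereal (4 ^ Suc k) \<le> ?\<tau> \<omega>}"
          by (rule nn_integral_cmult_indicator) measurable
        finally show "ennreal (2 ^ Suc k / 4) * emeasure M {\<omega>\<in>space M. ereal (4 ^ Suc k) \<le> ?\<tau> \<omega>} =
          (\<integral>\<^sup>+\<omega>. ennreal (2 ^ Suc k / 4) * indicator {y. ereal (4 ^ Suc k) \<le> y} (?\<tau> \<omega>) \<partial>M)" ..
      qed
    qed measurable
    also have "\<dots> \<le> ?I"
      by (intro nn_integral_mono extend_sup_powr_ge_sum p hit_nonneg T_nonneg)
    finally show ?thesis using C by simp
  qed
  moreover obtain N :: nat where "C / c < real N" using reals_Archimedean2 by blast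
  then have "C < real N * c" using c by (simp add: pos_divide_less_eq)
  ultimately show False by (meson not_le)
qed

section \<open>Both settings as planar Gaussian processes\<close>

definition gauss_incs :: "'a measure \<Rightarrow> real set \<Rightarrow> (real \<Rightarrow> 'a \<Rightarrow> real) \<Rightarrow> bool" where
  "gauss_incs M T B \<longleftrightarrow>
    (\<forall>t\<in>T. B t \<in> borel_measurable M) \<and>
    (\<forall>\<omega>\<in>space M. B 0 \<omega> = 0) \<and>
    (\<forall>n c. (\<forall>i\<le>n. c i \<in> T) \<and> (\<forall>i<n. c i < c (Suc i)) \<longrightarrow>
      prob_space.indep_vars M (\<lambda>_. borel) (\<lambda>i \<omega>. B (c (Suc i)) \<omega> - B (c i) \<omega>) {..<n::nat}) \<and>
    (\<forall>s\<in>T. \<forall>t\<in>T. s < t \<longrightarrow>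
      distributed M lborel (\<lambda>\<omega>. B t \<omega> - B s \<omega>) (normal_density 0 (sqrt (t - s))))"

text \<open>Rectangles generate the Borel sets of the plane. An intersection of rectangle events
  factors between the two families by \<open>VW\<close> and then within each family; regrouping
  gives the product over the pairs.\<close>

lemma (in prob_space) indep_vars_pair:
  fixes V W :: "'i \<Rightarrow> 'a \<Rightarrow> real"
  assumes I: "finite I"
    and V: "indep_vars (\<lambda>_. borel) V I" and W: "indep_vars (\<lambda>_. borel) W I"
    and VW: "indep_var (PiM I (\<lambda>_. borel)) (\<lambda>\<omega>. \<lambda>i\<in>I. V i \<omega>) (PiM I (\<lambda>_. borel)) (\<lambda>\<omega>. \<lambda>i\<in>I. W i \<omega>)"
  shows "indep_vars (\<lambda>_. borel) (\<lambda>i \<omega>. (V i \<omega>, W i \<omega>)) I"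
proof (cases "I = {}")
  case True
  then show ?thesis by (simp add: indep_vars_def indep_sets_def)
next
  case False
  let ?E = "{A \<times> C |A C. A \<in> sets (borel :: real measure) \<and> C \<in> sets (borel :: real measure)}"
  have [measurable]: "random_variable borel (V i)" "random_variable borel (W i)" if "i \<in> I" for i
    using V W that by (auto simp: indep_vars_def)
  have "indep_vars (\<lambda>_. borel :: (real \<times> real) measure) (\<lambda>i \<omega>. (V i \<omega>, W i \<omega>)) I \<longleftrightarrow>
    (\<forall>A\<in>I \<rightarrow> ?E. prob (\<Inter>j\<in>I. (\<lambda>\<omega>. (V j \<omega>, W j \<omega>)) -` A j \<inter> space M) =
      (\<Prod>j\<in>I. prob ((\<lambda>\<omega>. (V j \<omega>, W j \<omega>)) -` A j \<inter> space M)))"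
  proof (rule indep_vars_finite[OF False I])
    fix i assume i: "i \<in> I"
    show "sets (borel :: (real \<times> real) measure) = sigma_sets (space borel) ?E"
      by (simp add: borel_prod[symmetric] sets_pair_measure space_pair_measure)
    show "random_variable borel (\<lambda>\<omega>. (V i \<omega>, W i \<omega>))"
      using i by (intro borel_measurable_Pair) auto
    show "Int_stable ?E"
      by (rule Int_stable_pair_measure_generator)
    show "space borel \<in> ?E" by (auto intro!: exI[of _ UNIV])
  qed auto
  also have "\<dots>"
  proof
    fix A assume "A \<in> I \<rightarrow> ?E"
    then have "\<forall>i\<in>I. \<exists>B C. A i = B \<times> C \<and> B \<in> sets borel \<and> C \<in> sets borel" by blast
    then obtain B C where A: "\<And>i. i \<in> I \<Longrightarrow> A i = B i \<times> C i"
      and B: "\<And>i. i \<in> I \<Longrightarrow> B i \<in> sets borel" and C: "\<And>i. i \<in> I \<Longrightarrow> C i \<in> sets borel"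
      by metis
    have split: "prob ((\<lambda>\<omega>. (\<lambda>i\<in>I. V i \<omega>, \<lambda>i\<in>I. W i \<omega>)) -` (Pi\<^sub>E I B' \<times> Pi\<^sub>E I C') \<inter> space M) =
        prob (\<Inter>j\<in>I. V j -` B' j \<inter> space M) * prob (\<Inter>j\<in>I. W j -` C' j \<inter> space M)"
      if B': "\<And>i. i \<in> I \<Longrightarrow> B' i \<in> sets borel" and C': "\<And>i. i \<in> I \<Longrightarrow> C' i \<in> sets borel" for B' C'
    proof -
      have "prob ((\<lambda>\<omega>. (\<lambda>i\<in>I. V i \<omega>, \<lambda>i\<in>I. W i \<omega>)) -` (Pi\<^sub>E I B' \<times> Pi\<^sub>E I C') \<inter> space M) =
        prob ((\<lambda>\<omega>. \<lambda>i\<in>I. V i \<omega>) -` Pi\<^sub>E I B' \<inter> space M) * prob ((\<lambda>\<omega>. \<lambda>i\<in>I. W i \<omega>) -` Pi\<^sub>E I C' \<inter> space M)"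
        using B' C' I by (intro indep_varD[OF VW] sets_PiM_I_finite) auto
      also have "(\<lambda>\<omega>. \<lambda>i\<in>I. V i \<omega>) -` Pi\<^sub>E I B' \<inter> space M = (\<Inter>j\<in>I. V j -` B' j \<inter> space M)"
        using False by (auto simp: PiE_iff)
      also have "(\<lambda>\<omega>. \<lambda>i\<in>I. W i \<omega>) -` Pi\<^sub>E I C' \<inter> space M = (\<Inter>j\<in>I. W j -` C' j \<inter> space M)"
        using False by (auto simp: PiE_iff)
      finally show ?thesis .
    qed
    have one: "prob ((\<lambda>\<omega>. (V j \<omega>, W j \<omega>)) -` A j \<inter> space M) = prob (V j -` B j \<inter> space M) * prob (W j -` C j \<inter> space M)"
      if j: "j \<in> I" for j
    proof -
      have "indep_var borel (V j) borel (W j)"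
        using indep_var_compose[OF VW measurable_component_singleton[OF j] measurable_component_singleton[OF j]] j
        by (simp add: comp_def)
      from indep_varD[OF this B[OF j] C[OF j]] show ?thesis by (simp add: A[OF j])
    qed
    have "(\<Inter>j\<in>I. (\<lambda>\<omega>. (V j \<omega>, W j \<omega>)) -` A j \<inter> space M) =
        (\<lambda>\<omega>. (\<lambda>i\<in>I. V i \<omega>, \<lambda>i\<in>I. W i \<omega>)) -` (Pi\<^sub>E I B \<times> Pi\<^sub>E I C) \<inter> space M"
      using A False by (auto simp: PiE_iff)
    then have "prob (\<Inter>j\<in>I. (\<lambda>\<omega>. (V j \<omega>, W j \<omega>)) -` A j \<inter> space M) =
        prob (\<Inter>j\<in>I. V j -` B j \<inter> space M) * prob (\<Inter>j\<in>I. W j -` C j \<inter> space M)"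
      using split[of B C] B C by simp
    also have "prob (\<Inter>j\<in>I. V j -` B j \<inter> space M) = (\<Prod>j\<in>I. prob (V j -` B j \<inter> space M))"
      using B by (intro indep_varsD[OF V False I]) auto
    also have "prob (\<Inter>j\<in>I. W j -` C j \<inter> space M) = (\<Prod>j\<in>I. prob (W j -` C j \<inter> space M))"
      using C by (intro indep_varsD[OF W False I]) auto
    finally show "prob (\<Inter>j\<in>I. (\<lambda>\<omega>. (V j \<omega>, W j \<omega>)) -` A j \<inter> space M) =
      (\<Prod>j\<in>I. prob ((\<lambda>\<omega>. (V j \<omega>, W j \<omega>)) -` A j \<inter> space M))"
      by (simp add: one prod.distrib)
  qed
  finally show ?thesis .
qed

lemma distr_std_normal_scale:
  assumes "0 < \<sigma>"
  shows "distr std_normal lborel (\<lambda>x. \<sigma> * x) = density lborel (normal_density 0 \<sigma>)"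
proof -
  have "distributed std_normal lborel (\<lambda>x. x) std_normal_density"
    unfolding distributed_def
  proof (intro conjI)
    have "distr std_normal lborel (\<lambda>x. x) = std_normal"
      by (rule distr_id2) (simp add: std_normal_def)
    then show "distr std_normal lborel (\<lambda>x. x) = density lborel std_normal_density"
      by (simp add: std_normal_def)
  qed (auto simp: std_normal_def)
  from std_normal.normal_density_affine[OF this zero_less_one, of \<sigma> 0] assms
  show ?thesis by (simp add: distributed_def)
qed

lemma (in prob_space) distr_normal_pair:
  assumes s: "0 < s"
    and B: "distributed M lborel B (normal_density 0 (sqrt s))"
    and N: "distributed M lborel N (normal_density 0 (sqrt s))"
    and BN: "indep_var borel B borel N"
  shows "distr M borel (\<lambda>\<omega>. (B \<omega>, N \<omega>)) = gauss2 s"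
proof -
  have sc: "distr M borel X = distr std_normal borel (\<lambda>x. sqrt s * x)"
    if "distributed M lborel X (normal_density 0 (sqrt s))" for X
  proof -
    have "distr M borel X = distr M lborel X" by (rule distr_cong) auto
    also have "\<dots> = density lborel (normal_density 0 (sqrt s))"
      using that by (simp add: distributed_def)
    also have "\<dots> = distr std_normal lborel (\<lambda>x. sqrt s * x)"
      using s by (subst distr_std_normal_scale) auto
    also have "\<dots> = distr std_normal borel (\<lambda>x. sqrt s * x)" by (rule distr_cong) auto
    finally show ?thesis .
  qed
  have m: "(\<lambda>x. sqrt s * x) \<in> measurable std_normal borel" by measurable
  have "distr M borel (\<lambda>\<omega>. (B \<omega>, N \<omega>)) = distr M borel B \<Otimes>\<^sub>M distr M borel N"
    using BN by (simp add: indep_var_distribution_eq borel_prod)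
  also have "\<dots> = distr std_normal borel (\<lambda>x. sqrt s * x) \<Otimes>\<^sub>M distr std_normal borel (\<lambda>x. sqrt s * x)"
    by (simp only: sc[OF B] sc[OF N])
  also have "\<dots> = distr (std_normal \<Otimes>\<^sub>M std_normal) (borel \<Otimes>\<^sub>M borel) (\<lambda>(x, y). (sqrt s * x, sqrt s * y))"
    by (rule pair_measure_distr[OF m m])
      (intro prob_space_imp_sigma_finite std_normal.prob_space_distr m)
  also have "\<dots> = gauss2 s"
    unfolding gauss2_def borel_prod by (rule distr_cong) auto
  finally show ?thesis .
qed

text \<open>Increments are measurable functions of the two whole paths, so independence of the paths
  passes to them; \<open>indep_vars_pair\<close> and \<open>distr_normal_pair\<close> do the
  rest.\<close>

lemma (in prob_space) gauss2_incs_pair: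
  assumes T: "T = \<nat> \<or> T = {0..}" and B: "gauss_incs M T B" and N: "gauss_incs M T N"
    and BN: "indep_var (PiM T (\<lambda>_. borel)) (\<lambda>\<omega>. \<lambda>t\<in>T. B t \<omega>) (PiM T (\<lambda>_. borel)) (\<lambda>\<omega>. \<lambda>t\<in>T. N t \<omega>)"
  shows "gauss2_incs M T (\<lambda>t \<omega>. (B t \<omega>, N t \<omega>))"
proof
  note comp = measurable_component_singleton
  fix n :: nat and c :: "nat \<Rightarrow> real"
  assume c: "\<And>i. i \<le> n \<Longrightarrow> c i \<in> T" "\<And>i. i < n \<Longrightarrow> c i < c (Suc i)"
  have inc: "(\<lambda>w. \<lambda>i\<in>{..<n}. w (c (Suc i)) - w (c i)) \<in> measurable (PiM T (\<lambda>_. borel :: real measure)) (PiM {..<n} (\<lambda>_. borel))"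
    using c(1) by (intro measurable_restrict borel_measurable_diff comp) auto
  have "indep_var (PiM {..<n} (\<lambda>_. borel)) (\<lambda>\<omega>. \<lambda>i\<in>{..<n}. B (c (Suc i)) \<omega> - B (c i) \<omega>)
    (PiM {..<n} (\<lambda>_. borel)) (\<lambda>\<omega>. \<lambda>i\<in>{..<n}. N (c (Suc i)) \<omega> - N (c i) \<omega>)"
  proof -
    have "(\<lambda>w. \<lambda>i\<in>{..<n}. w (c (Suc i)) - w (c i)) \<circ> (\<lambda>\<omega>. \<lambda>t\<in>T. X t \<omega>) = (\<lambda>\<omega>. \<lambda>i\<in>{..<n}. X (c (Suc i)) \<omega> - X (c i) \<omega>)"
      for X :: "real \<Rightarrow> 'a \<Rightarrow> real"
      using c(1) by (auto simp: fun_eq_iff)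
    with indep_var_compose[OF BN inc inc] show ?thesis by (simp only:)
  qed
  moreover have "indep_vars (\<lambda>_. borel) (\<lambda>i \<omega>. B (c (Suc i)) \<omega> - B (c i) \<omega>) {..<n}"
    "indep_vars (\<lambda>_. borel) (\<lambda>i \<omega>. N (c (Suc i)) \<omega> - N (c i) \<omega>) {..<n}"
    using B N c unfolding gauss_incs_def by blast+
  ultimately have "indep_vars (\<lambda>_. borel) (\<lambda>i \<omega>. (B (c (Suc i)) \<omega> - B (c i) \<omega>, N (c (Suc i)) \<omega> - N (c i) \<omega>)) {..<n}"
    by (intro indep_vars_pair) auto
  then show "indep_vars (\<lambda>_. borel) (\<lambda>i \<omega>. (B (c (Suc i)) \<omega>, N (c (Suc i)) \<omega>) - (B (c i) \<omega>, N (c i) \<omega>)) {..<n}"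
    by simp
next
  fix s t assume st: "s \<in> T" "t \<in> T" "s < t"
  have inc: "(\<lambda>w. w t - w s) \<in> measurable (PiM T (\<lambda>_. borel :: real measure)) borel"
    using st by (intro borel_measurable_diff measurable_component_singleton) auto
  have "indep_var borel (\<lambda>\<omega>. B t \<omega> - B s \<omega>) borel (\<lambda>\<omega>. N t \<omega> - N s \<omega>)"
    using indep_var_compose[OF BN inc inc] st by (simp add: comp_def)
  moreover have "distributed M lborel (\<lambda>\<omega>. B t \<omega> - B s \<omega>) (normal_density 0 (sqrt (t - s)))"
    "distributed M lborel (\<lambda>\<omega>. N t \<omega> - N s \<omega>) (normal_density 0 (sqrt (t - s)))"
    using B N st unfolding gauss_incs_def by blast+
  ultimately have "distr M borel (\<lambda>\<omega>. (B t \<omega> - B s \<omega>, N t \<omega> - N s \<omega>)) = gauss2 (t - s)"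
    using st by (intro distr_normal_pair) auto
  then show "distr M borel (\<lambda>\<omega>. (B t \<omega>, N t \<omega>) - (B s \<omega>, N s \<omega>)) = gauss2 (t - s)"
    by simp
qed (use T B N in \<open>auto simp: gauss_incs_def zero_prod_def intro!: borel_measurable_Pair\<close>)

definition walk :: "(nat \<Rightarrow> 'a \<Rightarrow> real) \<Rightarrow> real \<Rightarrow> 'a \<Rightarrow> real" where
  "walk V t \<omega> = (\<Sum>i=1..nat \<lfloor>t\<rfloor>. V i \<omega>)"

lemma walk_diff:
  assumes "m \<le> n"
  shows "walk V (real n) \<omega> - walk V (real m) \<omega> = (\<Sum>i\<in>{m<..n}. V i \<omega>)"
proof -
  have "{1..n} = {1..m} \<union> {m<..n}" using assms by auto
  then have "(\<Sum>i=1..n. V i \<omega>) = (\<Sum>i=1..m. V i \<omega>) + (\<Sum>i\<in>{m<..n}. V i \<omega>)"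
    by (simp only:) (rule sum.union_disjoint, auto)
  then show ?thesis by (simp add: walk_def)
qed

text \<open>Successive increments are sums of the steps over disjoint index blocks
  \<open>{m j<..m (Suc j)}\<close>.\<close>

lemma (in prob_space) gauss_incs_walk:
  assumes V: "indep_vars (\<lambda>_. borel) V {1..}"
    and normal: "\<And>i. 1 \<le> i \<Longrightarrow> distributed M lborel (V i) std_normal_density"
  shows "gauss_incs M \<nat> (walk V)"
  unfolding gauss_incs_def
proof (intro conjI ballI allI impI)
  have [measurable]: "V i \<in> borel_measurable M" if "1 \<le> i" for i
    using V that by (auto simp: indep_vars_def)
  show "walk V t \<in> borel_measurable M" for t
    unfolding walk_def by (intro borel_measurable_sum) auto
  show "walk V 0 \<omega> = 0" for \<omega> by (simp add: walk_def)
next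
  fix n :: nat and c :: "nat \<Rightarrow> real"
  assume c: "(\<forall>i\<le>n. c i \<in> \<nat>) \<and> (\<forall>i<n. c i < c (Suc i))"
  define m where "m i = nat \<lfloor>c i\<rfloor>" for i
  have m: "c i = real (m i)" if "i \<le> n" for i
  proof -
    from c that have "c i \<in> \<nat>" by blast
    then show ?thesis by (auto simp: m_def elim: Nats_cases)
  qed
  have mono: "m i < m (Suc i)" if "i < n" for i
  proof -
    have "c i < c (Suc i)" using c that by blast
    then show ?thesis using m[of i] m[of "Suc i"] that by simp
  qed
  have chain: "m (Suc i) \<le> m j" if "i < j" "j \<le> n" for i j
    using that
  proof (induction j)
    case (Suc j)
    then show ?case using mono[of j] by (cases "i = j") auto
  qed simp
  have "indep_vars (\<lambda>j. PiM {m j<..m (Suc j)} (\<lambda>_. borel)) (\<lambda>j \<omega>. restrict (\<lambda>i. V i \<omega>) {m j<..m (Suc j)}) {..<n}"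
  proof (rule indep_vars_restrict[OF V])
    show "disjoint_family_on (\<lambda>j. {m j<..m (Suc j)}) {..<n}"
    proof (unfold disjoint_family_on_def, intro ballI impI)
      fix i j assume "i \<in> {..<n}" "j \<in> {..<n}" "i \<noteq> j"
      then show "{m i<..m (Suc i)} \<inter> {m j<..m (Suc j)} = {}"
        using chain[of i j] chain[of j i] by (cases "i < j") auto
    qed
  qed auto
  then have "indep_vars (\<lambda>_. borel) (\<lambda>j \<omega>. \<Sum>i\<in>{m j<..m (Suc j)}. restrict (\<lambda>i. V i \<omega>) {m j<..m (Suc j)} i) {..<n}"
    by (rule indep_vars_compose2) (intro borel_measurable_sum measurable_component_singleton)
  also have "?this \<longleftrightarrow> indep_vars (\<lambda>_. borel) (\<lambda>i \<omega>. walk V (c (Suc i)) \<omega> - walk V (c i) \<omega>) {..<n}"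
  proof (rule indep_vars_cong[OF refl])
    fix j assume "j \<in> {..<n}"
    then have "walk V (c (Suc j)) \<omega> - walk V (c j) \<omega> = (\<Sum>i\<in>{m j<..m (Suc j)}. V i \<omega>)" for \<omega>
      using m[of j] m[of "Suc j"] mono[of j] walk_diff[of "m j" "m (Suc j)" V \<omega>] by simp
    then show "(\<lambda>\<omega>. \<Sum>i\<in>{m j<..m (Suc j)}. restrict (\<lambda>i. V i \<omega>) {m j<..m (Suc j)} i) =
        (\<lambda>\<omega>. walk V (c (Suc j)) \<omega> - walk V (c j) \<omega>)"
      by (auto simp: fun_eq_iff intro!: sum.cong)
  qed simp
  finally show "indep_vars (\<lambda>_. borel) (\<lambda>i \<omega>. walk V (c (Suc i)) \<omega> - walk V (c i) \<omega>) {..<n}" .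
next
  fix s t :: real assume "s \<in> \<nat>" "t \<in> \<nat>" "s < t"
  then obtain m n where mn: "s = real m" "t = real n" "m < n" by (auto elim!: Nats_cases)
  have "distributed M lborel (\<lambda>\<omega>. \<Sum>i\<in>{m<..n}. V i \<omega>) (normal_density (\<Sum>i\<in>{m<..n}. 0) (sqrt (\<Sum>i\<in>{m<..n}. 1\<^sup>2)))"
    using mn(3) normal by (intro sum_indep_normal indep_vars_subset[OF V]) auto
  then show "distributed M lborel (\<lambda>\<omega>. walk V t \<omega> - walk V s \<omega>) (normal_density 0 (sqrt (t - s)))"
    using mn by (simp add: walk_diff of_nat_diff)
qed

text \<open>For finitely many variables independence says that the joint law is the product of the
  marginal laws, and laws ignore null sets.\<close>

lemma (in prob_space) indep_vars_cong_AE: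
  assumes I: "finite I" and X: "indep_vars M' X I"
    and Y: "\<And>i. i \<in> I \<Longrightarrow> random_variable (M' i) (Y i)"
    and eq: "\<And>i. i \<in> I \<Longrightarrow> AE \<omega> in M. X i \<omega> = Y i \<omega>"
  shows "indep_vars M' Y I"
proof (cases "I = {}")
  case False
  have Xm: "random_variable (M' i) (X i)" if "i \<in> I" for i
    using X that by (auto simp: indep_vars_def)
  have "AE \<omega> in M. \<forall>i\<in>I. X i \<omega> = Y i \<omega>" using I eq by (simp add: AE_finite_allI)
  then have AE: "AE \<omega> in M. (\<lambda>i\<in>I. X i \<omega>) = (\<lambda>i\<in>I. Y i \<omega>)"
    by eventually_elim (auto intro: restrict_ext)
  have "distr M (PiM I M') (\<lambda>\<omega>. \<lambda>i\<in>I. Y i \<omega>) = distr M (PiM I M') (\<lambda>\<omega>. \<lambda>i\<in>I. X i \<omega>)"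
    using AE by (intro distr_cong_AE) (auto intro!: measurable_restrict Xm Y)
  also have "\<dots> = PiM I (\<lambda>i. distr M (M' i) (X i))"
    using X by (simp add: indep_vars_iff_distr_eq_PiM'[OF False Xm])
  also have "\<dots> = PiM I (\<lambda>i. distr M (M' i) (Y i))"
    using eq by (intro PiM_cong distr_cong_AE) (auto intro: Xm Y)
  finally show ?thesis
    by (simp add: indep_vars_iff_distr_eq_PiM'[OF False Y])
qed (simp add: indep_vars_def indep_sets_def)

lemma distributed_cong_AE:
  assumes "distributed M N X f" "AE \<omega> in M. X \<omega> = Y \<omega>" "Y \<in> measurable M N"
  shows "distributed M N Y f"
proof -
  have "distr M N Y = distr M N X"
    using assms by (intro distr_cong_AE) (auto simp: distributed_def)
  then show ?thesis using assms by (simp add: distributed_def)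
qed

text \<open>\<open>standard_wiener\<close> gives the value 0 at time 0 only almost surely, whereas
  \<open>wiener_setting\<close> imposes it on \<open>X\<close> and \<open>Y\<close> at every point,
  and \<open>gauss2_incs\<close> asks the same of \<open>Z\<close>. The change affects a single time
  and a null set.\<close>

definition start_at_0 :: "(real \<Rightarrow> 'a \<Rightarrow> real) \<Rightarrow> real \<Rightarrow> 'a \<Rightarrow> real" where
  "start_at_0 B t \<omega> = (if t = 0 then 0 else B t \<omega>)"

lemma start_at_0_AE:
  assumes "standard_wiener M B"
  shows "AE \<omega> in M. B t \<omega> = start_at_0 B t \<omega>"
proof -
  have "AE \<omega> in M. B 0 \<omega> = 0" using assms by (simp add: standard_wiener_def)
  then show ?thesis by eventually_elim (simp add: start_at_0_def)
qed

lemma (in prob_space) gauss_incs_wiener: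
  assumes B: "standard_wiener M B"
  shows "gauss_incs M {0..} (start_at_0 B)"
  unfolding gauss_incs_def
proof (intro conjI ballI allI impI)
  have Bm: "B t \<in> borel_measurable M" if "0 \<le> t" for t
    using B that by (simp add: standard_wiener_def)
  have Sm: "start_at_0 B t \<in> borel_measurable M" if "0 \<le> t" for t
    using Bm[OF that] by (cases "t = 0") (simp_all add: start_at_0_def[abs_def])
  have diff_AE: "AE \<omega> in M. B t \<omega> - B s \<omega> = start_at_0 B t \<omega> - start_at_0 B s \<omega>" for s t
    using start_at_0_AE[OF B, of s] start_at_0_AE[OF B, of t] by eventually_elim simp
  show "start_at_0 B t \<in> borel_measurable M" if "t \<in> {0..}" for t using Sm that by simp
  show "start_at_0 B 0 \<omega> = 0" for \<omega> by (simp add: start_at_0_def)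
  show "indep_vars (\<lambda>_. borel) (\<lambda>i \<omega>. start_at_0 B (c (Suc i)) \<omega> - start_at_0 B (c i) \<omega>) {..<n}"
    if c: "(\<forall>i\<le>n. c i \<in> {0..}) \<and> (\<forall>i<n. c i < c (Suc i))" for n :: nat and c
  proof (rule indep_vars_cong_AE)
    show "indep_vars (\<lambda>_. borel) (\<lambda>i \<omega>. B (c (Suc i)) \<omega> - B (c i) \<omega>) {..<n}"
      using B c unfolding standard_wiener_def by simp
    show "random_variable borel (\<lambda>\<omega>. start_at_0 B (c (Suc i)) \<omega> - start_at_0 B (c i) \<omega>)" if "i \<in> {..<n}" for i
      using c that by (intro borel_measurable_diff Sm) auto
  qed (use diff_AE in auto)
  show "distributed M lborel (\<lambda>\<omega>. start_at_0 B t \<omega> - start_at_0 B s \<omega>) (normal_density 0 (sqrt (t - s)))"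
    if "s \<in> {0..}" "t \<in> {0..}" "s < t" for s t
  proof (rule distributed_cong_AE[OF _ diff_AE])
    show "distributed M lborel (\<lambda>\<omega>. B t \<omega> - B s \<omega>) (normal_density 0 (sqrt (t - s)))"
      using B that unfolding standard_wiener_def by simp
    show "(\<lambda>\<omega>. start_at_0 B t \<omega> - start_at_0 B s \<omega>) \<in> measurable M lborel"
      using Sm that by (simp add: borel_measurable_diff)
  qed
qed

lemma gaussian_walk_gauss2_path:
  assumes "gaussian_walk_setting M \<epsilon> X Y"
  obtains Z where "gauss2_path M \<nat> Z"
    and "\<And>\<omega> t. \<omega> \<in> space M \<Longrightarrow> t \<in> \<nat> \<Longrightarrow> X t \<omega> = fst (Z t \<omega>) \<and> Y t \<omega> = fst (Z t \<omega>) + \<epsilon> * snd (Z t \<omega>)"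
proof -
  interpret prob_space M using assms by (simp add: gaussian_walk_setting_def)
  obtain V W :: "nat \<Rightarrow> 'a \<Rightarrow> real" where
    V: "indep_vars (\<lambda>_. borel) V {1..}" "\<And>i. 1 \<le> i \<Longrightarrow> distributed M lborel (V i) std_normal_density"
    and W: "indep_vars (\<lambda>_. borel) W {1..}" "\<And>i. 1 \<le> i \<Longrightarrow> distributed M lborel (W i) std_normal_density"
    and VW: "indep_var (PiM {1..} (\<lambda>_. borel)) (\<lambda>\<omega>. \<lambda>i\<in>{1..}. V i \<omega>) (PiM {1..} (\<lambda>_. borel)) (\<lambda>\<omega>. \<lambda>i\<in>{1..}. W i \<omega>)"
    and XY: "\<And>\<omega> n. \<omega> \<in> space M \<Longrightarrow> X (real n) \<omega> = (\<Sum>i=1..n. V i \<omega>) \<and> Y (real n) \<omega> = X (real n) \<omega> + \<epsilon> * (\<Sum>i=1..n. W i \<omega>)"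
    using assms unfolding gaussian_walk_setting_def by blast
  have sums: "(\<lambda>w. \<lambda>t\<in>(\<nat> :: real set). \<Sum>i=1..nat \<lfloor>t\<rfloor>. w i) \<in> measurable (PiM {1..} (\<lambda>_. borel :: real measure)) (PiM \<nat> (\<lambda>_. borel))"
    by (intro measurable_restrict borel_measurable_sum measurable_component_singleton) auto
  have "(\<lambda>w. \<lambda>t\<in>(\<nat> :: real set). \<Sum>i=1..nat \<lfloor>t\<rfloor>. w i) \<circ> (\<lambda>\<omega>. \<lambda>i\<in>{1..}. U i \<omega>) = (\<lambda>\<omega>. \<lambda>t\<in>\<nat>. walk U t \<omega>)"
    for U :: "nat \<Rightarrow> 'a \<Rightarrow> real"
    by (auto simp: fun_eq_iff walk_def)
  with indep_var_compose[OF VW sums sums]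
  have "indep_var (PiM \<nat> (\<lambda>_. borel)) (\<lambda>\<omega>. \<lambda>t\<in>\<nat>. walk V t \<omega>) (PiM \<nat> (\<lambda>_. borel)) (\<lambda>\<omega>. \<lambda>t\<in>\<nat>. walk W t \<omega>)"
    by (simp only:)
  then interpret Z: gauss2_incs M \<nat> "\<lambda>t \<omega>. (walk V t \<omega>, walk W t \<omega>)"
    by (intro gauss2_incs_pair gauss_incs_walk V W) auto
  \<comment> \<open>The natural numbers are 1-separated, so every path on them is continuous and the
    continuity assumption is automatic.\<close>
  have cont: "continuous_on \<nat> z" for z :: "real \<Rightarrow> real \<times> real"
  proof (unfold continuous_on_iff, intro ballI allI impI)
    fix x e :: real assume "x \<in> \<nat>" "0 < e"
    then obtain k where k: "x = real k" by (auto elim: Nats_cases)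
    have "dist (z y) (z x) < e" if "y \<in> \<nat>" "dist y x < 1" for y
    proof -
      obtain l where l: "y = real l" using \<open>y \<in> \<nat>\<close> by (auto elim: Nats_cases)
      then have "real l < real (k + 1)" "real k < real (l + 1)" using that(2) k by (auto simp: dist_real_def)
      then have "l = k" unfolding of_nat_less_iff by simp
      then show ?thesis using k l \<open>0 < e\<close> by simp
    qed
    then show "\<exists>d>0. \<forall>y\<in>\<nat>. dist y x < d \<longrightarrow> dist (z y) (z x) < e" by (intro exI[of _ 1]) auto
  qed
  have "gauss2_path M \<nat> (\<lambda>t \<omega>. (walk V t \<omega>, walk W t \<omega>))"
    by unfold_locales (simp add: cont)
  moreover have "X t \<omega> = walk V t \<omega> \<and> Y t \<omega> = walk V t \<omega> + \<epsilon> * walk W t \<omega>" if "\<omega> \<in> space M" "t \<in> \<nat>" for \<omega> t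
    using XY[OF that(1)] that(2) by (auto simp: walk_def elim!: Nats_cases)
  ultimately show ?thesis by (intro that[of "\<lambda>t \<omega>. (walk V t \<omega>, walk W t \<omega>)"]) auto
qed

lemma wiener_gauss2_path:
  assumes "wiener_setting M \<epsilon> X Y"
  obtains Z where "gauss2_path M {0..} Z"
    and "\<And>\<omega> t. \<omega> \<in> space M \<Longrightarrow> t \<in> {0..} \<Longrightarrow> X t \<omega> = fst (Z t \<omega>) \<and> Y t \<omega> = fst (Z t \<omega>) + \<epsilon> * snd (Z t \<omega>)"
proof -
  interpret prob_space M using assms by (simp add: wiener_setting_def)
  obtain B N :: "real \<Rightarrow> 'a \<Rightarrow> real" where B: "standard_wiener M B" and N: "standard_wiener M N"
    and BN: "indep_var (PiM {0..} (\<lambda>_. borel)) (\<lambda>\<omega>. \<lambda>t\<in>{0..}. B t \<omega>) (PiM {0..} (\<lambda>_. borel)) (\<lambda>\<omega>. \<lambda>t\<in>{0..}. N t \<omega>)"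
    and XY: "\<And>\<omega>. \<omega> \<in> space M \<Longrightarrow> X 0 \<omega> = 0 \<and> Y 0 \<omega> = 0 \<and> (\<forall>t>0. X t \<omega> = B t \<omega> \<and> Y t \<omega> = X t \<omega> + \<epsilon> * N t \<omega>)"
    using assms unfolding wiener_setting_def by blast
  \<comment> \<open>Overwriting the value at time 0 is a measurable map of paths, so independence of
    the two paths is kept.\<close>
  have mod: "(\<lambda>w. \<lambda>t\<in>{0::real..}. if t = 0 then 0 else w t) \<in> measurable (PiM {0..} (\<lambda>_. borel :: real measure)) (PiM {0..} (\<lambda>_. borel))"
  proof (rule measurable_restrict)
    fix t :: real assume "t \<in> {0..}"
    then show "(\<lambda>w. if t = 0 then 0 else w t) \<in> borel_measurable (PiM {0..} (\<lambda>_. borel :: real measure))"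
      by (cases "t = 0") (auto intro: measurable_component_singleton)
  qed
  have "(\<lambda>w. \<lambda>t\<in>{0..}. if t = 0 then 0 else w t) \<circ> (\<lambda>\<omega>. \<lambda>t\<in>{0..}. U t \<omega>) = (\<lambda>\<omega>. \<lambda>t\<in>{0..}. start_at_0 U t \<omega>)"
    for U :: "real \<Rightarrow> 'a \<Rightarrow> real"
    by (auto simp: fun_eq_iff start_at_0_def)
  with indep_var_compose[OF BN mod mod]
  have "indep_var (PiM {0..} (\<lambda>_. borel)) (\<lambda>\<omega>. \<lambda>t\<in>{0..}. start_at_0 B t \<omega>)
      (PiM {0..} (\<lambda>_. borel)) (\<lambda>\<omega>. \<lambda>t\<in>{0..}. start_at_0 N t \<omega>)"
    by (simp only:)
  then interpret Z: gauss2_incs M "{0..}" "\<lambda>t \<omega>. (start_at_0 B t \<omega>, start_at_0 N t \<omega>)"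
    by (intro gauss2_incs_pair gauss_incs_wiener B N) auto
  have "AE \<omega> in M. continuous_on {0..} (\<lambda>t. start_at_0 U t \<omega>)" if U: "standard_wiener M U" for U
  proof -
    have "AE \<omega> in M. U 0 \<omega> = 0" "AE \<omega> in M. continuous_on {0..} (\<lambda>t. U t \<omega>)"
      using U by (auto simp: standard_wiener_def)
    then show ?thesis
    proof eventually_elim
      case (elim \<omega>)
      then have "start_at_0 U t \<omega> = U t \<omega>" for t by (simp add: start_at_0_def)
      then show ?case using elim by simp
    qed
  qed
  from this[OF B] this[OF N]
  have "AE \<omega> in M. continuous_on {0..} (\<lambda>t. (start_at_0 B t \<omega>, start_at_0 N t \<omega>))"
    by eventually_elim (rule continuous_on_Pair)
  then have "gauss2_path M {0..} (\<lambda>t \<omega>. (start_at_0 B t \<omega>, start_at_0 N t \<omega>))"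
    by unfold_locales
  moreover have "X t \<omega> = start_at_0 B t \<omega> \<and> Y t \<omega> = start_at_0 B t \<omega> + \<epsilon> * start_at_0 N t \<omega>"
    if "\<omega> \<in> space M" "t \<in> {0..}" for \<omega> t
    using XY[OF that(1)] that(2) by (auto simp: start_at_0_def)
  ultimately show ?thesis by (intro that[of "\<lambda>t \<omega>. (start_at_0 B t \<omega>, start_at_0 N t \<omega>)"]) auto
qed

theorem theorem2p7:
  fixes M :: "'a measure" and X Y :: "real \<Rightarrow> 'a \<Rightarrow> real" and T :: "real set"
    and \<epsilon> \<l> :: real
  assumes "\<epsilon> > 0" and "\<l> > 0"
    and "(T = \<nat> \<and> gaussian_walk_setting M \<epsilon> X Y) \<or> (T = {0..} \<and> wiener_setting M \<epsilon> X Y)"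
  shows "(\<forall>f :: real \<Rightarrow> real. (\<forall>x\<ge>0. f x \<ge> 0) \<and> mono_on {0..} f \<and>
            (\<exists>h>0. (\<integral>\<^sup>+ \<omega>. extend_sup f (hitting_time T X h \<omega> / 2) \<partial>M) = \<infinity>) \<longrightarrow>
            (\<forall>\<eta>\<in>estimators T.
              (\<integral>\<^sup>+ \<omega>. extend_sup f \<bar>hitting_time T X \<l> \<omega> - \<eta> (observation T Y \<omega>)\<bar> \<partial>M) = \<infinity>))
       \<and> (\<forall>p::real. p \<ge> 1/2 \<longrightarrow>
            (\<forall>h>0. (\<integral>\<^sup>+ \<omega>. extend_sup (\<lambda>x. x powr p) (hitting_time T X h \<omega> / 2) \<partial>M) = \<infinity>) \<and>
            (\<forall>\<eta>\<in>estimators T.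
              (\<integral>\<^sup>+ \<omega>. extend_sup (\<lambda>x. x powr p)
                 \<bar>hitting_time T X \<l> \<omega> - \<eta> (observation T Y \<omega>)\<bar> \<partial>M) = \<infinity>))"
proof -
  obtain Z where "gauss2_path M T Z"
    and XY: "\<And>\<omega> t. \<omega> \<in> space M \<Longrightarrow> t \<in> T \<Longrightarrow> X t \<omega> = fst (Z t \<omega>) \<and> Y t \<omega> = fst (Z t \<omega>) + \<epsilon> * snd (Z t \<omega>)"
    using assms(3) by (auto elim: gaussian_walk_gauss2_path wiener_gauss2_path)
  then interpret gauss2_path M T Z by simp
  \<comment> \<open>The infimum in \<open>hitting_time\<close> runs over all of \<open>T\<close>;
    for almost every outcome it equals its version on rational times, so both have the same
    integrals.\<close>
  have hit: "AE \<omega> in M. hitting_time T X h \<omega> = hit T h (\<lambda>t. fst (Z t \<omega>))" for h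
    using cont AE_space
  proof eventually_elim
    case (elim \<omega>)
    have "{ereal t |t. t \<in> T \<and> h \<le> X t \<omega>} = {ereal t |t. t \<in> T \<and> h \<le> fst (Z t \<omega>)}"
      using XY[OF elim(2)] by auto
    moreover have "continuous_on T (\<lambda>t. fst (Z t \<omega>))" using elim(1) by (rule continuous_on_fst)
    ultimately show ?case by (simp add: hitting_time_def hit_eq[OF T_cases])
  qed
  have obs: "observation T Y \<omega> = (\<lambda>t\<in>T. fst (Z t \<omega>) + \<epsilon> * snd (Z t \<omega>))" if "\<omega> \<in> space M" for \<omega>
    unfolding observation_def using XY[OF that] by (intro restrict_ext) auto
  have tau: "(\<integral>\<^sup>+\<omega>. extend_sup f (hitting_time T X h \<omega> / 2) \<partial>M) =
      (\<integral>\<^sup>+\<omega>. extend_sup f (hit T h (\<lambda>t. fst (Z t \<omega>)) / 2) \<partial>M)" for f h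
    by (rule nn_integral_cong_AE) (use hit[of h] in eventually_elim, simp)
  have err: "(\<integral>\<^sup>+\<omega>. extend_sup f \<bar>hitting_time T X \<l> \<omega> - \<eta> (observation T Y \<omega>)\<bar> \<partial>M) =
      (\<integral>\<^sup>+\<omega>. extend_sup f \<bar>hit T \<l> (\<lambda>t. fst (Z t \<omega>)) - \<eta> (\<lambda>t\<in>T. fst (Z t \<omega>) + \<epsilon> * snd (Z t \<omega>))\<bar> \<partial>M)" for f \<eta>
    by (rule nn_integral_cong_AE) (use hit[of \<l>] AE_space in eventually_elim, simp add: obs)
  have i: "(\<integral>\<^sup>+\<omega>. extend_sup f \<bar>hitting_time T X \<l> \<omega> - \<eta> (observation T Y \<omega>)\<bar> \<partial>M) = \<infinity>"
    if "mono_on {0..} f" "(\<integral>\<^sup>+\<omega>. extend_sup f (hitting_time T X h \<omega> / 2) \<partial>M) = \<infinity>" "\<eta> \<in> estimators T" for f h \<eta>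
    unfolding err
    by (rule estimation_error_infinite[OF assms(1,2) that(1) _ that(2)[unfolded tau]])
      (use that(3) in \<open>simp add: estimators_def\<close>)
  have ii: "(\<integral>\<^sup>+\<omega>. extend_sup (\<lambda>x. x powr p) (hitting_time T X h \<omega> / 2) \<partial>M) = \<infinity>"
    if "1 / 2 \<le> p" "h > 0" for p h
    unfolding tau by (rule hit_powr_infinite[OF that])
  show ?thesis
  proof (intro conjI allI impI ballI)
    fix f :: "real \<Rightarrow> real" and \<eta>
    assume "(\<forall>x\<ge>0. f x \<ge> 0) \<and> mono_on {0..} f \<and> (\<exists>h>0. (\<integral>\<^sup>+ \<omega>. extend_sup f (hitting_time T X h \<omega> / 2) \<partial>M) = \<infinity>)"
      and "\<eta> \<in> estimators T"
    then show "(\<integral>\<^sup>+ \<omega>. extend_sup f \<bar>hitting_time T X \<l> \<omega> - \<eta> (observation T Y \<omega>)\<bar> \<partial>M) = \<infinity>"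
      using i by blast
  next
    fix p \<eta> assume p: "1 / 2 \<le> (p::real)" and \<eta>: "\<eta> \<in> estimators T"
    have "mono_on {0..} (\<lambda>x::real. x powr p)" using p by (intro mono_on_powr) simp
    \<comment> \<open>The level 1 is an arbitrary positive witness for the moment condition.\<close>
    from i[OF this ii[OF p zero_less_one] \<eta>]
    show "(\<integral>\<^sup>+ \<omega>. extend_sup (\<lambda>x. x powr p) \<bar>hitting_time T X \<l> \<omega> - \<eta> (observation T Y \<omega>)\<bar> \<partial>M) = \<infinity>" .
  qed (rule ii)
qed

end
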